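(* Let $c\in\mathbb{R}$ with $c<-3.75$, and let $Z(s)=\det(I-\mathcal{L}_s)$ be the dynamical zeta function associated to $f(z)=z^2+c$. Then for every $\epsilon>0$, $Z(s)$ has only finitely many zeros in the half plane $\mathrm{Re}(s)>1/2+\epsilon$.
   Context: Let $f(z)=z^2+c$ and $\zeta_c=\frac{1+\sqrt{1-4c}}{2}$, the largest fixed point of $f$; for $c<-2$ one has $2<\zeta_c<-c$. Fix $R\in(\zeta_c,-c)$ and let $D(0,R)$ be the open disc of radius $R$ centred at $0$ in $\mathbb{C}$. Define on $D(0,R)$ the two inverse branches $g_+(z)=\sqrt{z-c}$ and $g_-(z)=-\sqrt{z-c}$, where the square root is the holomorphic branch on $\mathbb{C}\setminus(-\infty,0]$ that is positive on $(0,\infty)$. Put $D_\pm=g_\pm(D(0,R))$; then $\overline{D_\pm}\subset D(0,R)$, and $D_+$, $D_-$ are disjoint. The Bergman space is $\mathcal{H}=\{u\in L^2(D_+\cup D_-): u \text{ is holomorphic on } D_+\cup D_-\}$. For $i\in\{+,-\}$ let $[g_i']$ be the holomorphic extension to $D_+\cup D_-$ of the function $|g_i'|$ on $\mathbb{R}\cap(D_+\cup D_-)$, i.e. $[g_i'(z)]=\frac{1}{2\sqrt{z-c}}$, and let $[g_i'(z)]^s=\exp(s\log[g_i'(z)])$ with the logarithm real for real $z$. For $s\in\mathbb{C}$, the Ruelle transfer operator $\mathcal{L}_s:\mathcal{H}\to\mathcal{H}$ is $$\mathcal{L}_su(z)=\sum_{i\in\{+,-\}}[g_i'(z)]^s\,u(g_i(z)),\qquad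 z\in D_+\cup D_-.$$ It is a trace class operator, and the dynamical zeta function is the Fredholm determinant $Z(s)=\det(I-\mathcal{L}_s)$, an entire function of $s$. *)

theory Defs
  imports "HOL-Complex_Analysis.Complex_Analysis"
begin

definition quad_map :: "real \<Rightarrow> complex \<Rightarrow> complex" where
  "quad_map c z = z\<^sup>2 + of_real c"

text \<open>The largest fixed point of \<open>quad_map c\<close>.\<close>

definition zeta_fix :: "real \<Rightarrow> real" where
  "zeta_fix c = (1 + sqrt (1 - 4 * c)) / 2"

text \<open>
  The inverse branches of \<open>quad_map c\<close>. Below they are only used on discs \<open>ball 0 R\<close> with \<open>R < -c\<close>, so
  \<open>z - c\<close> stays in the right half-plane, where \<open>csqrt\<close> is the holomorphic branch that is positive
  on the positive reals.
\<close>

definition g_plus :: "real \<Rightarrow> complex \<Rightarrow> complex" where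
  "g_plus c z = csqrt (z - of_real c)"

definition g_minus :: "real \<Rightarrow> complex \<Rightarrow> complex" where
  "g_minus c z = - csqrt (z - of_real c)"

definition D_plus :: "real \<Rightarrow> real \<Rightarrow> complex set" where
  "D_plus c R = g_plus c ` ball 0 R"

definition D_minus :: "real \<Rightarrow> real \<Rightarrow> complex set" where
  "D_minus c R = g_minus c ` ball 0 R"

lemma quad_map_zeta_fix:
  assumes "c \<le> 1 / 4"
  shows "quad_map c (of_real (zeta_fix c)) = of_real (zeta_fix c)"
proof -
  have "(sqrt (1 - 4 * c))\<^sup>2 = 1 - 4 * c"
    using assms by simp
  hence "(zeta_fix c)\<^sup>2 + c = zeta_fix c"
    by (simp add: zeta_fix_def power2_eq_square field_simps)
  thus ?thesis
    unfolding quad_map_def by (metis of_real_add of_real_power)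
qed

lemma quad_map_g_plus: "quad_map c (g_plus c z) = z"
  and quad_map_g_minus: "quad_map c (g_minus c z) = z"
  by (simp_all add: quad_map_def g_plus_def g_minus_def)

text \<open>
  The holomorphic extension of \<open>\<bar>g'\<bar>\<close> from the real line; it is the same function for both branches
  \<open>g = g_plus c\<close> and \<open>g = g_minus c\<close>. Its values lie in the right half-plane, so the principal
  logarithm in the complex power is the one that is real for real \<open>z\<close>.
\<close>

definition abs_deriv_ext :: "real \<Rightarrow> complex \<Rightarrow> complex" where
  "abs_deriv_ext c z = 1 / (2 * csqrt (z - of_real c))"

definition abs_deriv_pow :: "real \<Rightarrow> complex \<Rightarrow> complex \<Rightarrow> complex" where
  "abs_deriv_pow c s z = exp (s * Ln (abs_deriv_ext c z))"

text \<open>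
  Elements of the Bergman space of \<open>D\<close> are represented by functions on the whole plane that vanish
  off \<open>D\<close>, so that equality in the space is equality of functions.
\<close>

definition bergman :: "complex set \<Rightarrow> (complex \<Rightarrow> complex) set" where
  "bergman D = {u. u holomorphic_on D \<and> set_integrable lborel D (\<lambda>z. (cmod (u z))\<^sup>2) \<and>
                   (\<forall>z. z \<notin> D \<longrightarrow> u z = 0)}"

definition bergman_inner :: "complex set \<Rightarrow> (complex \<Rightarrow> complex) \<Rightarrow> (complex \<Rightarrow> complex) \<Rightarrow> complex" where
  "bergman_inner D u v = (LINT z:D|lborel. u z * cnj (v z))"

definition transfer_op :: "real \<Rightarrow> real \<Rightarrow> complex \<Rightarrow> (complex \<Rightarrow> complex) \<Rightarrow> (complex \<Rightarrow> complex)" where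
  "transfer_op c R s u = (\<lambda>z. if z \<in> D_plus c R \<union> D_minus c R
     then abs_deriv_pow c s z * u (g_plus c z) + abs_deriv_pow c s z * u (g_minus c z)
     else 0)"

text \<open>
  Fredholm determinants of trace class operators on a separable infinite-dimensional Hilbert space
  with carrier \<open>H\<close> and inner product \<open>ip\<close>, linear in the first argument.
\<close>

definition orthonormal_basis :: "'v set \<Rightarrow> ('v \<Rightarrow> 'v \<Rightarrow> complex) \<Rightarrow> (nat \<Rightarrow> 'v) \<Rightarrow> bool" where
  "orthonormal_basis H ip e \<longleftrightarrow>
     (\<forall>i. e i \<in> H) \<and>
     (\<forall>i j. ip (e i) (e j) = (if i = j then 1 else 0)) \<and>
     (\<forall>u\<in>H. (\<forall>i. ip u (e i) = 0) \<longrightarrow> ip u u = 0)"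

definition principal_minor :: "(nat \<Rightarrow> nat \<Rightarrow> complex) \<Rightarrow> nat set \<Rightarrow> complex" where
  "principal_minor A S = (\<Sum>p | p permutes S. of_int (sign p) * (\<Prod>i\<in>S. A i (p i)))"

text \<open>
  The trace of the \<open>k\<close>-th exterior power of \<open>T\<close>, computed in the orthonormal basis consisting of the
  \<open>e i\<^sub>1 \<and> \<dots> \<and> e i\<^sub>k\<close> with \<open>i\<^sub>1 < \<dots> < i\<^sub>k\<close>: the diagonal entry of \<open>T \<and> \<dots> \<and> T\<close> belonging to
  \<open>S = {i\<^sub>1, \<dots>, i\<^sub>k}\<close> is the principal minor on \<open>S\<close> of the matrix of \<open>T\<close> with respect to \<open>e\<close>.
\<close>

definition trace_exterior_power ::
    "('v \<Rightarrow> 'v \<Rightarrow> complex) \<Rightarrow> (nat \<Rightarrow> 'v) \<Rightarrow> nat \<Rightarrow> ('v \<Rightarrow> 'v) \<Rightarrow> complex" where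
  "trace_exterior_power ip e k T =
     (\<Sum>\<^sub>\<infinity>S\<in>{S. finite S \<and> card S = k}. principal_minor (\<lambda>i j. ip (T (e j)) (e i)) S)"

text \<open>
  The Fredholm determinant \<open>det (I - T) = (\<Sum>k. (-1) ^ k * tr (\<Lambda>\<^sup>k T))\<close>. For trace class \<open>T\<close> all the
  sums converge absolutely and the value does not depend on the orthonormal basis; the basis chosen
  here depends on the space only, not on \<open>T\<close>.
\<close>

definition fredholm_det_one_minus ::
    "'v set \<Rightarrow> ('v \<Rightarrow> 'v \<Rightarrow> complex) \<Rightarrow> ('v \<Rightarrow> 'v) \<Rightarrow> complex" where
  "fredholm_det_one_minus H ip T =
     (let e = (SOME e. orthonormal_basis H ip e)
      in \<Sum>k. (-1) ^ k * trace_exterior_power ip e k T)"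

definition dyn_zeta :: "real \<Rightarrow> real \<Rightarrow> complex \<Rightarrow> complex" where
  "dyn_zeta c R s =
     (let D = D_plus c R \<union> D_minus c R
      in fredholm_det_one_minus (bergman D) (bergman_inner D) (transfer_op c R s))"

end

(* The restriction of a function of the Bergman space to the real line suffices to control the zeros.
   If Z(s) = 0, then 1 is an eigenvalue of the transfer operator: since the branches map a disc into
   the interior of a smaller one, expanding images in powers of z factors the operator through
   sequences, L = P Q with P and Q Hilbert-Schmidt in any orthonormal basis, and the traces of the
   exterior powers of P Q equal those of the explicit, geometrically decaying matrix Q P. Its
   determinant is entire in s and can only vanish if the matrix has a fixed vector, which sums up to
   an eigenfunction v = L v.

   On the invariant interval [-\<zeta>, \<zeta>], with \<sigma> = Re s and t = Im s, write N for the integral of |v|^2.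
   The substitution y = sqrt (x - c) gives N \<le> \<theta> N + 2 |X| with \<theta> < 1 when \<sigma> > 1/2, where X is a
   correlation of v(y) with v(-y). Expanding v(y) and v(-y) by n-fold iteration of v = L v turns X into
   a sum over pairs of words whose first letters differ, of integrals with phase t (log g_w'(y) - log
   g_w'' (-y)). The bounds -1/8 \<le> (x - c) * slope \<le> 5/8 for the logarithmic derivatives make the
   derivative of every such phase at least a constant times |t|, so one integration by parts shows that
   X is at most N times a constant multiple of 2^n / |t| + (2 kappa)^n, where 2 kappa < 1. Choosing n and
   then |t| large forces v = 0. *)

theory Submission
  imports Defs "Jordan_Normal_Form.Determinant"
begin

section \<open>Traces of exterior powers of a product of matrices\<close>

text \<open>The determinant is defined through an orthonormal basis picked by \<open>SOME\<close>,
  of which nothing is known beyond its defining property. So such a basis must be shown to exist,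
  and the determinant must be brought into a form in which no basis occurs. Exchanging the two
  factors of the operator does this and also takes the place of trace class theory.

  The obstacle in the oscillation estimate is that an eigenfunction oscillates itself: its
  derivative has size |s|, so an integration by parts, which gains 1/|t|, gains nothing when the
  derivative falls on v. After n iterations v occurs only composed with words, whose derivatives are
  at most kappa^n, while the fast phases are explicit. The price is the number 2^n of words, lost in
  Cauchy-Schwarz. Here 2 kappa = 1/m, where m is the smallest value of sqrt (x - c) on the interval,
  so the balance is favourable because m > 1.\<close>

lemma principal_minor_image:
  assumes "inj_on f A" and "finite A"
  shows "principal_minor M (f ` A) = principal_minor (\<lambda>i j. M (f i) (f j)) A"
proof -
  have bij: "bij_betw (\<lambda>p. map_permutation A f p) {p. p permutes A} {p. p permutes (f ` A)}"
    using bij_betw_permutations[OF inj_on_imp_bij_betw[OF assms(1)]]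
    by (simp add: map_permutation_def restrict_id_def o_def)
  have eq: "map_permutation A f p (f a) = f (p a)" if "a \<in> A" for p a
    using that assms by (simp add: map_permutation_def restrict_id_def)
  show ?thesis
    unfolding principal_minor_def sum.reindex_bij_betw[OF bij, symmetric]
    by (intro sum.cong) (auto simp: prod.reindex[OF assms(1)] sign_map_permutation assms eq o_def
        intro!: prod.cong)
qed

lemma principal_minor_cong:
  assumes "\<And>i j. i \<in> S \<Longrightarrow> j \<in> S \<Longrightarrow> A i j = B i j"
  shows "principal_minor A S = principal_minor B S"
  unfolding principal_minor_def
  by (intro sum.cong refl arg_cong2[of _ _ _ _ "(*)"] prod.cong) (auto intro!: assms dest: permutes_in_image)

text \<open>Composing \<open>p\<close> with the transposition of two indices on which
  \<open>f\<close> agrees leaves the product over \<open>A\<close> unchanged and flips the sign, so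
  the sum equals its own negative.\<close>

lemma principal_minor_repeated_index:
  fixes M :: "nat \<Rightarrow> nat \<Rightarrow> complex"
  assumes "\<not> inj_on f A" and fin: "finite A"
  shows "principal_minor (\<lambda>i j. M (f i) (f j)) A = 0"
proof -
  obtain a b where ab: "a \<in> A" "b \<in> A" "a \<noteq> b" "f a = f b"
    using assms(1) by (auto simp: inj_on_def)
  let ?q = "Transposition.transpose a b"
  have q: "?q permutes A"
    using ab by (simp add: permutes_swap_id)
  have f: "f (?q x) = f x" for x
    using ab(4) by (auto simp: Transposition.transpose_def)
  define X where "X = principal_minor (\<lambda>i j. M (f i) (f j)) A"
  have "X = (\<Sum>p | p permutes A. of_int (sign (p \<circ> ?q)) * (\<Prod>i\<in>A. M (f i) (f ((p \<circ> ?q) i))))"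
    unfolding X_def principal_minor_def
    by (rule sum_permutations_compose_right[OF q])
  also have "\<dots> = (\<Sum>p | p permutes A. - (of_int (sign p) * (\<Prod>i\<in>A. M (f i) (f (p i)))))"
  proof (intro sum.cong refl)
    fix p assume "p \<in> {p. p permutes A}"
    then have p: "p permutes A" by simp
    have s: "sign (p \<circ> ?q) = - sign p"
    proof -
      have "permutation p" "permutation ?q"
        using p q fin permutation_permutes by blast+
      then show ?thesis
        using ab(3) by (simp add: sign_compose sign_swap_id)
    qed
    have "(\<Prod>i\<in>A. M (f i) (f (p i))) = (\<Prod>i\<in>A. M (f (?q i)) (f (p (?q i))))"
      using prod.permute[OF q, of "\<lambda>i. M (f i) (f (p i))"] by (simp add: o_def)
    then show "of_int (sign (p \<circ> ?q)) * (\<Prod>i\<in>A. M (f i) (f ((p \<circ> ?q) i))) =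
        - (of_int (sign p) * (\<Prod>i\<in>A. M (f i) (f (p i))))"
      by (simp add: s f)
  qed
  also have "\<dots> = - X"
    by (simp add: X_def principal_minor_def sum_negf)
  finally show ?thesis
    unfolding X_def by simp
qed

lemma has_sum_sum:
  fixes f :: "'i \<Rightarrow> 'a \<Rightarrow> 'b::topological_comm_monoid_add"
  assumes "finite I" and "\<And>i. i \<in> I \<Longrightarrow> (f i has_sum s i) X"
  shows "((\<lambda>x. \<Sum>i\<in>I. f i x) has_sum (\<Sum>i\<in>I. s i)) X"
  using assms by (induction I) (auto intro: has_sum_add has_sum_0)

abbreviation multi_indices :: "nat \<Rightarrow> (nat \<Rightarrow> nat) set" where
  "multi_indices n \<equiv> {..<n} \<rightarrow>\<^sub>E UNIV"

text \<open>Ordering the index set makes every principal minor appear \<open>n!\<close> times; multi-indices with a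
  repetition contribute nothing. This turns the sum over sets into a sum over a product space.\<close>

lemma infsum_principal_minor_multi_indices:
  assumes summ: "(\<lambda>i. principal_minor (\<lambda>a b. M (i a) (i b)) {..<n}) summable_on multi_indices n"
  shows "(\<Sum>\<^sub>\<infinity>i\<in>multi_indices n. principal_minor (\<lambda>a b. M (i a) (i b)) {..<n})
    = fact n * (\<Sum>\<^sub>\<infinity>S\<in>{S. finite S \<and> card S = n}. principal_minor M S)"
proof -
  let ?D = "\<lambda>i. principal_minor (\<lambda>a b. M (i a) (i b)) {..<n}"
  let ?Inj = "{i \<in> multi_indices n. inj_on i {..<n}}"
  let ?F = "{S::nat set. finite S \<and> card S = n}"
  let ?B = "\<lambda>S. {i \<in> {..<n} \<rightarrow>\<^sub>E S. inj_on i {..<n}}"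
  have sub: "?Inj \<subseteq> multi_indices n" by auto
  have img: "i ` {..<n} = S" if "S \<in> ?F" "i \<in> ?B S" for S i
  proof (rule card_subset_eq)
    show "finite S" "i ` {..<n} \<subseteq> S" using that by auto
    show "card (i ` {..<n}) = card S" using that by (auto simp: card_image)
  qed
  \<comment> \<open>Injective multi-indices are sorted by their range: over a set of
    \<open>n\<close> elements lie exactly its \<open>fact n\<close> enumerations.\<close>
  have bij: "bij_betw snd (Sigma ?F ?B) ?Inj"
  proof (rule bij_betwI[where g = "\<lambda>i. (i ` {..<n}, i)"])
    show "snd \<in> Sigma ?F ?B \<rightarrow> ?Inj" by (auto simp: PiE_def)
    show "(\<lambda>i. (i ` {..<n}, i)) \<in> ?Inj \<rightarrow> Sigma ?F ?B" by (auto simp: PiE_def card_image)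
    show "(\<lambda>i. (i ` {..<n}, i)) (snd x) = x" if "x \<in> Sigma ?F ?B" for x
      using that img by (cases x) auto
    show "snd ((\<lambda>i. (i ` {..<n}, i)) y) = y" for y by simp
  qed
  have "(\<Sum>\<^sub>\<infinity>i\<in>multi_indices n. ?D i) = (\<Sum>\<^sub>\<infinity>i\<in>?Inj. ?D i)"
    by (rule infsum_cong_neutral) (auto simp: principal_minor_repeated_index)
  also have "\<dots> = (\<Sum>\<^sub>\<infinity>x\<in>Sigma ?F ?B. ?D (snd x))"
    using infsum_reindex_bij_betw[OF bij, of ?D] by simp
  also have "\<dots> = (\<Sum>\<^sub>\<infinity>S\<in>?F. \<Sum>\<^sub>\<infinity>i\<in>?B S. ?D i)"
  proof -
    have "?D summable_on ?Inj"
      using summable_on_subset_banach[OF summ sub] .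
    then have "(\<lambda>x. ?D (snd x)) summable_on Sigma ?F ?B"
      using summable_on_reindex_bij_betw[OF bij, of ?D] by simp
    then show ?thesis
      using infsum_Sigma_banach[of "\<lambda>x. ?D (snd x)" ?F ?B] by simp
  qed
  also have "\<dots> = (\<Sum>\<^sub>\<infinity>S\<in>?F. fact n * principal_minor M S)"
  proof (rule infsum_cong)
    fix S assume S: "S \<in> ?F"
    have fin: "finite (?B S)" using S by (intro finite_subset[OF _ finite_PiE[of "{..<n}" "\<lambda>_. S"]]) auto
    have D: "?D i = principal_minor M S" if "i \<in> ?B S" for i
      using img[OF S that] principal_minor_image[of i "{..<n}" M] that by auto
    have "card (?B S) = fact n"
      using card_inj_on_subset_funcset[of "{..<n}" S "{..<n}"] S
      by (simp add: fact_prod_rev lessThan_atLeast0)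
    then show "(\<Sum>\<^sub>\<infinity>i\<in>?B S. ?D i) = fact n * principal_minor M S"
      using fin by (simp add: D)
  qed
  also have "\<dots> = fact n * (\<Sum>\<^sub>\<infinity>S\<in>?F. principal_minor M S)"
    by (rule infsum_cmult_right')
  finally show ?thesis .
qed

text \<open>A finite family of pairs of multi-indices has all its entries in one finite set
  \<open>F\<close>, and over the full box on \<open>F\<close> the sum of products factors into the
  \<open>n\<close>-th power of a double sum over \<open>F\<close>. This bounds all finite partial
  sums.\<close>

lemma summable_on_prod_multi_indices:
  fixes w :: "nat \<Rightarrow> nat \<Rightarrow> real"
  assumes nn: "\<And>i k. 0 \<le> w i k" and summ: "(\<lambda>(i, k). w i k) summable_on UNIV"
  shows "(\<lambda>(i, k). \<Prod>a<n. w (i a) (k a)) summable_on multi_indices n \<times> multi_indices n"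
proof (rule nonneg_bdd_above_summable_on)
  let ?I = "multi_indices n"
  show "0 \<le> (\<lambda>(i, k). \<Prod>a<n. w (i a) (k a)) x" if "x \<in> ?I \<times> ?I" for x
    by (auto simp: nn split: prod.splits intro!: prod_nonneg)
  show "bdd_above (sum (\<lambda>(i, k). \<Prod>a<n. w (i a) (k a)) ` {F. F \<subseteq> ?I \<times> ?I \<and> finite F})"
  proof (rule bdd_aboveI2)
    fix X assume X: "X \<in> {F. F \<subseteq> ?I \<times> ?I \<and> finite F}"
    define F where "F = (\<Union>(i, k)\<in>X. i ` {..<n} \<union> k ` {..<n})"
    have finF: "finite F" unfolding F_def using X by auto
    have XF: "X \<subseteq> ({..<n} \<rightarrow>\<^sub>E F) \<times> ({..<n} \<rightarrow>\<^sub>E F)"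
    proof
      fix x assume x: "x \<in> X"
      obtain i k where ik: "x = (i, k)" by fastforce
      have "i \<in> ?I" "k \<in> ?I" using x ik X by auto
      moreover have "i ` {..<n} \<subseteq> F" "k ` {..<n} \<subseteq> F" using x ik unfolding F_def by blast+
      ultimately show "x \<in> ({..<n} \<rightarrow>\<^sub>E F) \<times> ({..<n} \<rightarrow>\<^sub>E F)"
        using ik by (auto simp: PiE_def)
    qed
    have "sum (\<lambda>(i, k). \<Prod>a<n. w (i a) (k a)) X
        \<le> sum (\<lambda>(i, k). \<Prod>a<n. w (i a) (k a)) (({..<n} \<rightarrow>\<^sub>E F) \<times> ({..<n} \<rightarrow>\<^sub>E F))"
      by (rule sum_mono2) (use XF finF in \<open>auto intro!: finite_PiE prod_nonneg nn\<close>)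
    also have "\<dots> = (\<Sum>i\<in>{..<n} \<rightarrow>\<^sub>E F. \<Sum>k\<in>{..<n} \<rightarrow>\<^sub>E F. \<Prod>a<n. w (i a) (k a))"
      by (simp add: sum.cartesian_product)
    also have "\<dots> = (\<Sum>i\<in>{..<n} \<rightarrow>\<^sub>E F. \<Prod>a<n. \<Sum>k\<in>F. w (i a) k)"
      by (subst prod_sum_PiE) (use finF in auto)
    also have "\<dots> = (\<Prod>a<n. \<Sum>j\<in>F. \<Sum>k\<in>F. w j k)"
      by (subst prod_sum_PiE) (use finF in auto)
    also have "\<dots> = (\<Sum>j\<in>F. \<Sum>k\<in>F. w j k) ^ n"
      by simp
    also have "\<dots> \<le> (\<Sum>\<^sub>\<infinity>(i, k). w i k) ^ n"
    proof (rule power_mono)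
      have "(\<Sum>j\<in>F. \<Sum>k\<in>F. w j k) = sum (\<lambda>(i, k). w i k) (F \<times> F)"
        by (simp add: sum.cartesian_product)
      also have "\<dots> \<le> (\<Sum>\<^sub>\<infinity>(i, k). w i k)"
        by (rule finite_sum_le_infsum[OF summ]) (use finF nn in auto)
      finally show "(\<Sum>j\<in>F. \<Sum>k\<in>F. w j k) \<le> (\<Sum>\<^sub>\<infinity>(i, k). w i k)" .
      show "0 \<le> (\<Sum>j\<in>F. \<Sum>k\<in>F. w j k)" by (intro sum_nonneg nn)
    qed
    finally show "sum (\<lambda>(i, k). \<Prod>a<n. w (i a) (k a)) X \<le> (\<Sum>\<^sub>\<infinity>(i, k). w i k) ^ n" .
  qed
qed

lemma bij_betw_multi_indices_permute:
  assumes p: "p permutes {..<n}"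
  shows "bij_betw (\<lambda>i. i \<circ> p) (multi_indices n) (multi_indices n)"
proof (rule bij_betwI[where g = "\<lambda>i. i \<circ> Hilbert_Choice.inv p"])
  have *: "i \<circ> q \<in> multi_indices n" if "i \<in> multi_indices n" "q permutes {..<n}" for i q
    using that by (auto simp: PiE_def extensional_def permutes_not_in)
  show "(\<lambda>i. i \<circ> p) \<in> multi_indices n \<rightarrow> multi_indices n"
    using * p by blast
  show "(\<lambda>i. i \<circ> Hilbert_Choice.inv p) \<in> multi_indices n \<rightarrow> multi_indices n"
    using * permutes_inv[OF p] by blast
qed (auto simp: fun_eq_iff permutes_inverses[OF p])

lemma summable_mult_of_square_summable:
  fixes f g :: "'a \<Rightarrow> complex"
  assumes "(\<lambda>x. (cmod (f x))\<^sup>2) summable_on X" "(\<lambda>x. (cmod (g x))\<^sup>2) summable_on X"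
  shows "(\<lambda>x. norm (f x * g x)) summable_on X"
proof (rule summable_on_comparison_test)
  show "(\<lambda>x. (cmod (f x))\<^sup>2 + (cmod (g x))\<^sup>2) summable_on X"
    by (intro summable_on_add assms)
  show "norm (f x * g x) \<le> (cmod (f x))\<^sup>2 + (cmod (g x))\<^sup>2" for x
  proof -
    have "0 \<le> cmod (f x) * cmod (g x)" by simp
    then show ?thesis
      using sum_squares_bound[of "cmod (f x)" "cmod (g x)"] unfolding norm_mult by linarith
  qed
qed auto

text \<open>Cyclicity of the trace on exterior powers. Written over multi-indices, both sides are
  the same signed sum of the terms \<open>W p i k\<close>, once summed over \<open>k\<close> first
  and once over \<open>i\<close> first; the square summability of \<open>P\<close> and
  \<open>Q\<close> permits the interchange.\<close>

theorem infsum_principal_minor_commute: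
  fixes P Q :: "nat \<Rightarrow> nat \<Rightarrow> complex"
  assumes P: "(\<lambda>(i, k). (cmod (P i k))\<^sup>2) summable_on UNIV"
    and Q: "(\<lambda>(k, i). (cmod (Q k i))\<^sup>2) summable_on UNIV"
  shows "(\<Sum>\<^sub>\<infinity>S\<in>{S. finite S \<and> card S = n}. principal_minor (\<lambda>i j. \<Sum>\<^sub>\<infinity>k. P i k * Q k j) S)
    = (\<Sum>\<^sub>\<infinity>S\<in>{S. finite S \<and> card S = n}. principal_minor (\<lambda>k l. \<Sum>\<^sub>\<infinity>i. Q k i * P i l) S)"
proof -
  define A where "A = (\<lambda>i j. \<Sum>\<^sub>\<infinity>k. P i k * Q k j)"
  define B where "B = (\<lambda>k l. \<Sum>\<^sub>\<infinity>i. Q k i * P i l)"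
  let ?I = "multi_indices n"
  have Qs: "(\<lambda>(i, k). (cmod (Q k i))\<^sup>2) summable_on UNIV"
    using summable_on_swap[of "\<lambda>(k, i). (cmod (Q k i))\<^sup>2" UNIV UNIV] Q by (simp add: case_prod_unfold)
  have Prow: "(\<lambda>k. (cmod (P i k))\<^sup>2) summable_on UNIV" for i
    using summable_on_SigmaD1[of "\<lambda>i k. (cmod (P i k))\<^sup>2" UNIV "\<lambda>_. UNIV" i] P by simp
  have Pcol: "(\<lambda>i. (cmod (P i k))\<^sup>2) summable_on UNIV" for k
  proof -
    have "(\<lambda>(k, i). (cmod (P i k))\<^sup>2) summable_on UNIV"
      using summable_on_swap[of "\<lambda>(i, k). (cmod (P i k))\<^sup>2" UNIV UNIV] P by (simp add: case_prod_unfold)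
    then show ?thesis
      using summable_on_SigmaD1[of "\<lambda>k i. (cmod (P i k))\<^sup>2" UNIV "\<lambda>_. UNIV" k] by simp
  qed
  have Qrow: "(\<lambda>i. (cmod (Q k i))\<^sup>2) summable_on UNIV" for k
    using summable_on_SigmaD1[of "\<lambda>k i. (cmod (Q k i))\<^sup>2" UNIV "\<lambda>_. UNIV" k] Q by simp
  have Qcol: "(\<lambda>k. (cmod (Q k i))\<^sup>2) summable_on UNIV" for i
    using summable_on_SigmaD1[of "\<lambda>i k. (cmod (Q k i))\<^sup>2" UNIV "\<lambda>_. UNIV" i] Qs by simp
  define W where "W = (\<lambda>p i k. \<Prod>a<n. P (i a) (k a) * Q (k a) (i (p a)))"
  have W: "(\<lambda>x. norm (case x of (i, k) \<Rightarrow> W p i k)) summable_on ?I \<times> ?I" if p: "p permutes {..<n}" for p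
  proof -
    have 1: "(\<lambda>x. (cmod (case x of (i, k) \<Rightarrow> \<Prod>a<n. P (i a) (k a)))\<^sup>2) summable_on ?I \<times> ?I"
      using summable_on_prod_multi_indices[OF _ P, of n]
      by (simp add: case_prod_unfold prod_norm[symmetric] prod_power_distrib)
    have 2: "(\<lambda>x. (cmod (case x of (i, k) \<Rightarrow> \<Prod>a<n. Q (k a) (i a)))\<^sup>2) summable_on ?I \<times> ?I"
      using summable_on_prod_multi_indices[OF _ Qs, of n]
      by (simp add: case_prod_unfold prod_norm[symmetric] prod_power_distrib)
    \<comment> \<open>Precomposition with \<open>p\<close> permutes the multi-indices, so the square
      summability of the \<open>Q\<close> factor survives the twist of \<open>i\<close> by
      \<open>p\<close>.\<close>
    have bij: "bij_betw (map_prod (\<lambda>i. i \<circ> p) id) (?I \<times> ?I) (?I \<times> ?I)"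
      by (intro bij_betw_map_prod bij_betw_multi_indices_permute p bij_betw_id)
    have 3: "(\<lambda>x. (cmod (case x of (i, k) \<Rightarrow> \<Prod>a<n. Q (k a) (i (p a))))\<^sup>2) summable_on ?I \<times> ?I"
      using summable_on_reindex_bij_betw[OF bij, of "\<lambda>x. (cmod (case x of (i, k) \<Rightarrow> \<Prod>a<n. Q (k a) (i a)))\<^sup>2"] 2
      by (simp add: case_prod_unfold)
    show ?thesis
      using summable_mult_of_square_summable[OF 1 3]
      by (simp add: case_prod_unfold W_def prod.distrib)
  qed
  have W': "(\<lambda>(i, k). W p i k) summable_on ?I \<times> ?I" if p: "p permutes {..<n}" for p
    using W[OF p] by (rule abs_summable_summable)
  have rowA: "(\<Sum>\<^sub>\<infinity>k\<in>?I. W p i k) = (\<Prod>a<n. A (i a) (i (p a)))" for p i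
    unfolding W_def A_def
    by (rule infsum_prod_PiE_abs) (auto intro!: summable_mult_of_square_summable Prow Qcol)
  \<comment> \<open>Renumbering the factors by the inverse of \<open>p\<close> gathers the two
    factors that contain \<open>i b\<close>; only then does the sum over \<open>i\<close> split into
    a product of single sums.\<close>
  have colB: "(\<Sum>\<^sub>\<infinity>i\<in>?I. W p i k) = (\<Prod>a<n. B (k a) (k (p a)))" if p: "p permutes {..<n}" for p k
  proof -
    have ip: "Hilbert_Choice.inv p permutes {..<n}" using permutes_inv[OF p] .
    have "W p i k = (\<Prod>b<n. Q (k (Hilbert_Choice.inv p b)) (i b) * P (i b) (k b))" for i
    proof -
      have "(\<Prod>a<n. Q (k a) (i (p a))) = (\<Prod>b<n. Q (k (Hilbert_Choice.inv p b)) (i b))"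
        using prod.permute[OF ip, of "\<lambda>a. Q (k a) (i (p a))"] by (simp add: o_def permutes_inverses[OF p])
      then show ?thesis
        unfolding W_def prod.distrib by (simp add: mult.commute)
    qed
    then have "(\<Sum>\<^sub>\<infinity>i\<in>?I. W p i k) = (\<Prod>b<n. \<Sum>\<^sub>\<infinity>j. Q (k (Hilbert_Choice.inv p b)) j * P j (k b))"
      by (simp, intro infsum_prod_PiE_abs) (auto intro!: summable_mult_of_square_summable Pcol Qrow)
    also have "\<dots> = (\<Prod>b<n. B (k (Hilbert_Choice.inv p b)) (k b))" by (simp add: B_def)
    also have "\<dots> = (\<Prod>a<n. B (k a) (k (p a)))"
      using prod.permute[OF p, of "\<lambda>b. B (k (Hilbert_Choice.inv p b)) (k b)"] by (simp add: o_def permutes_inverses[OF p])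
    finally show ?thesis .
  qed
  let ?Perm = "{p. p permutes {..<n}}"
  have A_expand: "principal_minor (\<lambda>a b. A (i a) (i b)) {..<n} = (\<Sum>p\<in>?Perm. of_int (sign p) * (\<Sum>\<^sub>\<infinity>k\<in>?I. W p i k))" for i
    by (simp add: principal_minor_def rowA)
  have B_expand: "principal_minor (\<lambda>a b. B (k a) (k b)) {..<n} = (\<Sum>p\<in>?Perm. of_int (sign p) * (\<Sum>\<^sub>\<infinity>i\<in>?I. W p i k))" for k
    by (simp add: principal_minor_def colB)
  have sA: "(\<lambda>i. of_int (sign p) * (\<Sum>\<^sub>\<infinity>k\<in>?I. W p i k)) summable_on ?I" if "p \<in> ?Perm" for p
    using that summable_on_Sigma_banach[OF W'] by (intro summable_on_cmult_right) auto
  have W'': "(\<lambda>(k, i). W p i k) summable_on ?I \<times> ?I" if "p permutes {..<n}" for p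
    using summable_on_swap[of "\<lambda>(i, k). W p i k" ?I ?I] W'[OF that] by (simp add: case_prod_unfold)
  have sB: "(\<lambda>k. of_int (sign p) * (\<Sum>\<^sub>\<infinity>i\<in>?I. W p i k)) summable_on ?I" if "p \<in> ?Perm" for p
    using that summable_on_Sigma_banach[OF W''] by (intro summable_on_cmult_right) auto
  have finP: "finite ?Perm" by (rule finite_permutations) simp
  have "fact n * (\<Sum>\<^sub>\<infinity>S\<in>{S. finite S \<and> card S = n}. principal_minor A S)
      = (\<Sum>\<^sub>\<infinity>i\<in>?I. principal_minor (\<lambda>a b. A (i a) (i b)) {..<n})"
    by (rule infsum_principal_minor_multi_indices[symmetric])
       (unfold A_expand, rule has_sum_imp_summable, rule has_sum_sum[OF finP], rule has_sum_infsum, rule sA)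
  also have "\<dots> = (\<Sum>p\<in>?Perm. of_int (sign p) * (\<Sum>\<^sub>\<infinity>i\<in>?I. \<Sum>\<^sub>\<infinity>k\<in>?I. W p i k))"
    unfolding A_expand using infsumI[OF has_sum_sum[OF finP has_sum_infsum[OF sA]]] by (simp add: infsum_cmult_right')
  also have "\<dots> = (\<Sum>p\<in>?Perm. of_int (sign p) * (\<Sum>\<^sub>\<infinity>k\<in>?I. \<Sum>\<^sub>\<infinity>i\<in>?I. W p i k))"
    by (intro sum.cong refl arg_cong2[of _ _ _ _ "(*)"] infsum_swap_banach W') auto
  also have "\<dots> = (\<Sum>\<^sub>\<infinity>k\<in>?I. principal_minor (\<lambda>a b. B (k a) (k b)) {..<n})"
    unfolding B_expand using infsumI[OF has_sum_sum[OF finP has_sum_infsum[OF sB]]] by (simp add: infsum_cmult_right')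
  also have "\<dots> = fact n * (\<Sum>\<^sub>\<infinity>S\<in>{S. finite S \<and> card S = n}. principal_minor B S)"
    by (rule infsum_principal_minor_multi_indices)
       (unfold B_expand, rule has_sum_imp_summable, rule has_sum_sum[OF finP], rule has_sum_infsum, rule sB)
  finally show ?thesis
    unfolding A_def B_def by simp
qed

section \<open>Determinants of infinite matrices with geometric decay\<close>

text \<open>Turns decay in the sum of the elements of \<open>K\<close> into decay whose exponent is
  quadratic in \<open>card K\<close>, enough to beat the factorial from the number of
  permutations.\<close>

lemma sum_lessThan_card_le:
  fixes K :: "nat set"
  assumes "finite K"
  shows "\<Sum>{..<card K} \<le> \<Sum>K"
  using assms
proof (induction "card K" arbitrary: K)
  case (Suc n)
  then have ne: "K \<noteq> {}" by auto
  let ?m = "Max K"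
  have m: "?m \<in> K" using Suc.prems ne by simp
  have c: "card (K - {?m}) = n" using Suc m by simp
  have "\<Sum>{..<n} \<le> \<Sum>(K - {?m})"
    using Suc.hyps(1)[of "K - {?m}"] c Suc.prems by simp
  moreover have "n \<le> ?m"
  proof -
    have "K \<subseteq> {..?m}" using Suc.prems by auto
    from card_mono[OF _ this] show ?thesis using Suc.hyps(2) by simp
  qed
  moreover have "\<Sum>K = ?m + \<Sum>(K - {?m})"
    using m Suc.prems by (simp add: sum.remove)
  ultimately show ?case by (simp add: Suc.hyps(2)[symmetric] lessThan_Suc)
qed simp

text \<open>Consecutive values have ratio \<open>real (Suc n) * C * r ^ n\<close>, which tends to 0,
  so the sequence does not increase from some index on.\<close>

lemma bounded_fact_power_triangular:
  fixes C r :: real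
  assumes "0 \<le> C" "0 < r" "r < 1"
  obtains B where "0 \<le> B" "\<And>n. fact n * C ^ n * r ^ (\<Sum>{..<n}) \<le> B"
proof -
  define b where "b = (\<lambda>n. fact n * C ^ n * r ^ (\<Sum>{..<n}))"
  have nn: "0 \<le> b n" for n unfolding b_def using assms by simp
  have step: "b (Suc n) = b n * (real (Suc n) * C * r ^ n)" for n
    by (simp add: b_def lessThan_Suc power_add algebra_simps)
  have "(\<lambda>n. real n * r ^ n) \<longlonglongrightarrow> 0"
    using assms by (intro powser_times_n_limit_0) simp
  moreover have "(\<lambda>n. r ^ n) \<longlonglongrightarrow> 0"
    using assms by (intro LIMSEQ_power_zero) simp
  ultimately have "(\<lambda>n. (real n * r ^ n + r ^ n) * C) \<longlonglongrightarrow> (0 + 0) * C"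
    by (intro tendsto_mult tendsto_add tendsto_const)
  then have "eventually (\<lambda>n. (real n * r ^ n + r ^ n) * C < 1) sequentially"
    by (rule order_tendstoD) simp
  then obtain N where N: "\<And>n. n \<ge> N \<Longrightarrow> real (Suc n) * C * r ^ n < 1"
    by (auto simp: eventually_sequentially algebra_simps)
  define B where "B = Max (b ` {..N})"
  have "b n \<le> B" for n
  proof (induction n)
    case 0 show ?case unfolding B_def by (intro Max_ge) auto
  next
    case (Suc n)
    show ?case
    proof (cases "Suc n \<le> N")
      case True then show ?thesis unfolding B_def by (intro Max_ge) auto
    next
      case False
      then have "real (Suc n) * C * r ^ n \<le> 1" using N[of n] by simp
      then have "b (Suc n) \<le> b n * 1"
        unfolding step by (intro mult_left_mono nn)
      then show ?thesis using Suc by simp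
    qed
  qed
  then show ?thesis using that[of B] nn[of 0] order_trans unfolding b_def by blast
qed

text \<open>The sum over all subsets of \<open>{..<N}\<close> is the product of the factors
  \<open>r ^ k + 1\<close>, which is at most \<open>exp\<close> of a geometric series.\<close>

lemma summable_power_sum_finite_sets:
  fixes r :: real
  assumes "0 \<le> r" "r < 1"
  shows "(\<lambda>K. r ^ (\<Sum>K)) summable_on {K::nat set. finite K}"
proof (rule nonneg_bdd_above_summable_on)
  show "bdd_above (sum (\<lambda>K. r ^ \<Sum>K) ` {F. F \<subseteq> {K::nat set. finite K} \<and> finite F})"
  proof (rule bdd_aboveI2)
    fix X assume X: "X \<in> {F. F \<subseteq> {K::nat set. finite K} \<and> finite F}"
    have "finite (\<Union>X)" using X by auto
    then obtain N where "\<Union>X \<subseteq> {..<N}"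
      using finite_nat_iff_bounded by auto
    then have sub: "X \<subseteq> Pow {..<N}" by auto
    have "sum (\<lambda>K. r ^ \<Sum>K) X \<le> sum (\<lambda>K. r ^ \<Sum>K) (Pow {..<N})"
      by (rule sum_mono2[OF _ sub]) (use assms in auto)
    also have "\<dots> = (\<Prod>k<N. r ^ k + 1)"
      by (simp add: prod_add power_sum)
    also have "\<dots> \<le> (\<Prod>k<N. exp (r ^ k))"
      using assms by (intro prod_mono) (simp add: add.commute exp_ge_add_one_self)
    also have "\<dots> = exp (\<Sum>k<N. r ^ k)"
      by (simp add: exp_sum)
    also have "\<dots> \<le> exp (1 / (1 - r))"
      using sum_le_suminf[of "\<lambda>k. r ^ k" "{..<N}"] assms by (simp add: suminf_geometric summable_geometric)
    finally show "sum (\<lambda>K. r ^ \<Sum>K) X \<le> exp (1 / (1 - r))" .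
  qed
qed (use assms in simp)


definition geometric_decay :: "real \<Rightarrow> real \<Rightarrow> real \<Rightarrow> (nat \<Rightarrow> nat \<Rightarrow> complex) \<Rightarrow> bool" where
  "geometric_decay C \<alpha> \<beta> M \<longleftrightarrow> (\<forall>k l. cmod (M k l) \<le> C * \<alpha> ^ k * \<beta> ^ l)"

text \<open>Fredholm's expansion of det (I - M), kept as one unordered sum over finite index sets,
  so that truncation to an initial segment and grouping by cardinality are both rearrangements of
  it.\<close>

definition det_one_minus :: "(nat \<Rightarrow> nat \<Rightarrow> complex) \<Rightarrow> complex" where
  "det_one_minus M = (\<Sum>\<^sub>\<infinity>K\<in>{K. finite K}. (-1) ^ card K * principal_minor M K)"

definition truncated_det :: "(nat \<Rightarrow> nat \<Rightarrow> complex) \<Rightarrow> nat \<Rightarrow> complex" where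
  "truncated_det M N = principal_minor (\<lambda>i j. (if i = j then 1 else 0) - M i j) {..<N}"

text \<open>Along a permutation the powers of \<open>\<beta>\<close> only change places, so each of
  the \<open>fact (card K)\<close> terms has the same bound.\<close>

lemma norm_principal_minor_le:
  assumes M: "geometric_decay C \<alpha> \<beta> M" and pos: "0 \<le> C" "0 \<le> \<alpha>" "0 \<le> \<beta>" and "finite K"
  shows "cmod (principal_minor M K) \<le> fact (card K) * C ^ card K * (\<alpha> * \<beta>) ^ (\<Sum>K)"
proof -
  have "cmod (principal_minor M K) \<le> (\<Sum>p | p permutes K. cmod (of_int (sign p) * (\<Prod>i\<in>K. M i (p i))))"
    unfolding principal_minor_def by (rule norm_sum)
  also have "\<dots> \<le> (\<Sum>p | p permutes K. C ^ card K * (\<alpha> * \<beta>) ^ (\<Sum>K))"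
  proof (rule sum_mono)
    fix p assume "p \<in> {p. p permutes K}"
    then have p: "p permutes K" by simp
    have "cmod (of_int (sign p) * (\<Prod>i\<in>K. M i (p i))) = (\<Prod>i\<in>K. cmod (M i (p i)))"
      by (simp add: norm_mult prod_norm[symmetric] sign_def)
    also have "\<dots> \<le> (\<Prod>i\<in>K. C * \<alpha> ^ i * \<beta> ^ (p i))"
      using M by (intro prod_mono) (auto simp: geometric_decay_def)
    also have "\<dots> = C ^ card K * \<alpha> ^ (\<Sum>K) * (\<Prod>i\<in>K. \<beta> ^ (p i))"
      by (simp add: prod.distrib power_sum)
    also have "(\<Prod>i\<in>K. \<beta> ^ (p i)) = \<beta> ^ (\<Sum>K)"
      using prod.permute[OF p, of "\<lambda>i. \<beta> ^ i"] by (simp add: power_sum o_def)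
    finally show "cmod (of_int (sign p) * (\<Prod>i\<in>K. M i (p i))) \<le> C ^ card K * (\<alpha> * \<beta>) ^ (\<Sum>K)"
      by (simp add: power_mult_distrib mult.assoc)
  qed
  also have "\<dots> = fact (card K) * C ^ card K * (\<alpha> * \<beta>) ^ (\<Sum>K)"
    using card_permutations[OF refl \<open>finite K\<close>] by simp
  finally show ?thesis .
qed

text \<open>With \<open>r = sqrt (\<alpha> * \<beta>)\<close> the decay splits into two equal
  factors: one absorbs \<open>fact (card K) * C ^ card K\<close>, the other keeps the sum over
  \<open>K\<close> finite. The majorant depends on the constants only and not on \<open>M\<close>,
  which later gives convergence uniform in \<open>s\<close>.\<close>

lemma principal_minor_majorant:
  assumes "0 \<le> C" "0 < \<alpha>" "\<alpha> < 1" "0 < \<beta>" "\<beta> < 1"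
  obtains g :: "nat set \<Rightarrow> real" where
    "\<And>K. 0 \<le> g K" "g summable_on {K. finite K}"
    "\<And>M K. geometric_decay C \<alpha> \<beta> M \<Longrightarrow> finite K \<Longrightarrow> cmod (principal_minor M K) \<le> g K"
proof -
  define r where "r = sqrt (\<alpha> * \<beta>)"
  have ab: "0 < \<alpha> * \<beta>" "\<alpha> * \<beta> < 1"
    using assms mult_strict_mono[of \<alpha> 1 \<beta> 1] by simp_all
  have r: "0 < r" "r < 1" "\<alpha> * \<beta> = r * r"
    using ab unfolding r_def by simp_all
  obtain B where B: "0 \<le> B" "\<And>n. fact n * C ^ n * r ^ (\<Sum>{..<n}) \<le> B"
    using bounded_fact_power_triangular[OF assms(1) r(1,2)] by blast
  show thesis
  proof (rule that[of "\<lambda>K. B * r ^ (\<Sum>K)"])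
    show "0 \<le> B * r ^ (\<Sum>K)" for K using B r by simp
    show "(\<lambda>K. B * r ^ (\<Sum>K)) summable_on {K. finite K}"
      by (intro summable_on_cmult_right summable_power_sum_finite_sets) (use r in auto)
    fix M K assume M: "geometric_decay C \<alpha> \<beta> M" and K: "finite (K :: nat set)"
    have "cmod (principal_minor M K) \<le> fact (card K) * C ^ card K * (\<alpha> * \<beta>) ^ (\<Sum>K)"
      by (rule norm_principal_minor_le[OF M]) (use assms K in auto)
    also have "\<dots> = (fact (card K) * C ^ card K * r ^ (\<Sum>K)) * r ^ (\<Sum>K)"
      by (simp add: r(3) power_mult_distrib)
    also have "\<dots> \<le> (fact (card K) * C ^ card K * r ^ (\<Sum>{..<card K})) * r ^ (\<Sum>K)"
      using r assms sum_lessThan_card_le[OF K]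
      by (intro mult_right_mono mult_left_mono power_decreasing) auto
    also have "\<dots> \<le> B * r ^ (\<Sum>K)"
      using r B by (intro mult_right_mono) auto
    finally show "cmod (principal_minor M K) \<le> B * r ^ (\<Sum>K)" .
  qed
qed

text \<open>In every row of I - M either the entry of the identity or that of -M is chosen. A
  permutation contributes only if it fixes all rows of the first kind, so what remains are the
  permutations of the set \<open>K\<close> of rows of the second kind.\<close>

lemma truncated_det_eq_sum:
  "truncated_det M N = (\<Sum>K\<in>Pow {..<N}. (-1) ^ card K * principal_minor M K)"
proof -
  have "truncated_det M N = (\<Sum>p | p permutes {..<N}. of_int (sign p) *
      (\<Prod>i<N. (- M i (p i)) + (if i = p i then 1 else 0)))"
    by (simp add: truncated_det_def principal_minor_def)
  also have "\<dots> = (\<Sum>p | p permutes {..<N}. \<Sum>K\<in>Pow {..<N}. of_int (sign p) *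
      ((\<Prod>i\<in>K. - M i (p i)) * (\<Prod>i\<in>{..<N} - K. if i = p i then 1 else 0)))"
    by (simp only: prod_add[OF finite_lessThan] sum_distrib_left)
  also have "\<dots> = (\<Sum>K\<in>Pow {..<N}. \<Sum>p | p permutes {..<N}. of_int (sign p) *
      ((\<Prod>i\<in>K. - M i (p i)) * (\<Prod>i\<in>{..<N} - K. if i = p i then 1 else 0)))"
    by (rule sum.swap)
  also have "\<dots> = (\<Sum>K\<in>Pow {..<N}. (-1) ^ card K * principal_minor M K)"
  proof (rule sum.cong[OF refl])
    fix K assume K: "K \<in> Pow {..<N}"
    let ?g = "\<lambda>p. of_int (sign p) * ((\<Prod>i\<in>K. - M i (p i)) * (\<Prod>i\<in>{..<N} - K. if i = p i then 1 else (0::complex)))"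
    have "(\<Sum>p | p permutes {..<N}. ?g p) = (\<Sum>p | p permutes K. ?g p)"
    proof (rule sum.mono_neutral_right)
      show "finite {p. p permutes {..<N}}" by (rule finite_permutations) simp
      show "{p. p permutes K} \<subseteq> {p. p permutes {..<N}}" using K permutes_subset by blast
      show "\<forall>p\<in>{p. p permutes {..<N}} - {p. p permutes K}. ?g p = 0"
      proof
        fix p assume p: "p \<in> {p. p permutes {..<N}} - {p. p permutes K}"
        then obtain i where i: "i \<in> {..<N} - K" "i \<noteq> p i"
          using permutes_superset[of p "{..<N}" K] by force
        then have "(\<Prod>i\<in>{..<N} - K. if i = p i then 1 else (0::complex)) = 0"
          by (intro prod_zero bexI[of _ i]) auto
        then show "?g p = 0" by simp
      qed
    qed
    also have "\<dots> = (\<Sum>p | p permutes K. (-1) ^ card K * (of_int (sign p) * (\<Prod>i\<in>K. M i (p i))))"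
    proof (rule sum.cong[OF refl])
      fix p assume "p \<in> {p. p permutes K}"
      then have "(\<Prod>i\<in>{..<N} - K. if i = p i then 1 else (0::complex)) = 1"
        by (intro prod.neutral) (auto simp: permutes_not_in)
      moreover have "(\<Prod>i\<in>K. - M i (p i)) = (-1) ^ card K * (\<Prod>i\<in>K. M i (p i))"
        by (simp add: prod.distrib[symmetric] prod_constant[symmetric] del: prod_constant)
      ultimately show "?g p = (-1) ^ card K * (of_int (sign p) * (\<Prod>i\<in>K. M i (p i)))" by simp
    qed
    finally show "(\<Sum>p | p permutes {..<N}. ?g p) = (-1) ^ card K * principal_minor M K"
      by (simp add: principal_minor_def sum_distrib_left)
  qed
  finally show ?thesis .
qed

text \<open>The error is the sum over the finite sets not contained in \<open>{..<N}\<close>,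
  dominated by the tail of a majorant common to all \<open>M\<close> with the given decay.\<close>

lemma truncated_det_tendsto_uniformly:
  assumes "0 \<le> C" "0 < \<alpha>" "\<alpha> < 1" "0 < \<beta>" "\<beta> < 1"
  obtains \<tau> :: "nat \<Rightarrow> real" where "\<tau> \<longlonglongrightarrow> 0"
    "\<And>M N. geometric_decay C \<alpha> \<beta> M \<Longrightarrow> cmod (det_one_minus M - truncated_det M N) \<le> \<tau> N"
proof -
  obtain g :: "nat set \<Rightarrow> real" where g: "\<And>K. 0 \<le> g K" "g summable_on {K. finite K}"
    "\<And>M K. geometric_decay C \<alpha> \<beta> M \<Longrightarrow> finite K \<Longrightarrow> cmod (principal_minor M K) \<le> g K"
    using principal_minor_majorant[OF assms] by metis
  let ?F = "{K::nat set. finite K}"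
  define \<tau> where "\<tau> = (\<lambda>N. infsum g (?F - Pow {..<N}))"
  have gsub: "g summable_on X" if "X \<subseteq> ?F" for X
    using summable_on_subset_banach[OF g(2) that] .
  have sub: "Pow {..<N} \<subseteq> ?F" for N :: nat
    using finite_subset[of _ "{..<N}"] by auto
  have tau: "\<tau> N = infsum g ?F - (\<Sum>K\<in>Pow {..<N}. g K)" for N
    unfolding \<tau>_def using infsum_Diff[OF g(2) gsub[OF sub] sub, of N] by simp
  have "filterlim (\<lambda>N. Pow {..<N}) (finite_subsets_at_top ?F) sequentially"
    unfolding filterlim_finite_subsets_at_top
  proof (intro allI impI)
    fix X :: "nat set set" assume X: "finite X \<and> X \<subseteq> ?F"
    then have "finite (\<Union>X)" by auto
    then obtain N0 where "\<Union>X \<subseteq> {..<N0}" using finite_nat_iff_bounded by auto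
    then have *: "X \<subseteq> Pow {..<N}" if "N \<ge> N0" for N using that by fastforce
    have "finite (Pow {..<N}) \<and> X \<subseteq> Pow {..<N} \<and> Pow {..<N} \<subseteq> ?F" if "N \<ge> N0" for N
      using *[OF that] sub[of N] by simp
    then show "\<forall>\<^sub>F N in sequentially. finite (Pow {..<N}) \<and> X \<subseteq> Pow {..<N} \<and> Pow {..<N} \<subseteq> ?F"
      unfolding eventually_sequentially by blast
  qed
  moreover have "(sum g \<longlongrightarrow> infsum g ?F) (finite_subsets_at_top ?F)"
    using has_sum_infsum[OF g(2)] unfolding has_sum_def .
  ultimately have "(\<lambda>N. sum g (Pow {..<N})) \<longlonglongrightarrow> infsum g ?F"
    by (rule filterlim_compose[rotated])
  then have lim: "\<tau> \<longlonglongrightarrow> 0"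
    unfolding tau using tendsto_diff[OF tendsto_const, of _ _ _ "infsum g ?F"] by fastforce
  show thesis
  proof (rule that[OF lim])
    fix M N assume M: "geometric_decay C \<alpha> \<beta> M"
    let ?f = "\<lambda>K. (-1) ^ card K * principal_minor M K"
    have fg: "norm (?f K) \<le> g K" if "K \<in> ?F" for K
      using g(3)[OF M] that by (simp add: norm_mult norm_power)
    have abs: "(\<lambda>K. norm (?f K)) summable_on X" if "X \<subseteq> ?F" for X
      by (rule summable_on_comparison_test[OF gsub[OF that]]) (use fg that in auto)
    have fsub: "?f summable_on X" if "X \<subseteq> ?F" for X
      using abs[OF that] by (rule abs_summable_summable)
    have "det_one_minus M - truncated_det M N = infsum ?f (?F - Pow {..<N})"
      unfolding det_one_minus_def truncated_det_eq_sum
      using infsum_Diff[OF fsub[OF order_refl] fsub[OF sub] sub, of N] by simp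
    also have "norm \<dots> \<le> infsum (\<lambda>K. norm (?f K)) (?F - Pow {..<N})"
      by (rule norm_infsum_bound[OF abs]) auto
    also have "\<dots> \<le> \<tau> N"
      unfolding \<tau>_def by (rule infsum_mono[OF abs gsub]) (use fg in auto)
    finally show "cmod (det_one_minus M - truncated_det M N) \<le> \<tau> N" .
  qed
qed

text \<open>Grouping by cardinality leads back to the series of traces in
  \<open>fredholm_det_one_minus\<close>.\<close>

lemma det_one_minus_eq_suminf:
  assumes M: "geometric_decay C \<alpha> \<beta> M" and "0 \<le> C" "0 < \<alpha>" "\<alpha> < 1" "0 < \<beta>" "\<beta> < 1"
  shows "det_one_minus M = (\<Sum>n. (-1) ^ n * (\<Sum>\<^sub>\<infinity>S\<in>{S. finite S \<and> card S = n}. principal_minor M S))"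
proof -
  obtain g :: "nat set \<Rightarrow> real" where g: "\<And>K. 0 \<le> g K" "g summable_on {K. finite K}"
    "\<And>M K. geometric_decay C \<alpha> \<beta> M \<Longrightarrow> finite K \<Longrightarrow> cmod (principal_minor M K) \<le> g K"
    using principal_minor_majorant[OF assms(2-)] by metis
  let ?F = "{K::nat set. finite K}"
  let ?f = "\<lambda>K. (-1) ^ card K * principal_minor M K"
  let ?S = "Sigma UNIV (\<lambda>n. {S::nat set. finite S \<and> card S = n})"
  have "(\<lambda>K. norm (?f K)) summable_on ?F"
    by (rule summable_on_comparison_test[OF g(2)]) (use g(3)[OF M] in \<open>auto simp: norm_mult norm_power\<close>)
  then have s: "?f summable_on ?F" by (rule abs_summable_summable)
  have bij: "bij_betw snd ?S ?F"
    by (rule bij_betwI[where g = "\<lambda>K. (card K, K)"]) auto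
  have hs: "((\<lambda>x. ?f (snd x)) has_sum det_one_minus M) ?S"
    using has_sum_reindex_bij_betw[OF bij, of ?f] has_sum_infsum[OF s] by (simp add: det_one_minus_def)
  have "((\<lambda>n. \<Sum>\<^sub>\<infinity>K\<in>{S. finite S \<and> card S = n}. ?f K) has_sum det_one_minus M) UNIV"
  proof (rule has_sum_SigmaD[OF hs])
    fix n :: nat
    have "?f summable_on {S. finite S \<and> card S = n}"
      by (rule summable_on_subset_banach[OF s]) auto
    then show "((\<lambda>y. ?f (snd (n, y))) has_sum (\<Sum>\<^sub>\<infinity>K\<in>{S. finite S \<and> card S = n}. ?f K)) {S. finite S \<and> card S = n}"
      by (simp add: has_sum_infsum)
  qed
  moreover have "(\<Sum>\<^sub>\<infinity>K\<in>{S. finite S \<and> card S = n}. ?f K)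
      = (-1) ^ n * (\<Sum>\<^sub>\<infinity>S\<in>{S. finite S \<and> card S = n}. principal_minor M S)" for n
  proof -
    have "(\<Sum>\<^sub>\<infinity>K\<in>{S. finite S \<and> card S = n}. ?f K) = (\<Sum>\<^sub>\<infinity>K\<in>{S. finite S \<and> card S = n}. (-1) ^ n * principal_minor M K)"
      by (rule infsum_cong) auto
    then show ?thesis by (simp add: infsum_cmult_right')
  qed
  ultimately have "((\<lambda>n. (-1) ^ n * (\<Sum>\<^sub>\<infinity>S\<in>{S. finite S \<and> card S = n}. principal_minor M S)) has_sum det_one_minus M) UNIV"
    by simp
  from has_sum_imp_sums[OF this] show ?thesis by (simp add: sums_iff)
qed

section \<open>Finite determinants: kernel vectors and Schur complements\<close>

lemma det_mat_eq_principal_minor: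
  "Determinant.det (Matrix.mat N N (\<lambda>(i, j). A i j)) = principal_minor A {..<N}"
  by (simp add: Determinant.det_def principal_minor_def lessThan_atLeast0)

lemma principal_minor_eq_0D:
  assumes "principal_minor A {..<N} = 0"
  obtains x where "\<exists>k<N. x k \<noteq> 0" "\<And>k. k < N \<Longrightarrow> (\<Sum>l<N. A k l * x l) = 0"
proof -
  let ?A = "Matrix.mat N N (\<lambda>(i, j). A i j)"
  have "Determinant.det ?A = 0" using assms by (simp add: det_mat_eq_principal_minor)
  then obtain v where v: "v \<in> carrier_vec N" "v \<noteq> 0\<^sub>v N" "?A *\<^sub>v v = 0\<^sub>v N"
    using det_0_iff_vec_prod_zero[of ?A N] by auto
  show thesis
  proof (rule that[of "vec_index v"])
    show "\<exists>k<N. vec_index v k \<noteq> 0"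
      using v(1,2) by (metis carrier_vecD eq_vecI index_zero_vec(1) index_zero_vec(2))
    show "(\<Sum>l<N. A k l * vec_index v l) = 0" if "k < N" for k
    proof -
      have "vec_index (?A *\<^sub>v v) k = (\<Sum>l<N. A k l * vec_index v l)"
        using that v(1) by (simp add: scalar_prod_def lessThan_atLeast0)
      then show ?thesis using v(3) that by simp
    qed
  qed
qed

lemma principal_minor_last_column:
  assumes "\<And>i. i < N \<Longrightarrow> A i N = 0"
  shows "principal_minor A {..<Suc N} = A N N * principal_minor A {..<N}"
proof -
  let ?g = "\<lambda>p. of_int (sign p) * (\<Prod>i<Suc N. A i (p i))"
  have "principal_minor A {..<Suc N} = (\<Sum>p | p permutes {..<N}. ?g p)"
    unfolding principal_minor_def
  proof (rule sum.mono_neutral_right)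
    show "finite {p. p permutes {..<Suc N}}" by (rule finite_permutations) simp
    show "{p. p permutes {..<N}} \<subseteq> {p. p permutes {..<Suc N}}"
      using permutes_subset[of _ "{..<N}" "{..<Suc N}"] by auto
    show "\<forall>p\<in>{p. p permutes {..<Suc N}} - {p. p permutes {..<N}}. ?g p = 0"
    proof
      fix p assume p: "p \<in> {p. p permutes {..<Suc N}} - {p. p permutes {..<N}}"
      then have pN: "p N \<noteq> N"
        using permutes_superset[of p "{..<Suc N}" "{..<N}"] by (auto simp: lessThan_Suc)
      obtain i where i: "i < Suc N" "p i = N"
        using p permutes_image[of p "{..<Suc N}"] by (metis DiffD1 imageE lessThan_iff lessI mem_Collect_eq)
      then have "i < N" using pN by (auto simp: less_Suc_eq)
      then have "A i (p i) = 0" using assms i by simp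
      then have "(\<Prod>i<Suc N. A i (p i)) = 0" using i(1) by (intro prod_zero) auto
      then show "?g p = 0" by simp
    qed
  qed
  also have "\<dots> = (\<Sum>p | p permutes {..<N}. A N N * (of_int (sign p) * (\<Prod>i<N. A i (p i))))"
  proof (rule sum.cong[OF refl])
    fix p assume "p \<in> {p. p permutes {..<N}}"
    then have "p N = N" by (simp add: permutes_not_in)
    then show "?g p = A N N * (of_int (sign p) * (\<Prod>i<N. A i (p i)))" by simp
  qed
  finally show ?thesis by (simp add: principal_minor_def sum_distrib_left)
qed

text \<open>Multiplication from the right by a unipotent upper triangular matrix, whose determinant
  is 1.\<close>

lemma principal_minor_subtract_columns:
  "principal_minor A {..<Suc N} = principal_minor (\<lambda>i j. if j = N then A i N - (\<Sum>l<N. A i l * y l) else A i j) {..<Suc N}"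
proof -
  let ?A = "Matrix.mat (Suc N) (Suc N) (\<lambda>(i, j). A i j)"
  let ?E = "Matrix.mat (Suc N) (Suc N) (\<lambda>(i, j). if i = j then 1 else if j = N then - y i else 0)"
  let ?B = "Matrix.mat (Suc N) (Suc N) (\<lambda>(i, j). if j = N then A i N - (\<Sum>l<N. A i l * y l) else A i j)"
  have "upper_triangular ?E" by (auto simp: upper_triangular_def)
  then have E: "Determinant.det ?E = 1"
    using det_upper_triangular[of ?E "Suc N"] by (simp add: prod_list_diag_prod)
  have "?A * ?E = ?B"
  proof (rule eq_matI)
    fix i j assume ij: "i < dim_row ?B" "j < dim_col ?B"
    then have i: "i < Suc N" and j: "j < Suc N" by auto
    have "(?A * ?E) $$ (i, j) = (\<Sum>l<Suc N. A i l * (if l = j then 1 else if j = N then - y l else 0))"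
      using i j by (simp add: scalar_prod_def lessThan_atLeast0)
    also have "\<dots> = (if j = N then A i N - (\<Sum>l<N. A i l * y l) else A i j)"
    proof (cases "j = N")
      case True
      then show ?thesis by (simp add: sum_negf)
    next
      case False
      then have "(\<Sum>l<Suc N. A i l * (if l = j then 1 else if j = N then - y l else 0)) = (\<Sum>l<Suc N. if l = j then A i l else 0)"
        by (intro sum.cong) auto
      then show ?thesis using False j by simp
    qed
    finally show "(?A * ?E) $$ (i, j) = ?B $$ (i, j)" using i j by simp
  qed auto
  then have "Determinant.det ?B = Determinant.det ?A"
    using det_mult[of ?A "Suc N" ?E] E by simp
  then show ?thesis by (simp only: det_mat_eq_principal_minor)
qed

text \<open>The second factor is the Schur complement of the leading block. The vector
  \<open>y\<close> solves the leading system with the last column as right-hand side, and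
  subtracting the corresponding combination from the last column leaves only its bottom
  entry.\<close>

lemma bordered_determinant:
  assumes "principal_minor A {..<N} \<noteq> 0"
  obtains y where "\<And>k. k < N \<Longrightarrow> (\<Sum>l<N. A k l * y l) = A k N"
    "principal_minor A {..<Suc N} = principal_minor A {..<N} * (A N N - (\<Sum>l<N. A N l * y l))"
proof -
  \<comment> \<open>With its last row zeroed the matrix of size \<open>Suc N\<close> is singular.
    Its kernel vector has nonzero last coordinate, since the leading block is invertible; dividing
    by minus that coordinate yields \<open>y\<close>.\<close>
  define A' where "A' = (\<lambda>i j. if i = N then 0 else A i j)"
  have "principal_minor A' {..<Suc N} = 0"
    unfolding principal_minor_def
  proof (intro sum.neutral ballI)
    fix p
    have "(\<Prod>i<Suc N. A' i (p i)) = 0" by (intro prod_zero) (auto simp: A'_def)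
    then show "of_int (sign p) * (\<Prod>i<Suc N. A' i (p i)) = 0" by simp
  qed
  then obtain z where z: "\<exists>k<Suc N. z k \<noteq> 0" "\<And>k. k < Suc N \<Longrightarrow> (\<Sum>l<Suc N. A' k l * z l) = 0"
    using principal_minor_eq_0D by blast
  have z': "(\<Sum>l<N. A k l * z l) = - (A k N * z N)" if "k < N" for k
    using z(2)[of k] that by (simp add: A'_def add_eq_0_iff2)
  have zN: "z N \<noteq> 0"
  proof
    assume 0: "z N = 0"
    let ?A = "Matrix.mat N N (\<lambda>(i, j). A i j)"
    let ?v = "Matrix.vec N z"
    have "?A *\<^sub>v ?v = 0\<^sub>v N"
      by (rule eq_vecI) (use z' 0 in \<open>simp_all add: scalar_prod_def lessThan_atLeast0\<close>)
    moreover have "?v \<noteq> 0\<^sub>v N"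
      using z(1) 0 by (metis index_vec index_zero_vec(1) less_Suc_eq)
    ultimately have "Determinant.det ?A = 0"
      using det_0_iff_vec_prod_zero[of ?A N] vec_carrier[of N z] mat_carrier by blast
    then show False using assms by (simp add: det_mat_eq_principal_minor)
  qed
  define y where "y = (\<lambda>l. - z l / z N)"
  have y: "(\<Sum>l<N. A k l * y l) = A k N" if "k < N" for k
  proof -
    have "(\<Sum>l<N. A k l * y l) = - (\<Sum>l<N. A k l * z l) / z N"
      by (simp add: y_def sum_divide_distrib sum_negf)
    then show ?thesis using z'[OF that] zN by simp
  qed
  let ?B = "\<lambda>i j. if j = N then A i N - (\<Sum>l<N. A i l * y l) else A i j"
  have "principal_minor A {..<Suc N} = principal_minor ?B {..<Suc N}"
    by (rule principal_minor_subtract_columns)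
  also have "\<dots> = ?B N N * principal_minor ?B {..<N}"
    by (rule principal_minor_last_column) (simp add: y)
  also have "principal_minor ?B {..<N} = principal_minor A {..<N}"
    by (rule principal_minor_cong) simp
  finally show thesis using that[OF y] by (simp add: mult.commute)
qed

lemma geometric_decay_row:
  assumes M: "geometric_decay C \<alpha> \<beta> M" and "0 \<le> C" "0 < \<alpha>" "0 < \<beta>" "\<beta> < 1"
    and z: "\<And>l. cmod (z l) \<le> B"
  shows "summable (\<lambda>l. cmod (M k l * z l))" "cmod (\<Sum>l. M k l * z l) \<le> C * \<alpha> ^ k * B / (1 - \<beta>)"
    "cmod (\<Sum>l<N. M k l * z l) \<le> C * \<alpha> ^ k * B / (1 - \<beta>)"
proof -
  have le: "cmod (M k l * z l) \<le> C * \<alpha> ^ k * B * \<beta> ^ l" for l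
  proof -
    have "cmod (M k l * z l) \<le> (C * \<alpha> ^ k * \<beta> ^ l) * B"
      unfolding norm_mult using M z by (intro mult_mono) (auto simp: geometric_decay_def assms less_imp_le)
    then show ?thesis by (simp add: mult.commute mult.left_commute)
  qed
  have geo: "(\<lambda>l. C * \<alpha> ^ k * B * \<beta> ^ l) sums (C * \<alpha> ^ k * B * (1 / (1 - \<beta>)))"
    by (intro sums_mult geometric_sums) (use assms in auto)
  show s: "summable (\<lambda>l. cmod (M k l * z l))"
    by (rule summable_comparison_test'[OF sums_summable[OF geo]]) (use le in auto)
  have 2: "(\<Sum>l. cmod (M k l * z l)) \<le> C * \<alpha> ^ k * B / (1 - \<beta>)"
    using suminf_le[OF le s sums_summable[OF geo]] sums_unique[OF geo] by simp
  show "cmod (\<Sum>l. M k l * z l) \<le> C * \<alpha> ^ k * B / (1 - \<beta>)"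
    using summable_norm[OF s] 2 by linarith
  have "cmod (\<Sum>l<N. M k l * z l) \<le> (\<Sum>l<N. cmod (M k l * z l))" by (rule norm_sum)
  also have "\<dots> \<le> (\<Sum>l. cmod (M k l * z l))" by (rule sum_le_suminf[OF s]) auto
  finally show "cmod (\<Sum>l<N. M k l * z l) \<le> C * \<alpha> ^ k * B / (1 - \<beta>)" using 2 by linarith
qed

definition has_fixed_vector :: "(nat \<Rightarrow> nat \<Rightarrow> complex) \<Rightarrow> bool" where
  "has_fixed_vector M \<longleftrightarrow> (\<exists>y. bounded (range y) \<and> (\<exists>k. y k \<noteq> 0) \<and> (\<forall>k. y k = (\<Sum>l. M k l * y l)))"

text \<open>A sequence of unit vectors violating such a bound has, by the decay of the entries of \<open>M\<close>, a nonzero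
  pointwise limit along a subsequence, and that limit is a fixed vector.\<close>

lemma truncations_bounded_below:
  assumes M: "geometric_decay C \<alpha> \<beta> M" and C: "0 \<le> C" and al: "0 < \<alpha>" "\<alpha> < 1" and be: "0 < \<beta>" "\<beta> < 1"
    and no: "\<not> has_fixed_vector M"
  shows "\<exists>\<delta>>0. \<exists>N0. \<forall>N\<ge>N0. \<forall>x B. (\<forall>k<N. cmod (x k - (\<Sum>l<N. M k l * x l)) \<le> \<delta> * B) \<longrightarrow> (\<forall>k<N. cmod (x k) \<le> B)"
proof -
  define unit where "unit = (\<lambda>(N::nat) x. (\<forall>k<N. cmod (x k) \<le> 1) \<and> (\<exists>k<N. cmod (x k) = 1))"
  define small where "small = (\<lambda>\<delta> (N::nat) x. \<forall>k<N. cmod (x k - (\<Sum>l<N. M k l * x l)) < \<delta>)"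
  have "\<exists>\<delta>>0. \<exists>N0. \<forall>N\<ge>N0. \<forall>x. unit N x \<longrightarrow> \<not> small \<delta> N x"
  proof (rule ccontr)
    assume neg: "\<not> ?thesis"
    have "\<exists>N\<ge>j. \<exists>x. unit N x \<and> small (inverse (real (Suc j))) N x" for j
    proof -
      have "inverse (real (Suc j)) > 0" by simp
      with neg show ?thesis by meson
    qed
    then have "\<forall>j. \<exists>N x. N \<ge> j \<and> unit N x \<and> small (inverse (real (Suc j))) N x" by blast
    then obtain N X where NX: "\<And>j. N j \<ge> j \<and> unit (N j) (X j) \<and> small (inverse (real (Suc j))) (N j) (X j)"
      by metis
    have N: "\<And>j. N j \<ge> j" and X: "\<And>j k. k < N j \<Longrightarrow> cmod (X j k) \<le> 1"
      "\<And>j. \<exists>k<N j. cmod (X j k) = 1"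
      "\<And>j k. k < N j \<Longrightarrow> cmod (X j k - (\<Sum>l<N j. M k l * X j l)) < inverse (real (Suc j))"
      using NX unfolding unit_def small_def by blast+
    define Y where "Y = (\<lambda>j k. if k < N j then X j k else 0)"
    have Y1: "cmod (Y j k) \<le> 1" for j k using X(1) by (simp add: Y_def)
    have Ysum: "(\<Sum>l<N j. M k l * X j l) = (\<Sum>l. M k l * Y j l)" for j k
    proof -
      have "(\<Sum>l. M k l * Y j l) = (\<Sum>l<N j. M k l * Y j l)"
        by (rule suminf_finite) (auto simp: Y_def)
      also have "\<dots> = (\<Sum>l<N j. M k l * X j l)" by (rule sum.cong) (auto simp: Y_def)
      finally show ?thesis by simp
    qed
    have "\<exists>r. strict_mono r \<and> (\<forall>k. \<exists>l. (\<lambda>n. Y (r n) k) \<longlonglongrightarrow> l)"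
    proof (rule function_convergent_subsequence[of "UNIV::nat set" Y 1])
      show "norm (Y n k) \<le> 1" for n k by (rule Y1)
    qed auto
    then obtain r where r: "strict_mono r" "\<And>k. \<exists>l. (\<lambda>n. Y (r n) k) \<longlonglongrightarrow> l" by blast
    then obtain y where y: "\<And>k. (\<lambda>n. Y (r n) k) \<longlonglongrightarrow> y k" by metis
    have y1: "cmod (y k) \<le> 1" for k
      by (rule LIMSEQ_le_const2[OF tendsto_norm[OF y]]) (use Y1 in auto)
    have fix_y: "y k = (\<Sum>l. M k l * y l)" for k
    proof -
      \<comment> \<open>Tannery's theorem, with the decay along row \<open>k\<close> as majorant,
        takes the limit inside the row sums.\<close>
      have "eventually (\<lambda>(l, n). norm (M k l * Y (r n) l) \<le> C * \<alpha> ^ k * \<beta> ^ l) (at_top \<times>\<^sub>F sequentially)"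
      proof (intro always_eventually allI, clarify)
        fix l n
        have "norm (M k l) * norm (Y (r n) l) \<le> (C * \<alpha> ^ k * \<beta> ^ l) * 1"
          using M Y1 C al be by (intro mult_mono) (auto simp: geometric_decay_def less_imp_le)
        then show "norm (M k l * Y (r n) l) \<le> C * \<alpha> ^ k * \<beta> ^ l" by (simp add: norm_mult)
      qed
      moreover have "summable (\<lambda>l. C * \<alpha> ^ k * \<beta> ^ l)"
        using be by (intro summable_mult summable_geometric) auto
      ultimately have 1: "(\<lambda>n. \<Sum>l. M k l * Y (r n) l) \<longlonglongrightarrow> (\<Sum>l. M k l * y l)"
        using tannerys_theorem[of "\<lambda>l n. M k l * Y (r n) l" "\<lambda>l. M k l * y l" sequentially "\<lambda>l. C * \<alpha> ^ k * \<beta> ^ l"]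
        by (simp add: tendsto_mult_left y)
      have "(\<lambda>n. Y (r n) k - (\<Sum>l. M k l * Y (r n) l)) \<longlonglongrightarrow> 0"
      proof (rule Lim_null_comparison)
        have "cmod (Y (r n) k - (\<Sum>l. M k l * Y (r n) l)) \<le> inverse (real (Suc n))" if "k < n" for n
        proof -
          have "n \<le> r n" using r(1) by (rule seq_suble)
          also have "r n \<le> N (r n)" by (rule N)
          finally have kN: "k < N (r n)" using that by simp
          then have "cmod (Y (r n) k - (\<Sum>l. M k l * Y (r n) l)) \<le> inverse (real (Suc (r n)))"
            using X(3)[OF kN] by (simp add: Y_def Ysum[unfolded Y_def])
          also have "\<dots> \<le> inverse (real (Suc n))"
            using \<open>n \<le> r n\<close> by (intro le_imp_inverse_le) auto
          finally show ?thesis .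
        qed
        then show "\<forall>\<^sub>F n in sequentially. cmod (Y (r n) k - (\<Sum>l. M k l * Y (r n) l)) \<le> inverse (real (Suc n))"
          by (rule eventually_mono[OF eventually_gt_at_top[of k]])
        show "(\<lambda>n. inverse (real (Suc n))) \<longlonglongrightarrow> 0" by (rule LIMSEQ_inverse_real_of_nat)
      qed
      moreover have "(\<lambda>n. Y (r n) k - (\<Sum>l. M k l * Y (r n) l)) \<longlonglongrightarrow> y k - (\<Sum>l. M k l * y l)"
        by (intro tendsto_diff y 1)
      ultimately show ?thesis using LIMSEQ_unique by fastforce
    qed
    \<comment> \<open>Beyond an index \<open>k0\<close>, the same for all vectors, the entries of
      the image under \<open>M\<close> stay below 1/2. So once the residual is at most 1/2, a
      coordinate of modulus 1 must occur before \<open>k0\<close>, and the mass cannot escape to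
      infinity in the limit.\<close>
    have "(\<lambda>k. C * \<alpha> ^ k * 1 / (1 - \<beta>)) \<longlonglongrightarrow> C * 0 * 1 / (1 - \<beta>)"
      using al be by (intro tendsto_intros LIMSEQ_power_zero) auto
    then have "eventually (\<lambda>k. C * \<alpha> ^ k * 1 / (1 - \<beta>) < 1 / 2) sequentially"
      by (rule order_tendstoD) simp
    then obtain k0 where k0: "\<And>k. k \<ge> k0 \<Longrightarrow> C * \<alpha> ^ k * 1 / (1 - \<beta>) < 1 / 2"
      by (auto simp: eventually_sequentially)
    have big: "1 \<le> (\<Sum>k<k0. cmod (Y j k))" if "j \<ge> 1" for j
    proof -
      obtain k where k: "k < N j" "cmod (X j k) = 1" using X(2) by blast
      have "cmod (X j k) \<le> cmod (X j k - (\<Sum>l<N j. M k l * X j l)) + cmod (\<Sum>l<N j. M k l * X j l)"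
        by (metis add.commute diff_add_cancel norm_triangle_ineq)
      also have "cmod (X j k - (\<Sum>l<N j. M k l * X j l)) \<le> 1 / 2"
      proof -
        have "inverse (real (Suc j)) \<le> inverse 2"
          using that by (intro le_imp_inverse_le) auto
        then show ?thesis using X(3)[OF k(1)] by simp
      qed
      also have "cmod (\<Sum>l<N j. M k l * X j l) \<le> C * \<alpha> ^ k * 1 / (1 - \<beta>)"
        unfolding Ysum by (rule geometric_decay_row(2)[OF M C al(1) be]) (rule Y1)
      finally have "\<not> k0 \<le> k" using k(2) k0[of k] by fastforce
      then have "cmod (Y j k) \<le> (\<Sum>k<k0. cmod (Y j k))"
        by (intro member_le_sum) auto
      then show ?thesis using k by (simp add: Y_def)
    qed
    have "(\<lambda>n. \<Sum>k<k0. cmod (Y (r n) k)) \<longlonglongrightarrow> (\<Sum>k<k0. cmod (y k))"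
      by (intro tendsto_sum tendsto_norm y)
    then have "1 \<le> (\<Sum>k<k0. cmod (y k))"
    proof (rule LIMSEQ_le_const)
      show "\<exists>N. \<forall>n\<ge>N. 1 \<le> (\<Sum>k<k0. cmod (Y (r n) k))"
        using big seq_suble[OF r(1)] order_trans by blast
    qed
    then have "\<exists>k. y k \<noteq> 0" by (metis norm_zero not_one_le_zero sum.neutral)
    moreover have "bounded (range y)" using y1 by (auto simp: bounded_iff)
    ultimately show False using no fix_y unfolding has_fixed_vector_def by blast
  qed
  then obtain \<delta> N0 where d: "\<delta> > 0" and N0: "\<And>N x. N \<ge> N0 \<Longrightarrow> unit N x \<Longrightarrow> \<not> small \<delta> N x"
    by blast
  \<comment> \<open>Homogeneity: dividing by the largest modulus \<open>m\<close> gives a vector to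
    which the statement on unit vectors applies.\<close>
  have bound: "cmod (x k) \<le> B" if N: "N \<ge> N0" and x: "\<forall>k<N. cmod (x k - (\<Sum>l<N. M k l * x l)) \<le> \<delta> / 2 * B" and k: "k < N"
    for N x B k
  proof -
    define m where "m = Max ((\<lambda>k. cmod (x k)) ` {..<N})"
    have m: "cmod (x l) \<le> m" if "l < N" for l
      unfolding m_def using that by (intro Max_ge) auto
    have "m \<in> (\<lambda>k. cmod (x k)) ` {..<N}"
      unfolding m_def using k by (intro Max_in) auto
    then obtain k1 where k1: "k1 < N" "cmod (x k1) = m" by auto
    have "0 \<le> \<delta> / 2 * B" using x k norm_ge_zero order_trans by blast
    then have B0: "0 \<le> B" using d by (simp add: zero_le_mult_iff)
    have "m \<le> B"
    proof (rule ccontr)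
      assume "\<not> m \<le> B"
      then have mB: "m > B" "m > 0" using B0 by auto
      have "unit N (\<lambda>k. x k / m)"
        unfolding unit_def using m k1 mB by (auto simp: norm_divide intro!: exI[of _ k1])
      then obtain k where k: "k < N" "cmod (x k / m - (\<Sum>l<N. M k l * (x l / m))) \<ge> \<delta>"
        using N0[OF N] unfolding small_def by (meson not_le)
      have "x k / m - (\<Sum>l<N. M k l * (x l / m)) = (x k - (\<Sum>l<N. M k l * x l)) / m"
        by (simp add: diff_divide_distrib sum_divide_distrib)
      then have "\<delta> * m \<le> cmod (x k - (\<Sum>l<N. M k l * x l))"
        using k(2) mB by (simp add: norm_divide field_simps)
      also have "\<dots> \<le> \<delta> / 2 * B" using x k(1) by blast
      also have "\<dots> \<le> \<delta> / 2 * m" using d mB by (intro mult_left_mono) auto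
      finally show False using d mB by (simp add: field_simps)
    qed
    then show "cmod (x k) \<le> B" using m[OF k] by simp
  qed
  show ?thesis
    by (rule exI[of _ "\<delta> / 2"]) (use d bound in \<open>simp, blast\<close>)
qed

text \<open>Without a fixed vector the ratios of successive truncated determinants are \<open>1 + O(\<beta>\<^sup>N)\<close>, so the
  determinants converge to a nonzero limit.\<close>

theorem det_one_minus_eq_0_imp_fixed_vector:
  assumes M: "geometric_decay C \<alpha> \<beta> M" and C: "0 \<le> C" and al: "0 < \<alpha>" "\<alpha> < 1" and be: "0 < \<beta>" "\<beta> < 1"
    and zero: "det_one_minus M = 0"
  shows "has_fixed_vector M"
proof (rule ccontr)
  assume no: "\<not> has_fixed_vector M"
  obtain \<delta> N0 where d: "\<delta> > 0" and N0': "\<forall>N\<ge>N0. \<forall>x B. (\<forall>k<N. cmod (x k - (\<Sum>l<N. M k l * x l)) \<le> \<delta> * B)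
      \<longrightarrow> (\<forall>k<N. cmod (x k) \<le> B)"
    using truncations_bounded_below[OF M C al be no] by blast
  have N0: "cmod (x k) \<le> B" if "N \<ge> N0" "\<And>k. k < N \<Longrightarrow> cmod (x k - (\<Sum>l<N. M k l * x l)) \<le> \<delta> * B" "k < N" for N x B k
    using N0' that by blast
  define A where "A = (\<lambda>i j. (if i = j then 1 else 0) - M i j)"
  have A_sum: "(\<Sum>l<N. A k l * x l) = x k - (\<Sum>l<N. M k l * x l)" if "k < N" for k N x
  proof -
    have "(\<Sum>l<N. A k l * x l) = (\<Sum>l<N. if k = l then x l else 0) - (\<Sum>l<N. M k l * x l)"
      unfolding sum_subtractf[symmetric] by (rule sum.cong) (auto simp: A_def algebra_simps)
    then show ?thesis using that by simp
  qed
  have td: "truncated_det M N = principal_minor A {..<N}" for N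
    by (simp add: truncated_det_def A_def)
  \<comment> \<open>A kernel vector would satisfy the lower bound with \<open>B = 0\<close>.\<close>
  have nz: "truncated_det M N \<noteq> 0" if N: "N \<ge> N0" for N
  proof
    assume "truncated_det M N = 0"
    then obtain x where x: "\<exists>k<N. x k \<noteq> 0" "\<And>k. k < N \<Longrightarrow> (\<Sum>l<N. A k l * x l) = 0"
      unfolding td using principal_minor_eq_0D by blast
    have "cmod (x k) \<le> 0" if "k < N" for k
      by (rule N0[OF N _ that]) (use x(2) A_sum in auto)
    then show False using x(1) by auto
  qed
  \<comment> \<open>The first term bounds the corner entry \<open>M N N\<close>. The second bounds
    the border sum, where \<open>y\<close> is at most \<open>C * \<beta> ^ N / \<delta>\<close>
    because the right-hand side of its system is the small column \<open>- M k N\<close>.\<close>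
  define K where "K = C + C * (C / \<delta>) / (1 - \<beta>)"
  have step: "\<exists>a. truncated_det M (Suc N) = truncated_det M N * a \<and> norm (a - 1) \<le> K * \<beta> ^ N" if N: "N \<ge> N0" for N
  proof -
    obtain y where y: "\<And>k. k < N \<Longrightarrow> (\<Sum>l<N. A k l * y l) = A k N"
      "principal_minor A {..<Suc N} = principal_minor A {..<N} * (A N N - (\<Sum>l<N. A N l * y l))"
      using bordered_determinant nz[OF N] unfolding td by metis
    define B where "B = C * \<beta> ^ N / \<delta>"
    have B0: "0 \<le> B" using C be d by (simp add: B_def)
    have yB: "cmod (y k) \<le> B" if k: "k < N" for k
    proof (rule N0[OF N _ k])
      fix k assume k: "k < N"
      have "cmod (y k - (\<Sum>l<N. M k l * y l)) = cmod (M k N)"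
        using y(1)[OF k] A_sum[OF k] k by (simp add: A_def)
      also have "\<dots> \<le> C * \<alpha> ^ k * \<beta> ^ N" using M by (simp add: geometric_decay_def)
      also have "\<dots> \<le> C * 1 * \<beta> ^ N"
        using C al be by (intro mult_right_mono mult_left_mono power_le_one) auto
      finally show "cmod (y k - (\<Sum>l<N. M k l * y l)) \<le> \<delta> * B" using d by (simp add: B_def)
    qed
    let ?y = "\<lambda>l. if l < N then y l else 0"
    have "cmod (\<Sum>l<N. M N l * ?y l) \<le> C * \<alpha> ^ N * B / (1 - \<beta>)"
      by (rule geometric_decay_row(3)[OF M C al(1) be]) (use yB B0 in auto)
    also have "(\<Sum>l<N. M N l * ?y l) = (\<Sum>l<N. M N l * y l)" by (rule sum.cong) auto
    also have "C * \<alpha> ^ N * B / (1 - \<beta>) \<le> C * 1 * B / (1 - \<beta>)"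
      using C al be B0 by (intro divide_right_mono mult_right_mono mult_left_mono power_le_one) auto
    finally have s: "cmod (\<Sum>l<N. M N l * y l) \<le> C * B / (1 - \<beta>)" by simp
    let ?a = "A N N - (\<Sum>l<N. A N l * y l)"
    have "(\<Sum>l<N. A N l * y l) = - (\<Sum>l<N. M N l * y l)"
      unfolding sum_negf[symmetric] by (rule sum.cong) (auto simp: A_def)
    then have "?a - 1 = (\<Sum>l<N. M N l * y l) - M N N" by (simp add: A_def)
    then have "norm (?a - 1) \<le> cmod (\<Sum>l<N. M N l * y l) + cmod (M N N)"
      using norm_triangle_ineq4 by metis
    also have "cmod (M N N) \<le> C * \<alpha> ^ N * \<beta> ^ N" using M by (simp add: geometric_decay_def)
    also have "C * \<alpha> ^ N * \<beta> ^ N \<le> C * 1 * \<beta> ^ N"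
      using C al be by (intro mult_right_mono mult_left_mono power_le_one) auto
    finally have "norm (?a - 1) \<le> K * \<beta> ^ N"
      using s by (simp add: K_def B_def algebra_simps)
    then show ?thesis using y(2) unfolding td by blast
  qed
  then obtain a where a: "\<And>N. N \<ge> N0 \<Longrightarrow> truncated_det M (Suc N) = truncated_det M N * a N"
    "\<And>N. N \<ge> N0 \<Longrightarrow> norm (a N - 1) \<le> K * \<beta> ^ N"
    by metis
  have td_prod: "truncated_det M (n + N0) = truncated_det M N0 * (\<Prod>i<n. a (i + N0))" for n
    by (induction n) (auto simp: a(1) mult.assoc)
  have anz: "a (i + N0) \<noteq> 0" for i
    using a(1)[of "i + N0"] nz[of "Suc (i + N0)"] by auto
  have "summable (\<lambda>i. norm (a (i + N0) - 1))"
  proof (rule summable_comparison_test')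
    show "summable (\<lambda>i. K * \<beta> ^ (i + N0))"
      using be by (intro summable_mult summable_ignore_initial_segment summable_geometric) auto
    show "norm (norm (a (i + N0) - 1)) \<le> K * \<beta> ^ (i + N0)" for i using a(2)[of "i + N0"] by simp
  qed
  \<comment> \<open>The truncated determinants are partial products of nonzero factors that differ
    from 1 by a summable sequence, so their limit is nonzero.\<close>
  then have conv: "convergent_prod (\<lambda>i. a (i + N0))"
    by (intro abs_convergent_prod_imp_convergent_prod summable_imp_abs_convergent_prod)
  have "(\<lambda>n. \<Prod>i<n. a (i + N0)) \<longlonglongrightarrow> prodinf (\<lambda>i. a (i + N0))"
    using convergent_prod_LIMSEQ[OF conv] by (simp add: LIMSEQ_lessThan_iff_atMost)
  then have "(\<lambda>n. truncated_det M N0 * (\<Prod>i<n. a (i + N0))) \<longlonglongrightarrow> truncated_det M N0 * prodinf (\<lambda>i. a (i + N0))"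
    by (intro tendsto_intros)
  then have 1: "(\<lambda>n. truncated_det M (n + N0)) \<longlonglongrightarrow> truncated_det M N0 * prodinf (\<lambda>i. a (i + N0))"
    by (simp only: td_prod)
  obtain \<tau> where tau: "\<tau> \<longlonglongrightarrow> (0::real)" "\<And>M N. geometric_decay C \<alpha> \<beta> M \<Longrightarrow> cmod (det_one_minus M - truncated_det M N) \<le> \<tau> N"
    using truncated_det_tendsto_uniformly[OF C al be] by metis
  have "(\<lambda>N. det_one_minus M - truncated_det M N) \<longlonglongrightarrow> 0"
    by (rule Lim_null_comparison[OF always_eventually tau(1)]) (use tau(2)[OF M] in blast)
  then have "(\<lambda>N. truncated_det M N) \<longlonglongrightarrow> 0" using tendsto_minus[of "\<lambda>N. det_one_minus M - truncated_det M N"] zero by fastforce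
  then have "(\<lambda>n. truncated_det M (n + N0)) \<longlonglongrightarrow> 0" by (rule LIMSEQ_ignore_initial_segment)
  then have "truncated_det M N0 * prodinf (\<lambda>i. a (i + N0)) = 0" using 1 LIMSEQ_unique by blast
  then show False using nz[of N0] prodinf_nonzero[OF conv anz] by simp
qed

section \<open>Conformal change of variables\<close>

text \<open>The Jacobian formula \<open>has_absolute_integral_change_of_variables\<close> is phrased
  with matrices on real coordinate vectors; this identification carries it over to the complex
  plane.\<close>

definition complex_of_vec :: "real ^ 2 \<Rightarrow> complex" where
  "complex_of_vec v = Complex (v $ 1) (v $ 2)"

definition vec_of_complex :: "complex \<Rightarrow> real ^ 2" where
  "vec_of_complex z = (\<chi> i. if i = 1 then Re z else Im z)"

lemma vec_of_complex_nth [simp]: "vec_of_complex z $ 1 = Re z" "vec_of_complex z $ 2 = Im z"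
  by (simp_all add: vec_of_complex_def)

lemma complex_of_vec_inverse [simp]: "complex_of_vec (vec_of_complex z) = z" "vec_of_complex (complex_of_vec v) = v"
  by (simp_all add: complex_of_vec_def Finite_Cartesian_Product.vec_eq_iff forall_2)

lemma bounded_linear_complex_of_vec: "bounded_linear complex_of_vec"
  unfolding linear_conv_bounded_linear[symmetric]
  by (rule linearI) (simp_all add: complex_of_vec_def complex_eq_iff)

lemma bounded_linear_vec_of_complex: "bounded_linear vec_of_complex"
  unfolding linear_conv_bounded_linear[symmetric]
  by (rule linearI) (simp_all add: Finite_Cartesian_Product.vec_eq_iff forall_2)

lemma measurable_complex_of_vec [measurable]: "complex_of_vec \<in> borel_measurable borel"
  by (intro borel_measurable_continuous_onI linear_continuous_on bounded_linear_complex_of_vec)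

lemma distr_lborel_complex_of_vec: "distr lborel borel complex_of_vec = lborel"
proof (rule lborel_eqI[symmetric])
  fix l u :: complex
  assume le: "\<And>b. b \<in> Basis \<Longrightarrow> l \<bullet> b \<le> u \<bullet> b"
  have B: "(Basis :: (real ^ 2) set) = {axis 1 1, axis 2 1}"
    by (auto simp: Basis_vec_def UNIV_2)
  have ne: "axis 1 1 \<noteq> (axis 2 1 :: real ^ 2)"
    by (simp add: axis_eq_axis)
  have "complex_of_vec -` box l u = box (vec_of_complex l) (vec_of_complex u)"
    by (auto simp: box_def Basis_complex_def B inner_axis complex_of_vec_def)
  then show "emeasure (distr lborel borel complex_of_vec) (box l u) = (\<Prod>b\<in>Basis. (u - l) \<bullet> b)"
    using le[of 1] le[of \<i>] by (simp add: emeasure_distr emeasure_lborel_box_eq B ne inner_axis Basis_complex_def inner_diff_left)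
qed simp

lemma integrable_lborel_complex_of_vec:
  fixes F :: "complex \<Rightarrow> complex"
  assumes "F \<in> borel_measurable borel"
  shows "integrable lborel F \<longleftrightarrow> integrable lborel (\<lambda>v. F (complex_of_vec v))"
    and "(\<integral>z. F z \<partial>lborel) = (\<integral>v. F (complex_of_vec v) \<partial>lborel)"
  using assms integrable_distr_eq[of complex_of_vec lborel borel F] integral_distr[of complex_of_vec lborel borel F]
  by (simp_all add: distr_lborel_complex_of_vec)

text \<open>A dictionary between the gauge integral of the transported function and the Bochner
  integral over \<open>lborel\<close>. Borel measurability of the cut-off function makes the passage
  to the completed measure harmless.\<close>

lemma absolutely_integrable_vec_of_complex:
  fixes F :: "complex \<Rightarrow> complex"
  assumes meas: "(\<lambda>z. indicat_real T z *\<^sub>R F z) \<in> borel_measurable borel"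
  shows "((\<lambda>v. vec_of_complex (F (complex_of_vec v))) absolutely_integrable_on (complex_of_vec -` T) \<and>
          integral (complex_of_vec -` T) (\<lambda>v. vec_of_complex (F (complex_of_vec v))) = vec_of_complex b)
    \<longleftrightarrow> (set_integrable lborel T F \<and> (LINT z:T|lborel. F z) = b)"
proof -
  let ?F = "\<lambda>z. indicat_real T z *\<^sub>R F z"
  let ?G = "\<lambda>v. indicat_real (complex_of_vec -` T) v *\<^sub>R vec_of_complex (F (complex_of_vec v))"
  have G: "?G = (\<lambda>v. vec_of_complex (?F (complex_of_vec v)))"
    by (auto simp: fun_eq_iff indicator_def linear_0[OF bounded_linear.linear[OF bounded_linear_vec_of_complex]])
  have m1: "(\<lambda>v. ?F (complex_of_vec v)) \<in> borel_measurable borel"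
    using measurable_compose[OF measurable_complex_of_vec meas] .
  have m2: "?G \<in> borel_measurable borel"
    unfolding G
    using borel_measurable_continuous_onI[OF linear_continuous_on[OF bounded_linear_vec_of_complex]] m1
    by (rule measurable_compose[rotated])
  have i1: "integrable lborel ?G \<longleftrightarrow> integrable lborel ?F"
  proof -
    have "integrable lborel ?G \<longleftrightarrow> integrable lborel (\<lambda>v. ?F (complex_of_vec v))"
    proof
      assume "integrable lborel ?G"
      from integrable_bounded_linear[OF bounded_linear_complex_of_vec this[unfolded G]]
      show "integrable lborel (\<lambda>v. ?F (complex_of_vec v))" by (simp add: G)
    next
      assume "integrable lborel (\<lambda>v. ?F (complex_of_vec v))"
      from integrable_bounded_linear[OF bounded_linear_vec_of_complex this]
      show "integrable lborel ?G" by (simp add: G)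
    qed
    then show ?thesis using integrable_lborel_complex_of_vec(1)[OF meas] by simp
  qed
  have i2: "(\<integral>v. ?G v \<partial>lborel) = vec_of_complex (\<integral>z. ?F z \<partial>lborel)" if "integrable lborel ?F"
  proof -
    have "integrable lborel (\<lambda>v. ?F (complex_of_vec v))"
      using that integrable_lborel_complex_of_vec(1)[OF meas] by simp
    from integral_bounded_linear[OF bounded_linear_vec_of_complex this]
    show ?thesis unfolding G using integrable_lborel_complex_of_vec(2)[OF meas] by simp
  qed
  have a1: "(\<lambda>v. vec_of_complex (F (complex_of_vec v))) absolutely_integrable_on (complex_of_vec -` T) \<longleftrightarrow> integrable lborel ?F"
    unfolding set_integrable_def using i1 integrable_completion[of ?G lborel] m2 by simp
  have a2: "integral (complex_of_vec -` T) (\<lambda>v. vec_of_complex (F (complex_of_vec v))) = vec_of_complex (\<integral>z. ?F z \<partial>lborel)"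
    if "integrable lborel ?F"
  proof -
    have "integral (complex_of_vec -` T) (\<lambda>v. vec_of_complex (F (complex_of_vec v))) = (\<integral>v. ?G v \<partial>lebesgue)"
      using set_lebesgue_integral_eq_integral(2)[OF a1[THEN iffD2, OF that]]
      by (simp add: set_lebesgue_integral_def)
    also have "\<dots> = (\<integral>v. ?G v \<partial>lborel)"
      using integral_completion[of ?G lborel] m2 by simp
    finally show ?thesis using i2[OF that] by simp
  qed
  have inj: "vec_of_complex x = vec_of_complex y \<longleftrightarrow> x = y" for x y
    by (metis complex_of_vec_inverse(1))
  show ?thesis
  proof (cases "integrable lborel ?F")
    case True
    then show ?thesis
      using a1 a2 inj by (simp add: set_integrable_def[of lborel T F] set_lebesgue_integral_def[of lborel T F])
  next
    case False
    then show ?thesis using a1 by (simp add: set_integrable_def[of lborel T F])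
  qed
qed

text \<open>The real derivative of \<open>g\<close> at \<open>z\<close> is multiplication by
  \<open>deriv g z\<close>, whose determinant is the square of its modulus.\<close>

theorem holomorphic_change_of_variables:
  fixes F :: "complex \<Rightarrow> complex"
  assumes "open S" and g: "g holomorphic_on S" and inj: "inj_on g S" and F: "continuous_on (g ` S) F"
  shows "set_integrable lborel (g ` S) F \<longleftrightarrow> set_integrable lborel S (\<lambda>z. of_real ((cmod (deriv g z))\<^sup>2) * F (g z))"
    and "set_integrable lborel (g ` S) F \<Longrightarrow> (LINT z:g ` S|lborel. F z) = (LINT z:S|lborel. of_real ((cmod (deriv g z))\<^sup>2) * F (g z))"
proof -
  let ?J = "\<lambda>z. of_real ((cmod (deriv g z))\<^sup>2) * F (g z)"
  let ?S = "complex_of_vec -` S"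
  let ?g = "\<lambda>v. vec_of_complex (g (complex_of_vec v))"
  let ?g' = "\<lambda>v h. vec_of_complex (deriv g (complex_of_vec v) * complex_of_vec h)"
  let ?F = "\<lambda>v. vec_of_complex (F (complex_of_vec v))"
  have open_gS: "open (g ` S)"
    using open_mapping_thm3[OF g \<open>open S\<close> inj] by simp
  have m1: "(\<lambda>z. indicat_real (g ` S) z *\<^sub>R F z) \<in> borel_measurable borel"
    using borel_measurable_continuous_on_indicator[OF _ F] open_gS by simp
  have "continuous_on S ?J"
    by (intro continuous_intros continuous_on_compose2[OF F]
        holomorphic_on_imp_continuous_on[OF g] holomorphic_on_imp_continuous_on[OF holomorphic_deriv[OF g \<open>open S\<close>]]) auto
  then have m2: "(\<lambda>z. indicat_real S z *\<^sub>R ?J z) \<in> borel_measurable borel"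
    by (rule borel_measurable_continuous_on_indicator[OF borel_open[OF \<open>open S\<close>]])
  have open_S': "open ?S"
    by (rule open_vimage[OF \<open>open S\<close>]) (intro linear_continuous_on bounded_linear_complex_of_vec)
  have der: "(?g has_derivative ?g' v) (at v within ?S)" if "v \<in> ?S" for v
  proof -
    have "(g has_field_derivative deriv g (complex_of_vec v)) (at (complex_of_vec v))"
      using that holomorphic_derivI[OF g \<open>open S\<close>] by simp
    then have 1: "(g has_derivative (\<lambda>h. deriv g (complex_of_vec v) * h)) (at (complex_of_vec v))"
      by (simp add: has_field_derivative_def)
    have 2: "(complex_of_vec has_derivative complex_of_vec) (at v within ?S)"
      by (rule bounded_linear_imp_has_derivative[OF bounded_linear_complex_of_vec])
    have 3: "((\<lambda>v. g (complex_of_vec v)) has_derivative (\<lambda>h. deriv g (complex_of_vec v) * complex_of_vec h)) (at v within ?S)"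
      using has_derivative_compose[OF 2 1] .
    show ?thesis
      by (rule has_derivative_compose[OF 3, OF bounded_linear_imp_has_derivative[OF bounded_linear_vec_of_complex]])
  qed
  have inj': "inj_on ?g ?S"
  proof (rule inj_onI)
    fix v w assume vw: "v \<in> ?S" "w \<in> ?S" "?g v = ?g w"
    have "g (complex_of_vec v) = g (complex_of_vec w)"
      using arg_cong[OF vw(3), of complex_of_vec] by simp
    then have "complex_of_vec v = complex_of_vec w"
      using inj vw(1,2) by (auto dest: inj_onD)
    then show "v = w"
      by (metis complex_of_vec_inverse(2))
  qed
  have img: "?g ` ?S = complex_of_vec -` (g ` S)"
  proof -
    have "v \<in> ?g ` ?S" if "complex_of_vec v = g z" "z \<in> S" for v z
    proof (rule image_eqI[of _ _ "vec_of_complex z"])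
      show "v = ?g (vec_of_complex z)"
        using that(1)[symmetric] by simp
      show "vec_of_complex z \<in> ?S" using that(2) by simp
    qed
    moreover have "?g w \<in> complex_of_vec -` (g ` S)" if "w \<in> ?S" for w
      using that by simp
    ultimately show ?thesis by blast
  qed
  have detJ: "\<bar>Determinants.det (matrix (?g' v))\<bar> = (cmod (deriv g (complex_of_vec v)))\<^sup>2" for v
    unfolding cmod_power2 by (simp add: det_2 matrix_def complex_of_vec_def axis_def power2_eq_square)
  have J: "\<bar>Determinants.det (matrix (?g' v))\<bar> *\<^sub>R ?F (?g v) = vec_of_complex (?J (complex_of_vec v))" for v
    unfolding detJ by (simp add: Finite_Cartesian_Product.vec_eq_iff forall_2)
  have "?S \<in> sets lebesgue" using open_S' by (simp add: borel_open)
  note cov = has_absolute_integral_change_of_variables[OF this der inj', of ?F, unfolded J img]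
  have main: "(set_integrable lborel S ?J \<and> (LINT z:S|lborel. ?J z) = b) \<longleftrightarrow>
      (set_integrable lborel (g ` S) F \<and> (LINT z:g ` S|lborel. F z) = b)" for b
    using cov[of "vec_of_complex b"] absolutely_integrable_vec_of_complex[OF m1, of b]
      absolutely_integrable_vec_of_complex[OF m2, of b] by simp
  show "set_integrable lborel (g ` S) F \<longleftrightarrow> set_integrable lborel S ?J"
    and "set_integrable lborel (g ` S) F \<Longrightarrow> (LINT z:g ` S|lborel. F z) = (LINT z:S|lborel. ?J z)"
    using main by blast+
qed

section \<open>Moments of holomorphic functions on discs\<close>

lemma set_integrable_bounded_continuous:
  fixes f :: "complex \<Rightarrow> 'a::euclidean_space"
  assumes "open S" "bounded S" "continuous_on S f" and B: "\<And>z. z \<in> S \<Longrightarrow> norm (f z) \<le> B"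
  shows "set_integrable lborel S f"
  unfolding set_integrable_def
proof (rule integrableI_bounded_set[of S _ _ B])
  show "(\<lambda>z. indicat_real S z *\<^sub>R f z) \<in> borel_measurable lborel"
    using borel_measurable_continuous_on_indicator[OF borel_open[OF \<open>open S\<close>] \<open>continuous_on S f\<close>] by simp
  show "emeasure lborel S < \<infinity>" using \<open>bounded S\<close> by (rule emeasure_bounded_finite)
qed (use assms B in \<open>auto simp: indicator_def\<close>)

lemma set_integrable_monomial:
  "set_integrable lborel (ball 0 r) (\<lambda>z::complex. a * z ^ m * cnj z ^ n)"
proof (rule set_integrable_bounded_continuous[where B = "cmod a * r ^ m * r ^ n"])
  show "norm (a * z ^ m * cnj z ^ n) \<le> cmod a * r ^ m * r ^ n" if "z \<in> ball 0 r" for z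
  proof -
    have "cmod z \<le> r" "0 \<le> r" using that by (auto intro: order_trans[OF norm_ge_zero less_imp_le])
    then show ?thesis
      unfolding norm_mult norm_power complex_mod_cnj by (intro mult_mono power_mono) auto
  qed
qed (auto intro!: continuous_intros)

text \<open>The rotation by \<omega> with \<omega>^(m - n) = -1 preserves the disc and changes the
  sign of the integrand.\<close>

lemma monomials_orthogonal:
  fixes r :: real
  assumes "m \<noteq> n"
  shows "(LINT z:ball 0 r|lborel. z ^ m * cnj z ^ n) = (0::complex)"
proof -
  define F where "F = (\<lambda>z::complex. z ^ m * cnj z ^ n)"
  define \<theta> where "\<theta> = pi / (real m - real n)"
  define \<omega> where "\<omega> = cis \<theta>"
  have w: "\<omega> \<noteq> 0" "cmod \<omega> = 1" by (simp_all add: \<omega>_def)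
  have "\<omega> ^ m * cnj \<omega> ^ n = cis (real m * \<theta> + real n * - \<theta>)"
    by (simp add: \<omega>_def Complex.DeMoivre cis_cnj cis_mult)
  also have "real m * \<theta> + real n * - \<theta> = (real m - real n) * \<theta>"
    by (simp add: algebra_simps)
  also have "\<dots> = pi"
    using assms by (simp add: \<theta>_def)
  finally have F: "F (\<omega> * z) = - F z" for z
    by (simp add: F_def power_mult_distrib) (metis (no_types, lifting) cis_pi mult.assoc mult.left_commute mult_minus1)
  have img: "(*) \<omega> ` ball 0 r = ball 0 r"
  proof (intro equalityI subsetI)
    fix z assume "z \<in> ball (0::complex) r"
    then show "z \<in> (*) \<omega> ` ball 0 r"
      using w by (intro image_eqI[of _ _ "z / \<omega>"]) (auto simp: norm_divide)
  qed (use w in \<open>auto simp: norm_mult\<close>)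
  have int: "set_integrable lborel (ball 0 r) F"
    using set_integrable_monomial[of r 1 m n] by (simp add: F_def)
  have "(LINT z:(*) \<omega> ` ball 0 r|lborel. F z)
      = (LINT z:ball 0 r|lborel. of_real ((cmod (deriv ((*) \<omega>) z))\<^sup>2) * F (\<omega> * z))"
  proof (rule holomorphic_change_of_variables(2))
    show "continuous_on ((*) \<omega> ` ball 0 r) F" unfolding F_def by (intro continuous_intros)
    show "inj_on ((*) \<omega>) (ball 0 r)" using w by (simp add: inj_on_def)
    show "set_integrable lborel ((*) \<omega> ` ball 0 r) F" unfolding img by (rule int)
  qed (auto intro!: holomorphic_intros)
  also have "\<dots> = - (LINT z:ball 0 r|lborel. F z)"
    using w by (simp add: F set_integral_uminus[OF int])
  finally show ?thesis unfolding img by (simp add: F_def)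
qed

text \<open>The squared norm of z^n on the disc, equal to pi r^(2n+2) / (n+1); it enters through its
  positivity and its monotonicity in the radius.\<close>

definition moment :: "real \<Rightarrow> nat \<Rightarrow> real" where
  "moment r n = (LINT z:ball (0::complex) r|lborel. cmod z ^ (2 * n))"

lemma set_integrable_moment: "set_integrable lborel (ball (0::complex) r) (\<lambda>z. cmod z ^ (2 * n))"
  by (rule set_integrable_bounded_continuous[where B = "r ^ (2 * n)"])
     (auto intro!: continuous_intros power_mono)

lemma moment_complex: "(LINT z:ball 0 r|lborel. z ^ n * cnj z ^ n) = complex_of_real (moment r n)"
proof -
  have "z ^ n * cnj z ^ n = complex_of_real (cmod z ^ (2 * n))" for z
    by (simp add: power_mult_distrib[symmetric] complex_norm_square[symmetric] power_mult)
  then show ?thesis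
    unfolding moment_def by (simp only: set_integral_complex_of_real)
qed

lemma set_integral_mono_set:
  fixes f :: "'a \<Rightarrow> real"
  assumes "set_integrable M B f" "A \<in> sets M" "A \<subseteq> B" "\<And>x. x \<in> B \<Longrightarrow> 0 \<le> f x"
  shows "(LINT x:A|M. f x) \<le> (LINT x:B|M. f x)"
  using set_integrable_subset[OF assms(1-3)] assms
  unfolding set_lebesgue_integral_def set_integrable_def
  by (intro integral_mono) (auto simp: indicator_def)

lemma moment_mono: "r \<le> r' \<Longrightarrow> moment r n \<le> moment r' n"
  unfolding moment_def by (rule set_integral_mono_set[OF set_integrable_moment]) auto

lemma moment_pos:
  assumes "0 < r"
  shows "0 < moment r n"
proof -
  \<comment> \<open>A ball inside the annulus r/2 \<le> |z| < r, where the integrand is bounded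
    below.\<close>
  let ?B = "ball (of_real (3 * r / 4)) (r / 4) :: complex set"
  have sub: "?B \<subseteq> ball 0 r" and ge: "z \<in> ?B \<Longrightarrow> r / 2 \<le> cmod z" for z
  proof -
    have "cmod z < r \<and> r / 2 \<le> cmod z" if "z \<in> ?B" for z
    proof -
      have "cmod (of_real (3 * r / 4) - z) < r / 4" using that by (simp add: dist_norm)
      moreover have "cmod (of_real (3 * r / 4) :: complex) = 3 * r / 4" using assms by (simp only: norm_of_real)
      ultimately show ?thesis
        using norm_triangle_ineq2[of "of_real (3 * r / 4)" z] norm_triangle_ineq3[of "of_real (3 * r / 4)" z] by linarith
    qed
    then show "?B \<subseteq> ball 0 r" "z \<in> ?B \<Longrightarrow> r / 2 \<le> cmod z" by auto
  qed
  have "0 < (r / 2) ^ (2 * n) * measure lborel ?B"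
    using assms by (intro mult_pos_pos content_ball_pos) auto
  also have "\<dots> = (LINT z:?B|lborel. (r / 2) ^ (2 * n))"
    using emeasure_lborel_ball_finite[of "of_real (3 * r / 4) :: complex" "r / 4"] by (subst set_integral_const) auto
  also have "\<dots> \<le> (LINT z:?B|lborel. cmod z ^ (2 * n))"
  proof (rule set_integral_mono)
    show "set_integrable lborel ?B (\<lambda>z. cmod z ^ (2 * n))"
      by (rule set_integrable_subset[OF set_integrable_moment _ sub]) simp
    show "set_integrable lborel ?B (\<lambda>z. (r / 2) ^ (2 * n))"
      by (rule set_integrable_bounded_continuous[where B = "(r / 2) ^ (2 * n)"]) (use assms in auto)
    show "(r / 2) ^ (2 * n) \<le> cmod z ^ (2 * n)" if "z \<in> ?B" for z
      using ge[OF that] assms by (intro power_mono) auto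
  qed
  also have "\<dots> \<le> moment r n"
    unfolding moment_def by (rule set_integral_mono_set[OF set_integrable_moment]) (use sub in auto)
  finally show ?thesis .
qed

text \<open>Integrated termwise against the conjugate monomial, the Taylor series keeps only its
  \<open>n\<close>-th term by orthogonality. The radius \<open>r\<close> strictly below
  \<open>R\<close> gives the absolute convergence that justifies this.\<close>

lemma holomorphic_moment:
  fixes f :: "complex \<Rightarrow> complex"
  assumes f: "f holomorphic_on ball 0 R" and r: "0 < r" "r < R"
  shows "(LINT z:ball 0 r|lborel. f z * cnj z ^ n) = (deriv ^^ n) f 0 / fact n * of_real (moment r n)"
proof -
  define a where "a = (\<lambda>m. (deriv ^^ m) f 0 / fact m)"
  have sums: "(\<lambda>m. a m * z ^ m) sums f z" if "z \<in> ball 0 R" for z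
    using holomorphic_power_series[OF f that] by (simp add: a_def)
  have "summable (\<lambda>m. norm (a m * of_real r ^ m))"
  proof (rule powser_insidea)
    show "summable (\<lambda>m. a m * of_real ((r + R) / 2) ^ m)"
      by (rule sums_summable[OF sums]) (use r in \<open>simp add: norm_divide flip: of_real_add\<close>)
    show "norm (complex_of_real r) < norm (complex_of_real ((r + R) / 2))"
      unfolding norm_of_real using r by simp
  qed
  then have ar: "summable (\<lambda>m. cmod (a m) * r ^ m)" using r by (simp add: norm_mult norm_power)
  define h where "h = (\<lambda>m z. indicat_real (ball 0 r) z *\<^sub>R (a m * z ^ m * cnj z ^ n))"
  have int: "integrable lborel (h m)" for m
    using set_integrable_monomial[of r "a m" m n] unfolding h_def set_integrable_def .
  have bound: "norm (h m z) \<le> indicat_real (ball 0 r) z * (cmod (a m) * r ^ m * r ^ n)" for m z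
  proof (cases "z \<in> ball 0 r")
    case True
    then have "cmod z \<le> r" by simp
    then have "cmod (a m * z ^ m * cnj z ^ n) \<le> cmod (a m) * r ^ m * r ^ n"
      unfolding norm_mult norm_power complex_mod_cnj using r by (intro mult_mono power_mono) auto
    then show ?thesis using True by (simp add: h_def)
  qed (simp add: h_def)
  have sum1: "summable (\<lambda>m. norm (h m z))" for z
  proof (rule summable_comparison_test')
    show "summable (\<lambda>m. cmod (a m) * r ^ m * r ^ n)" using ar by (rule summable_mult2)
    show "norm (norm (h m z)) \<le> cmod (a m) * r ^ m * r ^ n" for m
      using bound[of m z] r by (auto simp: indicator_def split: if_splits intro: order_trans)
  qed
  have sum2: "summable (\<lambda>m. \<integral>z. norm (h m z) \<partial>lborel)"
  proof (rule summable_comparison_test')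
    show "summable (\<lambda>m. measure lborel (ball (0::complex) r) * (cmod (a m) * r ^ m * r ^ n))"
      by (intro summable_mult summable_mult2 ar)
    fix m
    have "(\<integral>z. norm (h m z) \<partial>lborel) \<le> (\<integral>z. indicat_real (ball (0::complex) r) z * (cmod (a m) * r ^ m * r ^ n) \<partial>lborel)"
      using emeasure_lborel_ball_finite[of "0::complex" r]
      by (intro integral_mono integrable_norm int integrable_mult_left bound) (auto simp: integrable_indicator_iff)
    then show "norm (\<integral>z. norm (h m z) \<partial>lborel) \<le> measure lborel (ball (0::complex) r) * (cmod (a m) * r ^ m * r ^ n)"
      by simp
  qed
  have "(LINT z:ball 0 r|lborel. f z * cnj z ^ n) = (\<integral>z. (\<Sum>m. h m z) \<partial>lborel)"
    unfolding set_lebesgue_integral_def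
  proof (rule Bochner_Integration.integral_cong[OF refl])
    fix z :: complex
    show "indicat_real (ball 0 r) z *\<^sub>R (f z * cnj z ^ n) = (\<Sum>m. h m z)"
    proof (cases "z \<in> ball 0 r")
      case True
      then have "(\<lambda>m. a m * z ^ m * cnj z ^ n) sums (f z * cnj z ^ n)"
        using r by (intro sums_mult2 sums) auto
      then show ?thesis using True by (simp add: h_def sums_iff)
    qed (simp add: h_def)
  qed
  also have "\<dots> = (\<Sum>m. \<integral>z. h m z \<partial>lborel)"
    by (rule integral_suminf[OF int _ sum2]) (use sum1 in auto)
  also have "\<dots> = (\<Sum>m. if m = n then a n * of_real (moment r n) else 0)"
  proof (rule suminf_cong)
    fix m
    have "(\<integral>z. h m z \<partial>lborel) = (LINT z:ball 0 r|lborel. a m * (z ^ m * cnj z ^ n))"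
      unfolding h_def set_lebesgue_integral_def mult.assoc ..
    also have "\<dots> = a m * (LINT z:ball 0 r|lborel. z ^ m * cnj z ^ n)" by (rule set_integral_mult_right)
    also have "\<dots> = (if m = n then a n * of_real (moment r n) else 0)"
      using monomials_orthogonal[of m n r] moment_complex[of r n] by simp
    finally show "(\<integral>z. h m z \<partial>lborel) = (if m = n then a n * of_real (moment r n) else 0)" .
  qed
  also have "\<dots> = a n * of_real (moment r n)"
    using sums_single[of n "\<lambda>m. a n * of_real (moment r n)"] by (simp add: sums_iff)
  finally show ?thesis by (simp add: a_def)
qed

text \<open>The case \<open>n = 0\<close> of the moment formula, moved to the centre
  \<open>w\<close> by a translation.\<close>

lemma area_mean_value:
  fixes f :: "complex \<Rightarrow> complex"
  assumes f: "f holomorphic_on ball w R" and r: "0 < r" "r < R"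
  shows "(LINT z:ball w r|lborel. f z) = f w * of_real (measure lborel (ball w r))"
proof -
  have img: "(+) w ` ball 0 r = ball w r" by (simp add: image_add_ball)
  have cont: "continuous_on (cball w r) f"
    by (rule continuous_on_subset[OF holomorphic_on_imp_continuous_on[OF f]]) (use r in auto)
  obtain B where B: "\<And>z. z \<in> cball w r \<Longrightarrow> cmod (f z) \<le> B"
    using compact_imp_bounded[OF compact_continuous_image[OF cont compact_cball]]
    unfolding bounded_iff by blast
  have int: "set_integrable lborel (ball w r) f"
    by (rule set_integrable_bounded_continuous[where B = B])
       (use B in \<open>auto intro: continuous_on_subset[OF cont]\<close>)
  have "(LINT z:(+) w ` ball 0 r|lborel. f z)
      = (LINT z:ball 0 r|lborel. of_real ((cmod (deriv ((+) w) z))\<^sup>2) * f (w + z))"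
  proof (rule holomorphic_change_of_variables(2))
    show "continuous_on ((+) w ` ball 0 r) f" unfolding img by (rule continuous_on_subset[OF cont]) auto
    show "set_integrable lborel ((+) w ` ball 0 r) f" unfolding img by (rule int)
  qed (auto intro!: holomorphic_intros)
  also have "\<dots> = (LINT z:ball 0 r|lborel. f (w + z) * cnj z ^ 0)"
    by simp
  also have "\<dots> = (deriv ^^ 0) (\<lambda>z. f (w + z)) 0 / fact 0 * of_real (moment r 0)"
  proof (rule holomorphic_moment[OF _ r])
    have "(f \<circ> (+) w) holomorphic_on ball 0 R"
      by (rule holomorphic_on_compose[OF _ holomorphic_on_subset[OF f]])
         (auto intro!: holomorphic_intros simp: image_add_ball)
    then show "(\<lambda>z. f (w + z)) holomorphic_on ball 0 R" by (simp add: o_def)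
  qed
  also have "moment r 0 = measure lborel (ball w r)"
    using emeasure_lborel_ball_finite[of "0::complex" r] r
    by (simp add: moment_def set_integral_const content_ball)
  finally show ?thesis unfolding img by simp
qed

section \<open>Bergman spaces\<close>

text \<open>Integrated over the whole plane: elements of \<open>bergman D\<close> vanish off
  \<open>D\<close>, so no domain has to be carried along.\<close>

definition sqnorm :: "(complex \<Rightarrow> complex) \<Rightarrow> real" where
  "sqnorm u = (\<integral>z. (cmod (u z))\<^sup>2 \<partial>lborel)"

lemma sqnorm_nonneg: "0 \<le> sqnorm u"
  unfolding sqnorm_def by (rule Bochner_Integration.integral_nonneg) auto

lemma borel_measurable_cnj [measurable]: "cnj \<in> borel_measurable borel"
  by (intro borel_measurable_continuous_onI continuous_intros)

lemma square_integrable_mult: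
  fixes f g :: "complex \<Rightarrow> complex"
  assumes [measurable]: "f \<in> borel_measurable borel" "g \<in> borel_measurable borel"
    and "integrable lborel (\<lambda>z. (cmod (f z))\<^sup>2)" "integrable lborel (\<lambda>z. (cmod (g z))\<^sup>2)"
  shows "integrable lborel (\<lambda>z. f z * cnj (g z))"
proof (rule Bochner_Integration.integrable_bound)
  show "integrable lborel (\<lambda>z. (cmod (f z))\<^sup>2 + (cmod (g z))\<^sup>2)"
    by (intro Bochner_Integration.integrable_add assms)
  have "cmod (f z) * cmod (g z) \<le> (cmod (f z))\<^sup>2 + (cmod (g z))\<^sup>2" for z
  proof -
    have "0 \<le> cmod (f z) * cmod (g z)" by simp
    then show ?thesis using sum_squares_bound[of "cmod (f z)" "cmod (g z)"] by linarith
  qed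
  then show "AE z in lborel. norm (f z * cnj (g z)) \<le> norm ((cmod (f z))\<^sup>2 + (cmod (g z))\<^sup>2)"
    by (simp add: norm_mult)
qed measurable

lemma Cauchy_Schwarz_integral:
  fixes f g :: "complex \<Rightarrow> complex"
  assumes f [measurable]: "f \<in> borel_measurable borel" and g [measurable]: "g \<in> borel_measurable borel"
    and f2: "integrable lborel (\<lambda>z. (cmod (f z))\<^sup>2)" and g2: "integrable lborel (\<lambda>z. (cmod (g z))\<^sup>2)"
  shows "(cmod (\<integral>z. f z * cnj (g z) \<partial>lborel))\<^sup>2 \<le> sqnorm f * sqnorm g"
proof -
  let ?I = "\<integral>z. cmod (f z) * cmod (g z) \<partial>lborel"
  have int: "integrable lborel (\<lambda>z. cmod (f z) * cmod (g z))"
    using integrable_norm[OF square_integrable_mult[OF f g f2 g2]] by (simp add: norm_mult)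
  have I0: "0 \<le> ?I" by (rule Bochner_Integration.integral_nonneg) auto
  have "ennreal (?I\<^sup>2) = (\<integral>\<^sup>+z. ennreal (cmod (f z) * cmod (g z)) \<partial>lborel)\<^sup>2"
    using nn_integral_eq_integral[OF int] I0 by (simp add: ennreal_power)
  also have "\<dots> \<le> (\<integral>\<^sup>+z. (ennreal (cmod (f z)))\<^sup>2 \<partial>lborel) * (\<integral>\<^sup>+z. (ennreal (cmod (g z)))\<^sup>2 \<partial>lborel)"
    using Cauchy_Schwarz_nn_integral[of "\<lambda>z. ennreal (cmod (f z))" lborel "\<lambda>z. ennreal (cmod (g z))"]
    by (simp add: ennreal_mult)
  also have "\<dots> = ennreal (sqnorm f * sqnorm g)"
    using nn_integral_eq_integral[OF f2] nn_integral_eq_integral[OF g2]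
    by (simp add: ennreal_power sqnorm_def ennreal_mult)
  finally have "?I\<^sup>2 \<le> sqnorm f * sqnorm g"
    by (subst (asm) ennreal_le_iff) (auto simp: sqnorm_nonneg)
  moreover have "cmod (\<integral>z. f z * cnj (g z) \<partial>lborel) \<le> ?I"
    using integral_norm_bound[of lborel "\<lambda>z. f z * cnj (g z)"] by (simp add: norm_mult)
  ultimately show ?thesis
    by (meson norm_ge_zero order_trans power_mono)
qed

context
  fixes D :: "complex set"
  assumes open_D: "open D"
begin

lemma bergman_holomorphic: "u \<in> bergman D \<Longrightarrow> u holomorphic_on D"
  and bergman_zero: "u \<in> bergman D \<Longrightarrow> z \<notin> D \<Longrightarrow> u z = 0"
  by (simp_all add: bergman_def)

lemma bergman_measurable: "u \<in> bergman D \<Longrightarrow> u \<in> borel_measurable borel"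
proof -
  assume u: "u \<in> bergman D"
  have "(\<lambda>z. indicat_real D z *\<^sub>R u z) \<in> borel_measurable borel"
    by (rule borel_measurable_continuous_on_indicator)
       (use open_D holomorphic_on_imp_continuous_on[OF bergman_holomorphic[OF u]] in auto)
  moreover have "(\<lambda>z. indicat_real D z *\<^sub>R u z) = u"
    using bergman_zero[OF u] by (auto simp: fun_eq_iff indicator_def)
  ultimately show ?thesis by simp
qed

lemma bergman_square_integrable: "u \<in> bergman D \<Longrightarrow> integrable lborel (\<lambda>z. (cmod (u z))\<^sup>2)"
proof -
  assume u: "u \<in> bergman D"
  have "(\<lambda>z. indicat_real D z *\<^sub>R (cmod (u z))\<^sup>2) = (\<lambda>z. (cmod (u z))\<^sup>2)"
    using bergman_zero[OF u] by (auto simp: fun_eq_iff indicator_def)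
  moreover have "integrable lborel (\<lambda>z. indicat_real D z *\<^sub>R (cmod (u z))\<^sup>2)"
    using u by (simp add: bergman_def set_integrable_def)
  ultimately show ?thesis by simp
qed

lemma bergmanI:
  assumes "u holomorphic_on D" "integrable lborel (\<lambda>z. (cmod (u z))\<^sup>2)" "\<And>z. z \<notin> D \<Longrightarrow> u z = 0"
  shows "u \<in> bergman D"
proof -
  have "(\<lambda>z. indicat_real D z *\<^sub>R (cmod (u z))\<^sup>2) = (\<lambda>z. (cmod (u z))\<^sup>2)"
    using assms(3) by (auto simp: fun_eq_iff indicator_def)
  then show ?thesis using assms by (simp add: bergman_def set_integrable_def)
qed

lemma bergman_inner_eq: "u \<in> bergman D \<Longrightarrow> bergman_inner D u v = (\<integral>z. u z * cnj (v z) \<partial>lborel)"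
proof -
  assume u: "u \<in> bergman D"
  have "(\<lambda>z. indicat_real D z *\<^sub>R (u z * cnj (v z))) = (\<lambda>z. u z * cnj (v z))"
    using bergman_zero[OF u] by (auto simp: fun_eq_iff indicator_def)
  then show ?thesis by (simp add: bergman_inner_def set_lebesgue_integral_def)
qed

lemma bergman_integrable: "u \<in> bergman D \<Longrightarrow> v \<in> bergman D \<Longrightarrow> integrable lborel (\<lambda>z. u z * cnj (v z))"
  by (intro square_integrable_mult bergman_measurable bergman_square_integrable)

lemma bergman_inner_self: "u \<in> bergman D \<Longrightarrow> bergman_inner D u u = of_real (sqnorm u)"
  by (simp add: bergman_inner_eq sqnorm_def complex_norm_square[symmetric] flip: of_real_power integral_complex_of_real)

lemma bergman_Cauchy_Schwarz:
  "u \<in> bergman D \<Longrightarrow> v \<in> bergman D \<Longrightarrow> (cmod (bergman_inner D u v))\<^sup>2 \<le> sqnorm u * sqnorm v"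
  by (simp add: bergman_inner_eq Cauchy_Schwarz_integral bergman_measurable bergman_square_integrable)

lemma bergman_scale: "u \<in> bergman D \<Longrightarrow> (\<lambda>z. a * u z) \<in> bergman D"
proof (rule bergmanI)
  assume u: "u \<in> bergman D"
  show "(\<lambda>z. a * u z) holomorphic_on D"
    by (intro holomorphic_intros bergman_holomorphic u)
  show "integrable lborel (\<lambda>z. (cmod (a * u z))\<^sup>2)"
    using bergman_square_integrable[OF u] by (simp add: norm_mult power_mult_distrib)
qed (simp add: bergman_zero)

lemma bergman_add: "u \<in> bergman D \<Longrightarrow> v \<in> bergman D \<Longrightarrow> (\<lambda>z. u z + v z) \<in> bergman D"
proof (rule bergmanI)
  assume uv: "u \<in> bergman D" "v \<in> bergman D"
  note [measurable] = bergman_measurable[OF uv(1)] bergman_measurable[OF uv(2)]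
  show "(\<lambda>z. u z + v z) holomorphic_on D"
    by (intro holomorphic_intros bergman_holomorphic uv)
  show "integrable lborel (\<lambda>z. (cmod (u z + v z))\<^sup>2)"
  proof (rule Bochner_Integration.integrable_bound)
    show "integrable lborel (\<lambda>z. 2 * (cmod (u z))\<^sup>2 + 2 * (cmod (v z))\<^sup>2)"
      by (intro Bochner_Integration.integrable_add integrable_mult_right bergman_square_integrable uv)
    have "(cmod (u z + v z))\<^sup>2 \<le> 2 * (cmod (u z))\<^sup>2 + 2 * (cmod (v z))\<^sup>2" for z
    proof -
      have "(cmod (u z + v z))\<^sup>2 \<le> (cmod (u z) + cmod (v z))\<^sup>2"
        by (intro power_mono norm_triangle_ineq) auto
      also have "\<dots> \<le> 2 * (cmod (u z))\<^sup>2 + 2 * (cmod (v z))\<^sup>2"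
        using sum_squares_bound[of "cmod (u z)" "cmod (v z)"] by (simp add: power2_sum)
      finally show ?thesis .
    qed
    then show "AE z in lborel. norm ((cmod (u z + v z))\<^sup>2) \<le> norm (2 * (cmod (u z))\<^sup>2 + 2 * (cmod (v z))\<^sup>2)"
      by simp
  qed measurable
qed (simp add: bergman_zero)

lemma bergman_diff: "u \<in> bergman D \<Longrightarrow> v \<in> bergman D \<Longrightarrow> (\<lambda>z. u z - v z) \<in> bergman D"
  using bergman_add[OF _ bergman_scale[of v "-1"], of u] by simp

lemma bergman_0: "(\<lambda>z. 0) \<in> bergman D"
  by (rule bergmanI) auto

lemma bergman_sum: "finite J \<Longrightarrow> (\<And>j. j \<in> J \<Longrightarrow> u j \<in> bergman D) \<Longrightarrow> (\<lambda>z. \<Sum>j\<in>J. u j z) \<in> bergman D"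
  by (induction J rule: finite_induct) (auto intro: bergman_add bergman_0)

lemma bergman_inner_add_left: "u \<in> bergman D \<Longrightarrow> v \<in> bergman D \<Longrightarrow> w \<in> bergman D \<Longrightarrow>
    bergman_inner D (\<lambda>z. u z + v z) w = bergman_inner D u w + bergman_inner D v w"
  by (simp add: bergman_inner_eq bergman_add bergman_integrable distrib_right)

lemma bergman_inner_scale_left: "u \<in> bergman D \<Longrightarrow> bergman_inner D (\<lambda>z. a * u z) w = a * bergman_inner D u w"
  by (simp add: bergman_inner_eq bergman_scale mult.assoc)

lemma bergman_inner_diff_left: "u \<in> bergman D \<Longrightarrow> v \<in> bergman D \<Longrightarrow> w \<in> bergman D \<Longrightarrow>
    bergman_inner D (\<lambda>z. u z - v z) w = bergman_inner D u w - bergman_inner D v w"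
  by (simp add: bergman_inner_eq bergman_diff bergman_integrable left_diff_distrib)

lemma bergman_inner_sum_left: "finite J \<Longrightarrow> (\<And>j. j \<in> J \<Longrightarrow> u j \<in> bergman D) \<Longrightarrow> w \<in> bergman D \<Longrightarrow>
    bergman_inner D (\<lambda>z. \<Sum>j\<in>J. u j z) w = (\<Sum>j\<in>J. bergman_inner D (u j) w)"
proof (induction J rule: finite_induct)
  case empty
  then show ?case by (simp add: bergman_inner_eq bergman_0)
qed (simp add: bergman_inner_add_left bergman_sum)

lemma bergman_inner_cnj: "u \<in> bergman D \<Longrightarrow> v \<in> bergman D \<Longrightarrow> cnj (bergman_inner D u v) = bergman_inner D v u"
  using integral_bounded_linear[OF bounded_linear_cnj bergman_integrable, of u v]
  by (simp add: bergman_inner_eq mult.commute)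

text \<open>By the mean value property, point evaluation is an inner product with the normalised
  indicator of a ball, and Cauchy-Schwarz bounds it. The radius is halved because the mean value
  property is applied strictly inside the disc of holomorphy.\<close>

lemma bergman_pointwise_bound:
  assumes u: "u \<in> bergman D" and sub: "ball w R \<subseteq> D" and R: "0 < R"
  shows "(cmod (u w))\<^sup>2 * measure lborel (ball w (R / 2)) \<le> sqnorm u"
proof -
  let ?B = "ball w (R / 2)"
  let ?m = "measure lborel ?B"
  let ?h = "\<lambda>z. complex_of_real (indicat_real ?B z)"
  have m: "0 < ?m" using R by (simp add: content_ball_pos)
  have fin: "emeasure lborel ?B < \<infinity>" by (rule emeasure_lborel_ball_finite)
  have h2: "(cmod (?h z))\<^sup>2 = indicat_real ?B z" for z by (simp add: indicator_def)
  have "u w * of_real ?m = (LINT z:?B|lborel. u z)"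
    by (rule area_mean_value[symmetric, of u w R])
       (use R in \<open>auto intro: holomorphic_on_subset[OF bergman_holomorphic[OF u] sub]\<close>)
  also have "\<dots> = (\<integral>z. u z * cnj (?h z) \<partial>lborel)"
    unfolding set_lebesgue_integral_def by (rule Bochner_Integration.integral_cong) (auto simp: indicator_def)
  finally have "(cmod (u w * of_real ?m))\<^sup>2 = (cmod (\<integral>z. u z * cnj (?h z) \<partial>lborel))\<^sup>2" by simp
  also have "\<dots> \<le> sqnorm u * sqnorm ?h"
  proof (rule Cauchy_Schwarz_integral[OF bergman_measurable[OF u] _ bergman_square_integrable[OF u]])
    show "?h \<in> borel_measurable borel"
      by (rule measurable_compose[OF borel_measurable_indicator borel_measurable_continuous_onI])
         (auto intro!: continuous_intros)
    show "integrable lborel (\<lambda>z. (cmod (?h z))\<^sup>2)"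
      unfolding h2 using fin by (simp add: integrable_indicator_iff)
  qed
  also have "sqnorm ?h = ?m"
    unfolding sqnorm_def h2 using fin by simp
  finally have "(cmod (u w))\<^sup>2 * ?m * ?m \<le> sqnorm u * ?m"
    by (simp add: norm_mult power_mult_distrib power2_eq_square ac_simps)
  then show ?thesis using m by simp
qed

text \<open>Makes convergence in norm imply uniform convergence on compact sets. The constant is
  uniform because balls of one fixed radius about the points of \<open>K\<close> stay inside
  \<open>D\<close>.\<close>

lemma bergman_compact_bound:
  assumes K: "compact K" "K \<subseteq> D"
  obtains B where "0 \<le> B" "\<And>u z. u \<in> bergman D \<Longrightarrow> z \<in> K \<Longrightarrow> (cmod (u z))\<^sup>2 \<le> B * sqnorm u"
proof -
  obtain \<epsilon> where e: "0 < \<epsilon>" "(\<Union>z\<in>K. ball z \<epsilon>) \<subseteq> D"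
    using compact_subset_open_imp_ball_epsilon_subset[OF K(1) open_D K(2)] by blast
  let ?m = "measure lborel (ball (0::complex) (\<epsilon> / 2))"
  have m: "0 < ?m" using e by (simp add: content_ball_pos)
  show thesis
  proof (rule that)
    show "0 \<le> 1 / ?m" using m by simp
    fix u z assume u: "u \<in> bergman D" and z: "z \<in> K"
    have "(cmod (u z))\<^sup>2 * measure lborel (ball z (\<epsilon> / 2)) \<le> sqnorm u"
      by (rule bergman_pointwise_bound[OF u]) (use e z in auto)
    then show "(cmod (u z))\<^sup>2 \<le> 1 / ?m * sqnorm u"
      using m e by (simp add: content_ball field_simps)
  qed
qed

lemma sqnorm_eq_0D:
  assumes u: "u \<in> bergman D" and "sqnorm u = 0"
  shows "u z = 0"
proof (cases "z \<in> D")
  case True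
  then obtain B where "0 \<le> B" "\<And>v w. v \<in> bergman D \<Longrightarrow> w \<in> {z} \<Longrightarrow> (cmod (v w))\<^sup>2 \<le> B * sqnorm v"
    using bergman_compact_bound[of "{z}"] by auto
  then have "(cmod (u z))\<^sup>2 \<le> B * sqnorm u" using u by blast
  then show ?thesis using assms(2) by simp
qed (use bergman_zero[OF u] in auto)

end

section \<open>Orthonormal expansions and bounded functionals\<close>

context
  fixes D :: "complex set" and e :: "nat \<Rightarrow> complex \<Rightarrow> complex"
  assumes open_D: "open D" and onb: "orthonormal_basis (bergman D) (bergman_inner D) e"
begin

lemma onb_mem: "e i \<in> bergman D"
  and onb_inner: "bergman_inner D (e i) (e j) = (if i = j then 1 else 0)"
  and onb_complete: "u \<in> bergman D \<Longrightarrow> (\<And>i. bergman_inner D u (e i) = 0) \<Longrightarrow> bergman_inner D u u = 0"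
  using onb by (auto simp: orthonormal_basis_def)

lemma onb_combination_mem: "finite J \<Longrightarrow> (\<lambda>z. \<Sum>i\<in>J. a i * e i z) \<in> bergman D"
  by (intro bergman_sum[OF open_D] bergman_scale[OF open_D] onb_mem)

lemma onb_combination_inner:
  assumes "finite J"
  shows "bergman_inner D (\<lambda>z. \<Sum>i\<in>J. a i * e i z) (e j) = (if j \<in> J then a j else 0)"
proof -
  have "bergman_inner D (\<lambda>z. \<Sum>i\<in>J. a i * e i z) (e j) = (\<Sum>i\<in>J. a i * bergman_inner D (e i) (e j))"
    by (simp add: bergman_inner_sum_left[OF open_D] assms bergman_scale[OF open_D] onb_mem bergman_inner_scale_left[OF open_D])
  also have "\<dots> = (\<Sum>i\<in>J. if i = j then a i else 0)"
    by (intro sum.cong) (auto simp: onb_inner)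
  finally show ?thesis using assms by (simp add: sum.delta)
qed

lemma inner_onb_combination:
  assumes "finite J" and v: "v \<in> bergman D"
  shows "bergman_inner D v (\<lambda>z. \<Sum>i\<in>J. a i * e i z) = (\<Sum>i\<in>J. cnj (a i) * bergman_inner D v (e i))"
proof -
  have "cnj (bergman_inner D (\<lambda>z. \<Sum>i\<in>J. a i * e i z) v) = (\<Sum>i\<in>J. cnj (a i) * cnj (bergman_inner D (e i) v))"
    by (simp add: bergman_inner_sum_left[OF open_D] assms bergman_scale[OF open_D] onb_mem bergman_inner_scale_left[OF open_D])
  then show ?thesis
    by (simp add: bergman_inner_cnj[OF open_D] onb_combination_mem assms onb_mem)
qed

lemma sqnorm_onb_combination:
  assumes "finite J"
  shows "sqnorm (\<lambda>z. \<Sum>i\<in>J. a i * e i z) = (\<Sum>i\<in>J. (cmod (a i))\<^sup>2)"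
proof -
  let ?v = "\<lambda>z. \<Sum>i\<in>J. a i * e i z"
  have "complex_of_real (sqnorm ?v) = bergman_inner D ?v ?v"
    by (rule bergman_inner_self[OF open_D, symmetric]) (rule onb_combination_mem[OF assms])
  also have "\<dots> = (\<Sum>i\<in>J. cnj (a i) * a i)"
    unfolding inner_onb_combination[OF assms onb_combination_mem[OF assms]] onb_combination_inner[OF assms]
    by (intro sum.cong) auto
  also have "\<dots> = of_real (\<Sum>i\<in>J. (cmod (a i))\<^sup>2)"
    unfolding of_real_sum by (intro sum.cong refl) (simp only: complex_norm_square mult.commute)
  finally show ?thesis using of_real_eq_iff by blast
qed

lemma Bessel_inequality:
  assumes u: "u \<in> bergman D" and "finite J"
  shows "(\<Sum>i\<in>J. (cmod (bergman_inner D u (e i)))\<^sup>2) \<le> sqnorm u"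
proof -
  define c where "c = (\<lambda>i. bergman_inner D u (e i))"
  let ?s = "\<lambda>z. \<Sum>i\<in>J. c i * e i z"
  let ?d = "\<lambda>z. u z - ?s z"
  note s = onb_combination_mem[OF \<open>finite J\<close>, of c]
  have d: "?d \<in> bergman D" by (intro bergman_diff[OF open_D] u s)
  have ds: "bergman_inner D ?d ?s = 0"
  proof -
    have "bergman_inner D ?d (e i) = 0" if "i \<in> J" for i
      unfolding bergman_inner_diff_left[OF open_D u s onb_mem] onb_combination_inner[OF \<open>finite J\<close>]
      using that by (simp add: c_def)
    then show ?thesis unfolding inner_onb_combination[OF \<open>finite J\<close> d] by simp
  qed
  have "complex_of_real (sqnorm ?d) = bergman_inner D ?d ?d"
    by (rule bergman_inner_self[OF open_D d, symmetric])
  also have "\<dots> = bergman_inner D u ?d - bergman_inner D ?s ?d"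
    by (rule bergman_inner_diff_left[OF open_D u s d])
  also have "bergman_inner D ?s ?d = 0"
    using bergman_inner_cnj[OF open_D d s] ds by simp
  also have "bergman_inner D u ?d = cnj (bergman_inner D ?d u)"
    by (rule bergman_inner_cnj[OF open_D d u, symmetric])
  also have "bergman_inner D ?d u = of_real (sqnorm u) - bergman_inner D ?s u"
    by (simp add: bergman_inner_diff_left[OF open_D u s u] bergman_inner_self[OF open_D u])
  also have "bergman_inner D ?s u = cnj (bergman_inner D u ?s)"
    by (rule bergman_inner_cnj[OF open_D u s, symmetric])
  also have "bergman_inner D u ?s = (\<Sum>i\<in>J. cnj (c i) * c i)"
    by (simp add: inner_onb_combination[OF \<open>finite J\<close> u] c_def)
  also have "\<dots> = of_real (\<Sum>i\<in>J. (cmod (c i))\<^sup>2)"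
    unfolding of_real_sum by (intro sum.cong refl) (simp only: complex_norm_square mult.commute)
  finally have "complex_of_real (sqnorm ?d) = of_real (sqnorm u - (\<Sum>i\<in>J. (cmod (c i))\<^sup>2))" by simp
  then have "sqnorm ?d = sqnorm u - (\<Sum>i\<in>J. (cmod (c i))\<^sup>2)" using of_real_eq_iff by blast
  then show ?thesis using sqnorm_nonneg[of ?d] by (simp add: c_def)
qed

text \<open>\<open>orthonormal_basis\<close> only says that a vector orthogonal to all
  \<open>e i\<close> has norm 0, so convergence of the expansion rests on the completeness of the
  Bergman space. The partial sums converge locally uniformly, their limit \<open>w\<close> is
  holomorphic and square integrable, and \<open>u - w\<close> is orthogonal to the basis.\<close>

theorem onb_expansion_converges:
  assumes u: "u \<in> bergman D"
  shows "(\<lambda>N. sqnorm (\<lambda>z. u z - (\<Sum>i<N. bergman_inner D u (e i) * e i z))) \<longlonglongrightarrow> 0"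
proof -
  define c where "c = (\<lambda>i. bergman_inner D u (e i))"
  define s where "s = (\<lambda>N z. \<Sum>i<N. c i * e i z)"
  have s_mem: "s N \<in> bergman D" for N unfolding s_def by (rule onb_combination_mem) simp
  have sumc: "summable (\<lambda>i. (cmod (c i))\<^sup>2)"
    by (rule bounded_imp_summable[where B = "sqnorm u"])
       (auto simp: c_def Bessel_inequality[OF u])
  define tail where "tail = (\<lambda>N. \<Sum>i. (cmod (c (i + N)))\<^sup>2)"
  have tail0: "tail \<longlonglongrightarrow> 0" unfolding tail_def by (rule suminf_exist_split2[OF sumc])
  have tail_nonneg: "0 \<le> tail N" for N
    unfolding tail_def by (intro suminf_nonneg summable_ignore_initial_segment sumc) auto
  have s_diff: "sqnorm (\<lambda>z. s M z - s N z) \<le> tail N" if "N \<le> M" for M N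
  proof -
    have "s M z - s N z = (\<Sum>i\<in>{N..<M}. c i * e i z)" for z
    proof -
      have "{..<M} = {..<N} \<union> {N..<M}" using that by auto
      then have "s M z = s N z + (\<Sum>i\<in>{N..<M}. c i * e i z)"
        unfolding s_def by (simp add: sum.union_disjoint ivl_disj_int)
      then show ?thesis by simp
    qed
    then have "sqnorm (\<lambda>z. s M z - s N z) = (\<Sum>i\<in>{N..<M}. (cmod (c i))\<^sup>2)"
      by (simp add: sqnorm_onb_combination)
    also have "\<dots> = (\<Sum>i<M - N. (cmod (c (i + N)))\<^sup>2)"
      using sum.shift_bounds_nat_ivl[of "\<lambda>i. (cmod (c i))\<^sup>2" 0 N "M - N"] that by (simp add: lessThan_atLeast0)
    also have "\<dots> \<le> tail N"
      unfolding tail_def by (rule sum_le_suminf[OF summable_ignore_initial_segment[OF sumc]]) auto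
    finally show ?thesis .
  qed
  have ptwise: "\<exists>l. (\<lambda>N. s N z) \<longlonglongrightarrow> l" for z
  proof (cases "z \<in> D")
    case True
    obtain B where B: "0 \<le> B" "\<And>u w. u \<in> bergman D \<Longrightarrow> w \<in> {z} \<Longrightarrow> (cmod (u w))\<^sup>2 \<le> B * sqnorm u"
      using bergman_compact_bound[OF open_D, of "{z}"] True by auto
    have "Cauchy (\<lambda>N. s N z)"
    proof (rule metric_CauchyI)
      fix \<epsilon> :: real assume "0 < \<epsilon>"
      have "(\<lambda>N. B * tail N) \<longlonglongrightarrow> B * 0" by (intro tendsto_intros tail0)
      then have "eventually (\<lambda>N. B * tail N < (\<epsilon> / 2)\<^sup>2) sequentially"
        by (rule order_tendstoD) (use \<open>0 < \<epsilon>\<close> in simp)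
      then obtain N0 where N0: "B * tail N0 < (\<epsilon> / 2)\<^sup>2" by (auto simp: eventually_sequentially)
      have *: "dist (s M z) (s N0 z) < \<epsilon> / 2" if "M \<ge> N0" for M
      proof -
        have "(cmod (s M z - s N0 z))\<^sup>2 \<le> B * sqnorm (\<lambda>z. s M z - s N0 z)"
          using B(2)[OF bergman_diff[OF open_D s_mem s_mem], of z M N0] by simp
        also have "\<dots> \<le> B * tail N0" using s_diff[OF that] B(1) by (rule mult_left_mono)
        finally have "(cmod (s M z - s N0 z))\<^sup>2 < (\<epsilon> / 2)\<^sup>2" using N0 by simp
        then show ?thesis
          unfolding dist_norm by (rule power2_less_imp_less) (use \<open>0 < \<epsilon>\<close> in simp)
      qed
      show "\<exists>M. \<forall>m\<ge>M. \<forall>n\<ge>M. dist (s m z) (s n z) < \<epsilon>"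
      proof (intro exI[of _ N0] allI impI)
        fix m n assume "N0 \<le> m" "N0 \<le> n"
        then show "dist (s m z) (s n z) < \<epsilon>"
          using dist_triangle_half_l[OF *[of m] *[of n]] by simp
      qed
    qed
    then show ?thesis by (simp add: Cauchy_convergent_iff convergent_def)
  next
    case False
    then have "s N z = 0" for N using bergman_zero[OF open_D s_mem] by simp
    then show ?thesis by auto
  qed
  then obtain w where w: "\<And>z. (\<lambda>N. s N z) \<longlonglongrightarrow> w z" by metis
  have w0: "w z = 0" if "z \<notin> D" for z
    using w[of z] bergman_zero[OF open_D s_mem that] LIMSEQ_unique[of "\<lambda>_. 0" 0] by simp
  have w_hol: "w holomorphic_on D"
  proof (rule holomorphic_uniform_sequence[OF open_D])
    show "s N holomorphic_on D" for N by (rule bergman_holomorphic[OF open_D s_mem])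
    fix x assume "x \<in> D"
    then obtain d where d: "0 < d" "cball x d \<subseteq> D" using open_D open_contains_cball by blast
    obtain B where B: "0 \<le> B" "\<And>u w. u \<in> bergman D \<Longrightarrow> w \<in> cball x d \<Longrightarrow> (cmod (u w))\<^sup>2 \<le> B * sqnorm u"
      using bergman_compact_bound[OF open_D compact_cball d(2)] by blast
    have "uniform_limit (cball x d) s w sequentially"
    proof (rule uniform_limitI)
      fix \<epsilon> :: real assume "0 < \<epsilon>"
      have "(\<lambda>N. B * tail N) \<longlonglongrightarrow> B * 0" by (intro tendsto_intros tail0)
      then have "eventually (\<lambda>N. B * tail N < \<epsilon>\<^sup>2) sequentially"
        by (rule order_tendstoD) (use \<open>0 < \<epsilon>\<close> in simp)
      then show "\<forall>\<^sub>F N in sequentially. \<forall>z\<in>cball x d. dist (s N z) (w z) < \<epsilon>"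
      proof (rule eventually_mono, intro ballI)
        fix N z assume N: "B * tail N < \<epsilon>\<^sup>2" and z: "z \<in> cball x d"
        have "(\<lambda>M. (cmod (s M z - s N z))\<^sup>2) \<longlonglongrightarrow> (cmod (w z - s N z))\<^sup>2"
          by (intro tendsto_intros w)
        then have "(cmod (w z - s N z))\<^sup>2 \<le> B * tail N"
        proof (rule LIMSEQ_le_const2)
          have "(cmod (s M z - s N z))\<^sup>2 \<le> B * tail N" if "M \<ge> N" for M
            using B(2)[OF bergman_diff[OF open_D s_mem s_mem] z, of M N] mult_left_mono[OF s_diff[OF that] B(1)]
            by linarith
          then show "\<exists>N'. \<forall>M\<ge>N'. (cmod (s M z - s N z))\<^sup>2 \<le> B * tail N" by blast
        qed
        then have "(cmod (w z - s N z))\<^sup>2 < \<epsilon>\<^sup>2" using N by simp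
        then show "dist (s N z) (w z) < \<epsilon>"
          unfolding dist_norm norm_minus_commute[of "s N z"]
          by (rule power2_less_imp_less) (use \<open>0 < \<epsilon>\<close> in simp)
      qed
    qed
    then show "\<exists>d>0. cball x d \<subseteq> D \<and> uniform_limit (cball x d) s w sequentially" using d by blast
  qed
  \<comment> \<open>Letting the larger index in \<open>s_diff\<close> tend to infinity, Fatou's
    lemma transfers the bound from differences of partial sums to the limit; the case
    \<open>N = 0\<close> shows that \<open>w\<close> is square integrable.\<close>
  have Fatou: "integrable lborel (\<lambda>z. (cmod (w z - s N z))\<^sup>2) \<and> sqnorm (\<lambda>z. w z - s N z) \<le> tail N" for N
  proof -
    note [measurable] = bergman_measurable[OF open_D s_mem]
    have [measurable]: "w \<in> borel_measurable borel"
      by (rule borel_measurable_LIMSEQ_metric[OF _ w]) measurable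
    have lim: "(\<lambda>M. ennreal ((cmod (s M z - s N z))\<^sup>2)) \<longlonglongrightarrow> ennreal ((cmod (w z - s N z))\<^sup>2)" for z
      by (intro tendsto_ennrealI tendsto_intros w)
    have "(\<integral>\<^sup>+z. ennreal ((cmod (w z - s N z))\<^sup>2) \<partial>lborel) = (\<integral>\<^sup>+z. liminf (\<lambda>M. ennreal ((cmod (s M z - s N z))\<^sup>2)) \<partial>lborel)"
      using lim_imp_Liminf[OF _ lim] by simp
    also have "\<dots> \<le> liminf (\<lambda>M. \<integral>\<^sup>+z. ennreal ((cmod (s M z - s N z))\<^sup>2) \<partial>lborel)"
      by (rule nn_integral_liminf) measurable
    also have "\<dots> \<le> liminf (\<lambda>M. ennreal (tail N))"
    proof (rule Liminf_mono)
      have "(\<integral>\<^sup>+z. ennreal ((cmod (s M z - s N z))\<^sup>2) \<partial>lborel) \<le> ennreal (tail N)" if "M \<ge> N" for M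
        using nn_integral_eq_integral[OF bergman_square_integrable[OF open_D bergman_diff[OF open_D s_mem s_mem]], of M N] s_diff[OF that]
        by (simp add: sqnorm_def ennreal_leI)
      then show "\<forall>\<^sub>F M in sequentially. (\<integral>\<^sup>+z. ennreal ((cmod (s M z - s N z))\<^sup>2) \<partial>lborel) \<le> ennreal (tail N)"
        unfolding eventually_sequentially by blast
    qed
    also have "\<dots> = ennreal (tail N)" by (simp add: Liminf_const)
    finally have le: "(\<integral>\<^sup>+z. ennreal ((cmod (w z - s N z))\<^sup>2) \<partial>lborel) \<le> ennreal (tail N)" .
    then have int: "integrable lborel (\<lambda>z. (cmod (w z - s N z))\<^sup>2)"
      by (intro integrableI_nonneg) (auto intro: le_less_trans)
    have "ennreal (sqnorm (\<lambda>z. w z - s N z)) \<le> ennreal (tail N)"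
      using nn_integral_eq_integral[OF int] le by (simp add: sqnorm_def)
    then show ?thesis using int tail_nonneg by (simp add: ennreal_le_iff)
  qed
  have w_mem: "w \<in> bergman D"
  proof (rule bergmanI[OF open_D w_hol])
    show "integrable lborel (\<lambda>z. (cmod (w z))\<^sup>2)" using Fatou[of 0] by (simp add: s_def)
  qed (rule w0)
  have inner_w: "bergman_inner D w (e j) = c j" for j
  proof -
    have "(cmod (bergman_inner D w (e j) - c j))\<^sup>2 \<le> tail N" if "N > j" for N
    proof -
      have "bergman_inner D w (e j) - c j = bergman_inner D (\<lambda>z. w z - s N z) (e j)"
        unfolding bergman_inner_diff_left[OF open_D w_mem s_mem onb_mem]
        using that onb_combination_inner[of "{..<N}" c j] by (simp add: s_def)
      then have "(cmod (bergman_inner D w (e j) - c j))\<^sup>2 \<le> sqnorm (\<lambda>z. w z - s N z) * sqnorm (e j)"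
        using bergman_Cauchy_Schwarz[OF open_D bergman_diff[OF open_D w_mem s_mem] onb_mem] by simp
      also have "sqnorm (e j) = 1"
        using bergman_inner_self[OF open_D onb_mem, of j] onb_inner[of j j] by (metis of_real_eq_1_iff)
      finally show ?thesis using Fatou[of N] by simp
    qed
    then have "(cmod (bergman_inner D w (e j) - c j))\<^sup>2 \<le> 0"
      by (intro LIMSEQ_le_const[OF tail0]) (meson Suc_le_eq)
    then show ?thesis by simp
  qed
  have "bergman_inner D (\<lambda>z. u z - w z) (\<lambda>z. u z - w z) = 0"
    by (rule onb_complete[OF bergman_diff[OF open_D u w_mem]])
       (simp add: bergman_inner_diff_left[OF open_D u w_mem onb_mem] inner_w c_def)
  then have "sqnorm (\<lambda>z. u z - w z) = 0"
    using bergman_inner_self[OF open_D bergman_diff[OF open_D u w_mem]] by simp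
  then have "u z = w z" for z
    using sqnorm_eq_0D[OF open_D bergman_diff[OF open_D u w_mem], of z] by simp
  then have le: "sqnorm (\<lambda>z. u z - s N z) \<le> tail N" for N
    using Fatou[of N] by simp
  have "(\<lambda>N. sqnorm (\<lambda>z. u z - s N z)) \<longlonglongrightarrow> 0"
  proof (rule tendsto_sandwich[OF _ _ tendsto_const tail0])
    show "\<forall>\<^sub>F N in sequentially. 0 \<le> sqnorm (\<lambda>z. u z - s N z)" by (simp add: sqnorm_nonneg)
    show "\<forall>\<^sub>F N in sequentially. sqnorm (\<lambda>z. u z - s N z) \<le> tail N" using le by simp
  qed
  then show ?thesis by (simp add: s_def c_def)
qed

context
  fixes \<phi> :: "(complex \<Rightarrow> complex) \<Rightarrow> complex" and B :: real
  assumes add: "\<And>u v. u \<in> bergman D \<Longrightarrow> v \<in> bergman D \<Longrightarrow> \<phi> (\<lambda>z. u z + v z) = \<phi> u + \<phi> v"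
    and scale: "\<And>a u. u \<in> bergman D \<Longrightarrow> \<phi> (\<lambda>z. a * u z) = a * \<phi> u"
    and bound: "\<And>u. u \<in> bergman D \<Longrightarrow> (cmod (\<phi> u))\<^sup>2 \<le> B * sqnorm u"
begin

lemma functional_onb_combination:
  assumes "finite J"
  shows "\<phi> (\<lambda>z. \<Sum>i\<in>J. a i * e i z) = (\<Sum>i\<in>J. a i * \<phi> (e i))"
  using assms
proof (induction J rule: finite_induct)
  case empty
  have "\<phi> (\<lambda>z. 0) = 0" using scale[OF bergman_0[OF open_D], of 0] by simp
  then show ?case by simp
next
  case (insert i J)
  then show ?case
    by (simp add: add[OF bergman_scale[OF open_D onb_mem] onb_combination_mem] scale[OF onb_mem])
qed

text \<open>The bound is tested on the combination with coefficients
  \<open>cnj (\<phi> (e i))\<close>, on which \<open>\<phi>\<close> takes the value of the sum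
  itself. Applied to a family of functionals with summable bounds \<open>B\<close>, this gives the
  Hilbert-Schmidt property.\<close>

lemma functional_square_sum:
  assumes "finite J"
  shows "(\<Sum>i\<in>J. (cmod (\<phi> (e i)))\<^sup>2) \<le> B"
proof -
  let ?v = "\<lambda>z. \<Sum>i\<in>J. cnj (\<phi> (e i)) * e i z"
  let ?S = "\<Sum>i\<in>J. (cmod (\<phi> (e i)))\<^sup>2"
  have S: "0 \<le> ?S" by (intro sum_nonneg) auto
  have "\<phi> ?v = of_real ?S"
    unfolding functional_onb_combination[OF assms] of_real_sum
    by (intro sum.cong refl) (simp only: complex_norm_square mult.commute)
  then have "?S\<^sup>2 = (cmod (\<phi> ?v))\<^sup>2" using S by (simp only: norm_of_real power2_abs)
  also have "\<dots> \<le> B * sqnorm ?v" by (rule bound[OF onb_combination_mem[OF assms]])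
  also have "sqnorm ?v = ?S" using sqnorm_onb_combination[OF assms, of "\<lambda>i. cnj (\<phi> (e i))"] by simp
  finally have "?S * ?S \<le> B * ?S" by (simp add: power2_eq_square)
  moreover have "0 \<le> B"
  proof -
    have "sqnorm (e 0) = 1"
      using bergman_inner_self[OF open_D onb_mem, of 0] onb_inner[of 0 0] by (metis of_real_eq_1_iff)
    then show ?thesis using bound[OF onb_mem, of 0] zero_le_power2 order_trans by (metis mult.right_neutral)
  qed
  ultimately show ?thesis using S by (cases "?S = 0") (auto simp: mult_le_cancel_right)
qed

lemma functional_square_summable: "(\<lambda>i. (cmod (\<phi> (e i)))\<^sup>2) summable_on UNIV"
  by (rule nonneg_bdd_above_summable_on) (auto intro!: bdd_aboveI[of _ B] functional_square_sum)

text \<open>Boundedness carries the norm convergence of the expansion of \<open>u\<close> over to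
  \<open>\<phi>\<close>; Bessel's inequality and the square summability of
  \<open>\<phi> (e i)\<close> make the resulting series absolutely convergent.\<close>

lemma functional_onb_expansion:
  assumes u: "u \<in> bergman D"
  shows "((\<lambda>i. bergman_inner D u (e i) * \<phi> (e i)) has_sum \<phi> u) UNIV"
proof -
  define c where "c = (\<lambda>i. bergman_inner D u (e i))"
  have "(\<lambda>i. (cmod (c i))\<^sup>2) summable_on UNIV"
    by (rule nonneg_bdd_above_summable_on)
       (auto intro!: bdd_aboveI[of _ "sqnorm u"] Bessel_inequality[OF u] simp: c_def)
  then have "(\<lambda>i. norm (c i * \<phi> (e i))) summable_on UNIV"
    by (intro summable_mult_of_square_summable functional_square_summable)
  then have summ: "(\<lambda>i. c i * \<phi> (e i)) summable_on UNIV" by (rule abs_summable_summable)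
  have "(\<lambda>N. \<phi> u - (\<Sum>i<N. c i * \<phi> (e i))) \<longlonglongrightarrow> 0"
  proof (rule Lim_null_comparison)
    have "cmod (\<phi> u - (\<Sum>i<N. c i * \<phi> (e i))) \<le> sqrt (B * sqnorm (\<lambda>z. u z - (\<Sum>i<N. c i * e i z)))" for N
    proof (rule real_le_rsqrt)
      let ?s = "\<lambda>z. \<Sum>i<N. c i * e i z"
      have s: "?s \<in> bergman D" by (rule onb_combination_mem) simp
      have "\<phi> (\<lambda>z. u z + (-1) * ?s z) = \<phi> u - \<phi> ?s"
        by (simp only: add[OF u bergman_scale[OF open_D s]] scale[OF s]) simp
      then have "\<phi> u - (\<Sum>i<N. c i * \<phi> (e i)) = \<phi> (\<lambda>z. u z - ?s z)"
        by (simp add: functional_onb_combination)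
      then show "(cmod (\<phi> u - (\<Sum>i<N. c i * \<phi> (e i))))\<^sup>2 \<le> B * sqnorm (\<lambda>z. u z - ?s z)"
        using bound[OF bergman_diff[OF open_D u s]] by simp
    qed
    then show "\<forall>\<^sub>F N in sequentially. cmod (\<phi> u - (\<Sum>i<N. c i * \<phi> (e i))) \<le> sqrt (B * sqnorm (\<lambda>z. u z - (\<Sum>i<N. c i * e i z)))"
      by simp
    have "(\<lambda>N. sqrt (B * sqnorm (\<lambda>z. u z - (\<Sum>i<N. c i * e i z)))) \<longlonglongrightarrow> sqrt (B * 0)"
      using onb_expansion_converges[OF u] unfolding c_def by (intro tendsto_intros)
    then show "(\<lambda>N. sqrt (B * sqnorm (\<lambda>z. u z - (\<Sum>i<N. c i * e i z)))) \<longlonglongrightarrow> 0" by simp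
  qed
  then have "(\<lambda>N. \<phi> u - (\<phi> u - (\<Sum>i<N. c i * \<phi> (e i)))) \<longlonglongrightarrow> \<phi> u - 0"
    by (intro tendsto_diff tendsto_const)
  then have "(\<lambda>i. c i * \<phi> (e i)) sums \<phi> u" by (simp add: sums_def)
  moreover have "(\<lambda>i. c i * \<phi> (e i)) sums infsum (\<lambda>i. c i * \<phi> (e i)) UNIV"
    by (rule has_sum_imp_sums[OF has_sum_infsum[OF summ]])
  ultimately have "infsum (\<lambda>i. c i * \<phi> (e i)) UNIV = \<phi> u" using sums_unique2 by blast
  then show ?thesis using has_sum_infsum[OF summ] by (simp add: c_def)
qed

end

end

section \<open>The transfer operator of a quadratic map\<close>

lemma bergman_boundedI:
  assumes "open D" "bounded D" and f: "f holomorphic_on D" and B: "\<And>z. z \<in> D \<Longrightarrow> cmod (f z) \<le> B"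
  shows "(\<lambda>z. if z \<in> D then f z else 0) \<in> bergman D"
    and "sqnorm (\<lambda>z. if z \<in> D then f z else 0) \<le> B\<^sup>2 * measure lborel D"
proof -
  let ?f = "\<lambda>z. if z \<in> D then f z else 0"
  have hol: "?f holomorphic_on D"
    using f by (rule holomorphic_transform) simp
  have eq: "(\<lambda>z. indicat_real D z *\<^sub>R (cmod (f z))\<^sup>2) = (\<lambda>z. (cmod (?f z))\<^sup>2)"
    by (auto simp: fun_eq_iff)
  have f2: "(cmod (f z))\<^sup>2 \<le> B\<^sup>2" if "z \<in> D" for z
    using B[OF that] by (intro power_mono) auto
  have "set_integrable lborel D (\<lambda>z. (cmod (f z))\<^sup>2)"
    by (rule set_integrable_bounded_continuous[where B = "B\<^sup>2"])
       (use assms f2 in \<open>auto intro!: continuous_intros holomorphic_on_imp_continuous_on\<close>)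
  then have int: "integrable lborel (\<lambda>z. (cmod (?f z))\<^sup>2)"
    unfolding set_integrable_def eq .
  show "?f \<in> bergman D" by (rule bergmanI[OF \<open>open D\<close> hol int]) simp
  have fin: "emeasure lborel D < \<infinity>" using \<open>bounded D\<close> by (rule emeasure_bounded_finite)
  have "sqnorm ?f \<le> (\<integral>z. indicat_real D z * B\<^sup>2 \<partial>lborel)"
    unfolding sqnorm_def
  proof (rule integral_mono[OF int])
    show "integrable lborel (\<lambda>z. indicat_real D z * B\<^sup>2)"
      using fin \<open>open D\<close> by (intro integrable_mult_left) (auto simp: integrable_indicator_iff borel_open)
    show "(cmod (?f z))\<^sup>2 \<le> indicat_real D z * B\<^sup>2" for z using f2 by auto
  qed
  then show "sqnorm ?f \<le> B\<^sup>2 * measure lborel D" by (simp add: mult.commute)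
qed

lemma g_plus_squared: "(g_plus c z)\<^sup>2 = z - of_real c"
  by (simp add: g_plus_def)

lemma g_minus_eq: "g_minus c z = - g_plus c z"
  by (simp add: g_plus_def g_minus_def)

locale quadratic_family =
  fixes c R :: real
  assumes c: "c < - 3.75" and R: "zeta_fix c < R" "R < - c"
begin

abbreviation "\<zeta> \<equiv> zeta_fix c"

lemma zeta_eq: "\<zeta>\<^sup>2 = \<zeta> - c" and zeta_gt: "5 / 2 < \<zeta>"
proof -
  have "(sqrt (1 - 4 * c))\<^sup>2 = 1 - 4 * c" using c by simp
  then show "\<zeta>\<^sup>2 = \<zeta> - c" by (simp add: zeta_fix_def power2_eq_square field_simps)
  have "sqrt (4\<^sup>2) < sqrt (1 - 4 * c)" using c by (subst real_sqrt_less_iff) simp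
  then show "5 / 2 < \<zeta>" by (simp add: zeta_fix_def)
qed

text \<open>Since |z - c| < R - c on the disc of radius \<open>R\<close>, both branches map that
  disc into the disc of this radius. It is smaller than \<open>R\<close> because \<open>R\<close>
  exceeds the fixed point \<open>\<zeta>\<close>.\<close>

definition "r0 = sqrt (R - c)"

lemma R_pos: "0 < R" using zeta_gt R by simp

lemma r0_pos: "0 < r0" using R_pos c by (simp add: r0_def)

lemma quadratic_growth: "\<zeta> < x \<Longrightarrow> x - c < x\<^sup>2"
proof -
  assume x: "\<zeta> < x"
  have "x\<^sup>2 - (x - c) = (x - \<zeta>) * (x + \<zeta> - 1)"
    using zeta_eq by (simp add: power2_eq_square algebra_simps)
  also have "\<dots> > 0" using x zeta_gt by (intro mult_pos_pos) auto
  finally show ?thesis by simp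
qed

lemma r0_less: "r0 < R"
  using quadratic_growth[OF R(1)] R_pos by (simp add: r0_def real_less_lsqrt)

lemma zeta_less_r0: "\<zeta> < r0"
  unfolding r0_def using zeta_eq R zeta_gt by (intro real_less_rsqrt) simp

lemma Re_shift_pos:
  assumes "z \<in> ball 0 R"
  shows "0 < Re (z - of_real c)"
proof -
  have "\<bar>Re z\<bar> < R" using assms abs_Re_le_cmod[of z] by simp
  then show ?thesis using R(2) by simp
qed

lemma shift_nonpos: "z \<in> ball 0 R \<Longrightarrow> z - complex_of_real c \<notin> \<real>\<^sub>\<le>\<^sub>0"
  using Re_shift_pos[of z] by (auto simp: complex_nonpos_Reals_iff)

lemma Re_g_plus_pos: "z \<in> ball 0 R \<Longrightarrow> 0 < Re (g_plus c z)"
proof -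
  assume z: "z \<in> ball 0 R"
  have "Re ((g_plus c z)\<^sup>2) > 0" using Re_shift_pos[OF z] by (simp add: g_plus_squared)
  then have "Re (g_plus c z) \<noteq> 0" by (auto simp: power2_eq_square)
  then show ?thesis using Re_csqrt[of "z - of_real c"] by (simp add: g_plus_def)
qed

lemma g_plus_nonzero: "z \<in> ball 0 R \<Longrightarrow> g_plus c z \<noteq> 0"
  using Re_g_plus_pos by fastforce

lemma norm_g_plus: "cmod (g_plus c z) = sqrt (cmod (z - of_real c))"
  by (simp add: g_plus_def)

lemma norm_g_plus_le: "cmod z \<le> \<rho> \<Longrightarrow> cmod (g_plus c z) \<le> sqrt (\<rho> - c)"
  unfolding norm_g_plus using norm_triangle_ineq4[of z "of_real c"] c by (intro real_sqrt_le_mono) simp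

lemma norm_g_plus_less: "z \<in> ball 0 R \<Longrightarrow> cmod (g_plus c z) < r0"
  unfolding norm_g_plus r0_def using norm_triangle_ineq4[of z "of_real c"] c by (intro real_sqrt_less_mono) simp

lemma g_plus_has_field_derivative:
  assumes "z \<in> ball 0 R"
  shows "(g_plus c has_field_derivative 1 / (2 * g_plus c z)) (at z)"
  unfolding g_plus_def[abs_def] using shift_nonpos[OF assms]
  by (auto intro!: derivative_eq_intros simp: field_simps)

lemma g_minus_has_field_derivative:
  assumes "z \<in> ball 0 R"
  shows "(g_minus c has_field_derivative 1 / (2 * g_minus c z)) (at z)"
  using DERIV_minus[OF g_plus_has_field_derivative[OF assms]] by (simp add: g_minus_eq[abs_def])

lemma g_plus_holomorphic: "g_plus c holomorphic_on ball 0 R" and g_minus_holomorphic: "g_minus c holomorphic_on ball 0 R"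
  unfolding holomorphic_on_open[OF open_ball]
  using g_plus_has_field_derivative g_minus_has_field_derivative by blast+

lemma inj_g_plus: "inj_on (g_plus c) A" and inj_g_minus: "inj_on (g_minus c) A"
  by (metis inj_onI quad_map_g_plus) (metis inj_onI quad_map_g_minus)

lemma open_D_plus: "open (D_plus c R)" and open_D_minus: "open (D_minus c R)"
  unfolding D_plus_def D_minus_def
  using open_mapping_thm3[OF g_plus_holomorphic open_ball inj_g_plus]
    open_mapping_thm3[OF g_minus_holomorphic open_ball inj_g_minus] by auto

lemma g_plus_neq_g_minus:
  assumes "z \<in> ball 0 R" "x \<in> ball 0 R"
  shows "g_plus c z \<noteq> g_minus c x"
proof
  assume "g_plus c z = g_minus c x"
  then have "Re (g_plus c z) = - Re (g_plus c x)" by (simp add: g_minus_eq)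
  then show False using Re_g_plus_pos[OF assms(1)] Re_g_plus_pos[OF assms(2)] by simp
qed

lemma D_disjoint: "D_plus c R \<inter> D_minus c R = {}"
  using g_plus_neq_g_minus by (fastforce simp: D_plus_def D_minus_def)

abbreviation "D \<equiv> D_plus c R \<union> D_minus c R"

lemma open_D: "open D" using open_D_plus open_D_minus by blast

lemma D_subset: "D \<subseteq> ball 0 r0"
  using norm_g_plus_less by (auto simp: D_plus_def D_minus_def g_minus_eq)

lemma D_subset_R: "D \<subseteq> ball 0 R"
  using D_subset r0_less by force

lemma bounded_D: "bounded D" using D_subset bounded_subset bounded_ball by blast

lemma quad_map_D: "w \<in> D \<Longrightarrow> quad_map c w \<in> ball 0 R"
  by (auto simp: D_plus_def D_minus_def quad_map_g_plus quad_map_g_minus)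

definition branch :: "nat \<Rightarrow> complex \<Rightarrow> complex" where
  "branch b = (if b = 0 then g_plus c else g_minus c)"

definition D_branch :: "nat \<Rightarrow> complex set" where
  "D_branch b = branch b ` ball 0 R"

lemma D_branch_subset: "D_branch b \<subseteq> D" and open_D_branch: "open (D_branch b)"
  using open_D_plus open_D_minus by (auto simp: D_branch_def branch_def D_plus_def D_minus_def)

lemma branch_deriv: "z \<in> ball 0 R \<Longrightarrow> deriv (branch b) z = 1 / (2 * branch b z)"
  by (simp add: branch_def DERIV_imp_deriv[OF g_plus_has_field_derivative] DERIV_imp_deriv[OF g_minus_has_field_derivative])

lemma branch_holomorphic: "branch b holomorphic_on ball 0 R"
  using g_plus_holomorphic g_minus_holomorphic by (simp add: branch_def)

lemma inj_branch: "inj_on (branch b) A"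
  using inj_g_plus inj_g_minus by (simp add: branch_def)

lemma quad_map_branch: "quad_map c (branch b z) = z"
  by (simp add: branch_def quad_map_g_plus quad_map_g_minus)

lemma branch_nonzero: "z \<in> ball 0 R \<Longrightarrow> branch b z \<noteq> 0"
  using g_plus_nonzero by (auto simp: branch_def g_minus_eq)

text \<open>The normalised monomials of the disc of radius \<open>R\<close>, pulled back to one
  component of \<open>D\<close> by \<open>quad_map c\<close>. The factor \<open>2 * w\<close> is the
  derivative of \<open>quad_map c\<close>, which makes the pull-back unitary.\<close>

definition basis_elem :: "nat \<Rightarrow> nat \<Rightarrow> complex \<Rightarrow> complex" where
  "basis_elem b n w = (if w \<in> D_branch b then of_real (1 / sqrt (moment R n)) * (2 * w * quad_map c w ^ n) else 0)"

lemma basis_elem_mem: "basis_elem b n \<in> bergman D"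
proof -
  let ?f = "\<lambda>w. of_real (1 / sqrt (moment R n)) * (2 * w * quad_map c w ^ n)"
  have hol: "basis_elem b n holomorphic_on D"
  proof -
    let ?A = "D_branch b" and ?B = "D - D_branch b"
    have "D_branch b = D_plus c R \<or> D_branch b = D_minus c R"
      by (simp add: D_branch_def branch_def D_plus_def D_minus_def)
    then have "?B = D_minus c R \<or> ?B = D_plus c R" using D_disjoint by auto
    then have oB: "open ?B" using open_D_plus open_D_minus by auto
    have "basis_elem b n holomorphic_on ?A"
      by (rule holomorphic_transform[of ?f]) (auto intro!: holomorphic_intros simp: basis_elem_def quad_map_def[abs_def])
    moreover have "basis_elem b n holomorphic_on ?B"
      by (rule holomorphic_transform[of "\<lambda>_. 0"]) (auto simp: basis_elem_def)
    ultimately have "basis_elem b n holomorphic_on (?A \<union> ?B)"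
      using holomorphic_on_Un[OF _ _ open_D_branch oB] by blast
    then show ?thesis using D_branch_subset by (simp add: Un_absorb1)
  qed
  have "(\<lambda>z. if z \<in> D then basis_elem b n z else 0) \<in> bergman D"
  proof (rule bergman_boundedI(1)[OF open_D bounded_D hol])
    fix w assume w: "w \<in> D"
    then have "cmod w \<le> R" "cmod (quad_map c w) \<le> R" using D_subset_R quad_map_D[OF w] by auto
    moreover have "cmod (basis_elem b n w) \<le> 1 / sqrt (moment R n) * (2 * cmod w * cmod (quad_map c w) ^ n)"
      using moment_pos[OF R_pos, of n] by (auto simp: basis_elem_def norm_mult norm_divide norm_power)
    moreover have "\<dots> \<le> 1 / sqrt (moment R n) * (2 * R * R ^ n)"
      using calculation moment_pos[OF R_pos, of n] R_pos by (intro mult_left_mono mult_mono power_mono) auto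
    ultimately show "cmod (basis_elem b n w) \<le> 1 / sqrt (moment R n) * (2 * R * R ^ n)" by linarith
  qed
  moreover have "(\<lambda>z. if z \<in> D then basis_elem b n z else 0) = basis_elem b n"
    using D_branch_subset by (auto simp: fun_eq_iff basis_elem_def)
  ultimately show ?thesis by simp
qed

text \<open>The substitution \<open>w = branch b z\<close> has Jacobian |1 / (2 branch b z)|^2, of
  which one factor cancels against the \<open>2 * w\<close> of the basis element. What remains is a
  moment on the disc.\<close>

lemma inner_basis_elem:
  assumes u: "u \<in> bergman D"
  shows "bergman_inner D u (basis_elem b n)
      = of_real (1 / sqrt (moment R n)) * (LINT z:ball 0 R|lborel. u (branch b z) / (2 * branch b z) * cnj z ^ n)"
    and "set_integrable lborel (ball 0 R) (\<lambda>z. u (branch b z) / (2 * branch b z) * cnj z ^ n)"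
proof -
  let ?k = "of_real (1 / sqrt (moment R n)) :: complex"
  have k: "?k \<noteq> 0" using moment_pos[OF R_pos, of n] by simp
  let ?F = "\<lambda>w. u w * cnj (basis_elem b n w)"
  let ?G = "\<lambda>z. u (branch b z) / (2 * branch b z) * cnj z ^ n"
  have ind: "indicat_real (D_branch b) w *\<^sub>R ?F w = ?F w" for w
    by (auto simp: basis_elem_def indicator_def)
  have int: "set_integrable lborel (D_branch b) ?F"
    unfolding set_integrable_def ind by (rule bergman_integrable[OF open_D u basis_elem_mem])
  have cont: "continuous_on (D_branch b) ?F"
    using holomorphic_on_imp_continuous_on[OF bergman_holomorphic[OF open_D u]]
      holomorphic_on_imp_continuous_on[OF bergman_holomorphic[OF open_D basis_elem_mem]]
    by (intro continuous_intros) (auto intro: continuous_on_subset[OF _ D_branch_subset])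
  have J: "of_real ((cmod (deriv (branch b) z))\<^sup>2) * ?F (branch b z) = ?k * ?G z" if z: "z \<in> ball 0 R" for z
  proof -
    have 1: "basis_elem b n (branch b z) = ?k * (2 * branch b z * z ^ n)"
      using z by (simp add: basis_elem_def D_branch_def quad_map_branch)
    have 2: "of_real ((cmod (deriv (branch b) z))\<^sup>2) = 1 / (2 * branch b z) * cnj (1 / (2 * branch b z))"
      unfolding branch_deriv[OF z] by (rule complex_norm_square)
    show ?thesis
      unfolding 1 2 using branch_nonzero[OF z, of b] by (simp add: field_simps)
  qed
  note cov = holomorphic_change_of_variables[OF open_ball branch_holomorphic inj_branch cont[unfolded D_branch_def], folded D_branch_def]
  have "set_integrable lborel (ball 0 R) (\<lambda>z. of_real ((cmod (deriv (branch b) z))\<^sup>2) * ?F (branch b z))"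
    using cov(1) int by blast
  then have "set_integrable lborel (ball 0 R) (\<lambda>z. ?k * ?G z)"
    using J by (subst (asm) set_integrable_cong[OF refl refl]) auto
  then show "set_integrable lborel (ball 0 R) ?G"
    unfolding set_integrable_mult_right_iff[OF k] .
  have "bergman_inner D u (basis_elem b n) = (LINT w:D_branch b|lborel. ?F w)"
    by (simp add: bergman_inner_eq[OF open_D u] set_lebesgue_integral_def ind)
  also have "\<dots> = (LINT z:ball 0 R|lborel. of_real ((cmod (deriv (branch b) z))\<^sup>2) * ?F (branch b z))"
    by (rule cov(2)[OF int])
  also have "\<dots> = (LINT z:ball 0 R|lborel. ?k * ?G z)"
    by (rule set_lebesgue_integral_cong) (use J in auto)
  also have "\<dots> = ?k * (LINT z:ball 0 R|lborel. ?G z)" by (rule set_integral_mult_right)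
  finally show "bergman_inner D u (basis_elem b n) = ?k * (LINT z:ball 0 R|lborel. ?G z)" .
qed

text \<open>The vanishing moments are those over the full disc, up to whose boundary
  \<open>U\<close> need not be regular, whereas \<open>holomorphic_moment\<close> asks for a smaller
  radius. Exhausting the disc by radii \<open>r k\<close> shows that each Taylor coefficient of
  \<open>U\<close>, times moments bounded away from 0, tends to 0.\<close>

lemma orthogonal_to_basis_imp_zero:
  assumes u: "u \<in> bergman D" and ortho: "\<And>n. bergman_inner D u (basis_elem b n) = 0" and w: "w \<in> D_branch b"
  shows "u w = 0"
proof -
  define U where "U = (\<lambda>z. u (branch b z) / (2 * branch b z))"
  have "(u \<circ> branch b) holomorphic_on ball 0 R"
    by (rule holomorphic_on_compose[OF branch_holomorphic holomorphic_on_subset[OF bergman_holomorphic[OF open_D u]]])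
       (use D_branch_subset in \<open>auto simp: D_branch_def\<close>)
  then have U: "U holomorphic_on ball 0 R"
    unfolding U_def o_def by (intro holomorphic_intros branch_holomorphic) (use branch_nonzero in auto)
  have der0: "(deriv ^^ n) U 0 = 0" for n
  proof -
    have int: "set_integrable lborel (ball 0 R) (\<lambda>z. U z * cnj z ^ n)"
      using inner_basis_elem(2)[OF u] by (simp add: U_def)
    have zero: "(LINT z:ball 0 R|lborel. U z * cnj z ^ n) = 0"
      using inner_basis_elem(1)[OF u, of b n] ortho[of n] moment_pos[OF R_pos, of n] by (simp add: U_def)
    define r where "r = (\<lambda>k. R - R / real (k + 2))"
    have r: "0 < r k" "r k < R" for k using R_pos by (simp_all add: r_def field_simps add_pos_nonneg)
    have r_mono: "r k \<le> r l" if "k \<le> l" for k l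
      using that R_pos by (simp add: r_def frac_le)
    have r_lim: "r \<longlonglongrightarrow> R"
    proof -
      have "(\<lambda>k. R - R * inverse (real (Suc (k + 1)))) \<longlonglongrightarrow> R - R * 0"
        by (intro tendsto_intros LIMSEQ_ignore_initial_segment LIMSEQ_inverse_real_of_nat)
      then show ?thesis by (simp add: r_def[abs_def] divide_inverse)
    qed
    have Un: "(\<Union>k. ball (0::complex) (r k)) = ball 0 R"
    proof (intro equalityI subsetI)
      fix z assume "z \<in> ball (0::complex) R"
      then have "cmod z < R" by simp
      with order_tendstoD(1)[OF r_lim] obtain k where "cmod z < r k"
        by (auto simp: eventually_sequentially)
      then show "z \<in> (\<Union>k. ball 0 (r k))" by auto
    qed (use r(2) in \<open>auto intro: less_trans\<close>)
    have "(\<lambda>k. LINT z:ball 0 (r k)|lborel. U z * cnj z ^ n) \<longlonglongrightarrow> (LINT z:(\<Union>k. ball 0 (r k))|lborel. U z * cnj z ^ n)"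
      by (rule set_integral_cont_up) (use int r_mono in \<open>auto simp: Un incseq_def intro: less_le_trans[OF _ r_mono]\<close>)
    then have "(\<lambda>k. (deriv ^^ n) U 0 / fact n * of_real (moment (r k) n)) \<longlonglongrightarrow> 0"
      unfolding Un zero holomorphic_moment[OF U r] .
    then have "(\<lambda>k. cmod ((deriv ^^ n) U 0 / fact n * of_real (moment (r k) n))) \<longlonglongrightarrow> 0"
      by (rule tendsto_norm_zero)
    moreover have "cmod ((deriv ^^ n) U 0 / fact n * of_real (moment (r k) n)) = cmod ((deriv ^^ n) U 0 / fact n) * moment (r k) n" for k
      unfolding norm_mult norm_of_real using moment_pos[OF r(1), of k n] by simp
    ultimately have lim: "(\<lambda>k. cmod ((deriv ^^ n) U 0 / fact n) * moment (r k) n) \<longlonglongrightarrow> 0"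
      by simp
    have "cmod ((deriv ^^ n) U 0 / fact n) * moment (r 0) n \<le> 0"
      by (rule LIMSEQ_le_const[OF lim]) (auto intro!: mult_left_mono moment_mono r_mono)
    then show ?thesis using moment_pos[OF r(1), of 0 n] by (simp add: mult_le_0_iff)
  qed
  obtain z where z: "z \<in> ball 0 R" "w = branch b z" using w by (auto simp: D_branch_def)
  have "U z = 0" by (rule holomorphic_fun_eq_0_on_ball[OF U z(1) der0])
  then show ?thesis using branch_nonzero[OF z(1), of b] z(2) by (simp add: U_def)
qed

text \<open>Ensures that the choice by \<open>SOME\<close> in \<open>fredholm_det_one_minus\<close>
  is an orthonormal basis. The parity of the index selects the component of \<open>D\<close>, its
  half the power.\<close>

theorem orthonormal_basis_exists: "\<exists>e. orthonormal_basis (bergman D) (bergman_inner D) e"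
proof
  let ?e = "\<lambda>i. basis_elem (i mod 2) (i div 2)"
  show "orthonormal_basis (bergman D) (bergman_inner D) ?e"
    unfolding orthonormal_basis_def
  proof (intro conjI allI ballI impI)
    show "?e i \<in> bergman D" for i by (rule basis_elem_mem)
    fix i j :: nat
    have disj: "branch b z \<notin> D_branch b'" if "b < 2" "b' < 2" "b \<noteq> b'" "z \<in> ball 0 R" for b b' z
      using that g_plus_neq_g_minus[of z] g_plus_neq_g_minus[of _ z]
      by (auto simp: branch_def D_branch_def split: if_splits) metis+
    have "bergman_inner D (?e i) (?e j) = of_real (1 / sqrt (moment R (j div 2))) *
        (LINT z:ball 0 R|lborel. ?e i (branch (j mod 2) z) / (2 * branch (j mod 2) z) * cnj z ^ (j div 2))"
      by (rule inner_basis_elem(1)[OF basis_elem_mem])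
    also have "(LINT z:ball 0 R|lborel. ?e i (branch (j mod 2) z) / (2 * branch (j mod 2) z) * cnj z ^ (j div 2)) =
       (LINT z:ball 0 R|lborel. (if i mod 2 = j mod 2 then of_real (1 / sqrt (moment R (i div 2))) else 0) * (z ^ (i div 2) * cnj z ^ (j div 2)))"
    proof (rule set_lebesgue_integral_cong)
      show "\<forall>z. z \<in> ball 0 R \<longrightarrow> ?e i (branch (j mod 2) z) / (2 * branch (j mod 2) z) * cnj z ^ (j div 2)
        = (if i mod 2 = j mod 2 then of_real (1 / sqrt (moment R (i div 2))) else 0) * (z ^ (i div 2) * cnj z ^ (j div 2))"
      proof (intro allI impI)
        fix z :: complex assume z: "z \<in> ball 0 R"
        show "?e i (branch (j mod 2) z) / (2 * branch (j mod 2) z) * cnj z ^ (j div 2)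
          = (if i mod 2 = j mod 2 then of_real (1 / sqrt (moment R (i div 2))) else 0) * (z ^ (i div 2) * cnj z ^ (j div 2))"
          using disj[of "j mod 2" "i mod 2" z] z branch_nonzero[OF z, of "j mod 2"]
          by (auto simp: basis_elem_def D_branch_def quad_map_branch)
      qed
    qed simp
    also have "\<dots> = (if i mod 2 = j mod 2 then of_real (1 / sqrt (moment R (i div 2))) else 0) * (LINT z:ball 0 R|lborel. z ^ (i div 2) * cnj z ^ (j div 2))"
      by (rule set_integral_mult_right)
    also have "(LINT z:ball 0 R|lborel. z ^ (i div 2) * cnj z ^ (j div 2)) = (if i div 2 = j div 2 then of_real (moment R (i div 2)) else 0)"
      using monomials_orthogonal[of "i div 2" "j div 2" R] moment_complex[of R "i div 2"] by auto
    also have "of_real (1 / sqrt (moment R (j div 2))) * ((if i mod 2 = j mod 2 then of_real (1 / sqrt (moment R (i div 2))) else 0) *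
        (if i div 2 = j div 2 then of_real (moment R (i div 2)) else 0)) = (if i = j then 1 else (0::complex))"
    proof (cases "i = j")
      case True
      have "1 / sqrt (moment R (j div 2)) * (1 / sqrt (moment R (j div 2)) * moment R (j div 2)) = 1"
        using moment_pos[OF R_pos, of "j div 2"] by (simp add: field_simps)
      then show ?thesis using True by (simp only: of_real_mult[symmetric] if_True refl of_real_1)
    next
      case False
      then have "i mod 2 \<noteq> j mod 2 \<or> i div 2 \<noteq> j div 2" by (metis div_mult_mod_eq)
      then show ?thesis using False by auto
    qed
    finally show "bergman_inner D (?e i) (?e j) = (if i = j then 1 else 0)" .
  next
    fix u assume u: "u \<in> bergman D" and ortho: "\<forall>i. bergman_inner D u (?e i) = 0"
    have "bergman_inner D u (basis_elem b n) = 0" if "b < 2" for b n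
      using ortho[rule_format, of "2 * n + b"] that by (simp add: mod_mult_self3)
    then have "u w = 0" if "w \<in> D_branch 0 \<or> w \<in> D_branch 1" for w
      using orthogonal_to_basis_imp_zero[OF u] that by (metis one_less_numeral_iff pos2 semiring_norm(76))
    moreover have "D = D_branch 0 \<union> D_branch 1"
      by (simp add: D_branch_def branch_def D_plus_def D_minus_def)
    ultimately have "u w = 0" for w using bergman_zero[OF open_D u, of w] by blast
    then show "bergman_inner D u u = 0" by (simp add: bergman_inner_def)
  qed
qed

end

section \<open>Taylor coefficients of images and the factorisation of the operator\<close>

context quadratic_family
begin

text \<open>The order is \<open>r0 < \<mu> < \<rho> < R\<close>. Monomials on \<open>D\<close> grow
  like \<open>r0 ^ k\<close>, Taylor coefficients of images decay like \<open>1 / \<rho> ^ k\<close>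
  by Cauchy's estimate, and weights \<open>\<mu> ^ k\<close> between the two make both factors of
  the operator square summable.\<close>

definition "\<rho> = (r0 + R) / 2"
definition "\<mu> = (r0 + \<rho>) / 2"

lemma radii: "0 < r0" "r0 < \<mu>" "\<mu> < \<rho>" "\<rho> < R" "0 < \<mu>" "0 < \<rho>" "r0 < \<rho>" "r0 < R"
  using r0_pos r0_less by (simp_all add: \<mu>_def \<rho>_def field_simps)

definition "r1 = sqrt (\<rho> - c)"

lemma r1: "0 < r1" "r1 < r0"
  using radii c by (simp_all add: r1_def r0_def)

definition "log_deriv z = Ln (abs_deriv_ext c z)"

lemma abs_deriv_pow_eq: "abs_deriv_pow c s z = exp (s * log_deriv z)"
  by (simp add: abs_deriv_pow_def log_deriv_def)

lemma abs_deriv_ext_eq: "abs_deriv_ext c z = 1 / (2 * g_plus c z)"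
  by (simp add: abs_deriv_ext_def g_plus_def)

lemma log_deriv_holomorphic: "log_deriv holomorphic_on ball 0 R"
proof -
  have "abs_deriv_ext c z \<notin> \<real>\<^sub>\<le>\<^sub>0" if z: "z \<in> ball 0 R" for z
  proof -
    have "Re (abs_deriv_ext c z) > 0"
      using Re_g_plus_pos[OF z]
      by (auto simp: abs_deriv_ext_eq Re_divide intro!: divide_pos_pos add_pos_nonneg)
    then show ?thesis by (auto simp: complex_nonpos_Reals_iff)
  qed
  moreover have "abs_deriv_ext c holomorphic_on ball 0 R"
    unfolding abs_deriv_ext_eq[abs_def]
    by (intro holomorphic_intros g_plus_holomorphic) (use g_plus_nonzero in auto)
  ultimately show ?thesis
    unfolding log_deriv_def[abs_def] by (intro holomorphic_intros) auto
qed

definition "log_bound = (SOME B. 0 \<le> B \<and> (\<forall>z\<in>cball 0 \<rho>. cmod (log_deriv z) \<le> B))"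

lemma log_bound: "0 \<le> log_bound" "z \<in> cball 0 \<rho> \<Longrightarrow> cmod (log_deriv z) \<le> log_bound"
proof -
  have "continuous_on (cball 0 \<rho>) log_deriv"
    by (rule continuous_on_subset[OF holomorphic_on_imp_continuous_on[OF log_deriv_holomorphic]]) (use radii in auto)
  from compact_imp_bounded[OF compact_continuous_image[OF this compact_cball]]
  obtain B where B: "\<forall>z\<in>cball 0 \<rho>. cmod (log_deriv z) \<le> B" unfolding bounded_iff by blast
  moreover have "0 \<le> B" using B radii by (meson centre_in_cball less_imp_le norm_ge_zero order_trans)
  ultimately have "\<exists>B. 0 \<le> B \<and> (\<forall>z\<in>cball 0 \<rho>. cmod (log_deriv z) \<le> B)" by blast
  from someI_ex[OF this] show "0 \<le> log_bound" "z \<in> cball 0 \<rho> \<Longrightarrow> cmod (log_deriv z) \<le> log_bound"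
    unfolding log_bound_def by auto
qed

text \<open>The formula of the operator without the cut-off to \<open>D\<close>. For
  \<open>u\<close> holomorphic on \<open>D\<close> the result is holomorphic on the whole disc of
  radius \<open>R\<close> and can be expanded at 0, a point outside \<open>D\<close>.\<close>

definition push :: "complex \<Rightarrow> (complex \<Rightarrow> complex) \<Rightarrow> complex \<Rightarrow> complex" where
  "push s u z = abs_deriv_pow c s z * (u (g_plus c z) + u (g_minus c z))"

definition push_coeff :: "complex \<Rightarrow> nat \<Rightarrow> (complex \<Rightarrow> complex) \<Rightarrow> complex" where
  "push_coeff s k u = (deriv ^^ k) (push s u) 0 / fact k"

lemma transfer_op_eq: "transfer_op c R s u = (\<lambda>z. if z \<in> D then push s u z else 0)"
  by (simp add: transfer_op_def push_def fun_eq_iff distrib_left)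

lemma g_in_D: "z \<in> ball 0 R \<Longrightarrow> g_plus c z \<in> D" "z \<in> ball 0 R \<Longrightarrow> g_minus c z \<in> D"
  by (auto simp: D_plus_def D_minus_def)

lemma push_holomorphic:
  assumes "u holomorphic_on D"
  shows "push s u holomorphic_on ball 0 R"
proof -
  have "(u \<circ> g_plus c) holomorphic_on ball 0 R" "(u \<circ> g_minus c) holomorphic_on ball 0 R"
    by (rule holomorphic_on_compose[OF g_plus_holomorphic holomorphic_on_subset[OF assms]];
        use g_in_D in blast)
       (rule holomorphic_on_compose[OF g_minus_holomorphic holomorphic_on_subset[OF assms]];
        use g_in_D in blast)
  then show ?thesis
    unfolding push_def[abs_def] abs_deriv_pow_eq o_def
    by (intro holomorphic_intros log_deriv_holomorphic)
qed

lemma norm_push_le: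
  assumes z: "z \<in> cball 0 \<rho>" and "cmod (u (g_plus c z)) \<le> A" "cmod (u (g_minus c z)) \<le> A"
  shows "cmod (push s u z) \<le> exp (cmod s * log_bound) * (2 * A)"
proof -
  have "Re (s * log_deriv z) \<le> cmod (s * log_deriv z)" by (rule complex_Re_le_cmod)
  also have "\<dots> \<le> cmod s * log_bound"
    unfolding norm_mult using log_bound(2)[OF z] by (intro mult_left_mono) auto
  finally have "cmod (abs_deriv_pow c s z) \<le> exp (cmod s * log_bound)"
    by (simp add: abs_deriv_pow_eq)
  moreover have "cmod (u (g_plus c z) + u (g_minus c z)) \<le> 2 * A"
    using norm_triangle_ineq[of "u (g_plus c z)" "u (g_minus c z)"] assms by linarith
  ultimately show ?thesis unfolding push_def norm_mult by (intro mult_mono) auto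
qed

lemma norm_push_coeff_le:
  assumes u: "u holomorphic_on D"
    and A: "\<And>z. z \<in> cball 0 \<rho> \<Longrightarrow> cmod (u (g_plus c z)) \<le> A" "\<And>z. z \<in> cball 0 \<rho> \<Longrightarrow> cmod (u (g_minus c z)) \<le> A"
  shows "cmod (push_coeff s k u) \<le> exp (cmod s * log_bound) * (2 * A) / \<rho> ^ k"
proof -
  have hol: "push s u holomorphic_on ball 0 R" by (rule push_holomorphic[OF u])
  have "norm ((deriv ^^ k) (push s u) 0) \<le> fact k * (exp (cmod s * log_bound) * (2 * A)) / \<rho> ^ k"
  proof (rule Cauchy_inequality)
    show "push s u holomorphic_on ball 0 \<rho>" by (rule holomorphic_on_subset[OF hol]) (use radii in auto)
    show "continuous_on (cball 0 \<rho>) (push s u)"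
      by (rule continuous_on_subset[OF holomorphic_on_imp_continuous_on[OF hol]]) (use radii in auto)
    show "norm (push s u x) \<le> exp (cmod s * log_bound) * (2 * A)" if "norm (0 - x) = \<rho>" for x
      by (rule norm_push_le) (use that A in auto)
  qed (use radii in auto)
  then show ?thesis by (simp add: push_coeff_def norm_divide field_simps)
qed

lemma push_coeff_add:
  assumes "u holomorphic_on D" "v holomorphic_on D"
  shows "push_coeff s k (\<lambda>z. u z + v z) = push_coeff s k u + push_coeff s k v"
proof -
  have "push s (\<lambda>z. u z + v z) = (\<lambda>z. push s u z + push s v z)"
    by (simp add: push_def fun_eq_iff algebra_simps)
  then show ?thesis
    using higher_deriv_add[OF push_holomorphic[OF assms(1)] push_holomorphic[OF assms(2)] open_ball, of 0 k] R_pos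
    by (simp add: push_coeff_def add_divide_distrib)
qed

lemma push_coeff_scale:
  assumes "u holomorphic_on D"
  shows "push_coeff s k (\<lambda>z. a * u z) = a * push_coeff s k u"
proof -
  have "push s (\<lambda>z. a * u z) = (\<lambda>z. a * push s u z)"
    by (simp add: push_def fun_eq_iff algebra_simps)
  then show ?thesis
    using higher_deriv_cmult[OF push_holomorphic[OF assms], of 0 k a] R_pos
    by (simp add: push_coeff_def)
qed

lemma push_power_series:
  assumes "u holomorphic_on D" "z \<in> ball 0 R"
  shows "(\<lambda>k. push_coeff s k u * z ^ k) sums push s u z"
  using holomorphic_power_series[OF push_holomorphic[OF assms(1)] assms(2)] by (simp add: push_coeff_def)

lemma bergman_branch_bound:
  obtains B where "0 \<le> B" "\<And>u z. u \<in> bergman D \<Longrightarrow> z \<in> cball 0 \<rho> \<Longrightarrow> (cmod (u (g_plus c z)))\<^sup>2 \<le> B * sqnorm u"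
    "\<And>u z. u \<in> bergman D \<Longrightarrow> z \<in> cball 0 \<rho> \<Longrightarrow> (cmod (u (g_minus c z)))\<^sup>2 \<le> B * sqnorm u"
proof -
  let ?K = "g_plus c ` cball 0 \<rho> \<union> g_minus c ` cball 0 \<rho>"
  have sub: "cball 0 \<rho> \<subseteq> ball (0::complex) R" using radii by auto
  have "compact ?K"
    by (intro compact_Un compact_continuous_image continuous_on_subset[OF _ sub] holomorphic_on_imp_continuous_on
        g_plus_holomorphic g_minus_holomorphic compact_cball)
  moreover have "?K \<subseteq> D" using g_in_D sub by blast
  ultimately obtain B where "0 \<le> B" "\<And>u z. u \<in> bergman D \<Longrightarrow> z \<in> ?K \<Longrightarrow> (cmod (u z))\<^sup>2 \<le> B * sqnorm u"
    using bergman_compact_bound[OF open_D] by blast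
  then show thesis using that by blast
qed

text \<open>Cauchy's estimate on the circle of radius \<open>\<rho>\<close>, whose images under the
  branches stay in a compact subset of \<open>D\<close>: the norms of the coefficient functionals
  decay geometrically in \<open>k\<close>.\<close>

lemma push_coeff_square_bound:
  obtains B where "0 \<le> B" "\<And>u k. u \<in> bergman D \<Longrightarrow> (cmod (push_coeff s k u))\<^sup>2 \<le> B / \<rho> ^ (2 * k) * sqnorm u"
proof -
  obtain B where B: "0 \<le> B" "\<And>u z. u \<in> bergman D \<Longrightarrow> z \<in> cball 0 \<rho> \<Longrightarrow> (cmod (u (g_plus c z)))\<^sup>2 \<le> B * sqnorm u"
    "\<And>u z. u \<in> bergman D \<Longrightarrow> z \<in> cball 0 \<rho> \<Longrightarrow> (cmod (u (g_minus c z)))\<^sup>2 \<le> B * sqnorm u"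
    using bergman_branch_bound by blast
  let ?E = "exp (cmod s * log_bound)"
  show thesis
  proof (rule that)
    show "0 \<le> (2 * ?E)\<^sup>2 * B" using B by simp
    fix u k assume u: "u \<in> bergman D"
    have nn: "0 \<le> B * sqnorm u" using B sqnorm_nonneg by simp
    have "cmod (push_coeff s k u) \<le> ?E * (2 * sqrt (B * sqnorm u)) / \<rho> ^ k"
      by (rule norm_push_coeff_le[OF bergman_holomorphic[OF open_D u]])
         (use B(2,3)[OF u] in \<open>auto intro!: real_le_rsqrt\<close>)
    then have "(cmod (push_coeff s k u))\<^sup>2 \<le> (?E * (2 * sqrt (B * sqnorm u)) / \<rho> ^ k)\<^sup>2"
      by (rule power_mono) simp
    also have "\<dots> = (2 * ?E)\<^sup>2 * B / \<rho> ^ (2 * k) * sqnorm u"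
      using nn by (simp add: power_divide power_mult_distrib power_mult[symmetric] mult.commute)
    finally show "(cmod (push_coeff s k u))\<^sup>2 \<le> (2 * ?E)\<^sup>2 * B / \<rho> ^ (2 * k) * sqnorm u" .
  qed
qed

definition monomial :: "nat \<Rightarrow> complex \<Rightarrow> complex" where
  "monomial l = (\<lambda>z. if z \<in> D then z ^ l else 0)"

lemma monomial_mem: "monomial l \<in> bergman D" and sqnorm_monomial: "sqnorm (monomial l) \<le> (r0 ^ l)\<^sup>2 * measure lborel D"
  unfolding monomial_def
  by (rule bergman_boundedI[OF open_D bounded_D, of "\<lambda>z. z ^ l" "r0 ^ l"];
      use D_subset in \<open>force intro!: holomorphic_intros power_mono simp: norm_power\<close>)+

lemma transfer_op_mem:
  assumes u: "u \<in> bergman D"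
  shows "transfer_op c R s u \<in> bergman D"
proof -
  obtain B where B: "0 \<le> B" "\<And>u z. u \<in> bergman D \<Longrightarrow> z \<in> cball 0 \<rho> \<Longrightarrow> (cmod (u (g_plus c z)))\<^sup>2 \<le> B * sqnorm u"
    "\<And>u z. u \<in> bergman D \<Longrightarrow> z \<in> cball 0 \<rho> \<Longrightarrow> (cmod (u (g_minus c z)))\<^sup>2 \<le> B * sqnorm u"
    using bergman_branch_bound by blast
  show ?thesis
    unfolding transfer_op_eq
  proof (rule bergman_boundedI(1)[OF open_D bounded_D])
    show "push s u holomorphic_on D"
      by (rule holomorphic_on_subset[OF push_holomorphic[OF bergman_holomorphic[OF open_D u]] D_subset_R])
    show "cmod (push s u z) \<le> exp (cmod s * log_bound) * (2 * sqrt (B * sqnorm u))" if "z \<in> D" for z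
    proof -
      have "z \<in> cball 0 \<rho>" using that D_subset radii by force
      then show ?thesis
        by (intro norm_push_le real_le_rsqrt B(2,3)[OF u])
    qed
  qed
qed

text \<open>The factorisation in weak form: take the Taylor coefficients of the image, then resum
  monomials. Since \<open>D\<close> lies in the disc of radius \<open>r0 < \<rho>\<close>, the
  Taylor polynomials converge to the image uniformly on \<open>D\<close> at the rate
  \<open>(r0 / \<rho>) ^ N\<close>, hence in norm.\<close>

lemma transfer_op_inner:
  assumes u: "u \<in> bergman D" and v: "v \<in> bergman D"
  shows "((\<lambda>k. push_coeff s k u * bergman_inner D (monomial k) v) has_sum bergman_inner D (transfer_op c R s u) v) UNIV"
proof -
  obtain B where B: "0 \<le> B" "\<And>u k. u \<in> bergman D \<Longrightarrow> (cmod (push_coeff s k u))\<^sup>2 \<le> B / \<rho> ^ (2 * k) * sqnorm u"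
    using push_coeff_square_bound by blast
  define A where "A = sqrt (B * sqnorm u)"
  have A0: "0 \<le> A" using B sqnorm_nonneg by (simp add: A_def)
  define q where "q = r0 / \<rho>"
  have q: "0 \<le> q" "q < 1" using radii by (simp_all add: q_def)
  have coeff: "cmod (push_coeff s k u) \<le> A / \<rho> ^ k" for k
  proof (rule power2_le_imp_le)
    show "(cmod (push_coeff s k u))\<^sup>2 \<le> (A / \<rho> ^ k)\<^sup>2"
      using B(2)[OF u, of k] B(1) sqnorm_nonneg[of u]
      by (simp add: A_def power_divide power_mult[symmetric] mult.commute)
  qed (use A0 radii in simp)
  let ?m = "measure lborel D"
  let ?a = "\<lambda>k. push_coeff s k u * bergman_inner D (monomial k) v"
  define W where "W = sqrt (?m * sqnorm v)"
  have W0: "0 \<le> W" using sqnorm_nonneg by (simp add: W_def)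
  have inner_le: "cmod (bergman_inner D (monomial k) v) \<le> r0 ^ k * W" for k
  proof (rule power2_le_imp_le)
    have "(cmod (bergman_inner D (monomial k) v))\<^sup>2 \<le> sqnorm (monomial k) * sqnorm v"
      by (rule bergman_Cauchy_Schwarz[OF open_D monomial_mem v])
    also have "\<dots> \<le> (r0 ^ k)\<^sup>2 * ?m * sqnorm v"
      by (intro mult_right_mono sqnorm_monomial sqnorm_nonneg)
    also have "\<dots> = (r0 ^ k * W)\<^sup>2" using sqnorm_nonneg[of v] by (simp add: W_def power_mult_distrib)
    finally show "(cmod (bergman_inner D (monomial k) v))\<^sup>2 \<le> (r0 ^ k * W)\<^sup>2" .
  qed (use W0 radii in simp)
  have ale: "norm (norm (?a k)) \<le> A * W * q ^ k" for k
  proof -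
    have "norm (?a k) \<le> (A / \<rho> ^ k) * (r0 ^ k * W)"
      unfolding norm_mult using A0 W0 radii by (intro mult_mono coeff inner_le) auto
    then show ?thesis by (simp add: q_def power_divide mult.commute mult.left_commute)
  qed
  have "summable (\<lambda>k. A * W * q ^ k)"
    by (rule summable_mult[OF summable_geometric]) (use q in simp)
  then have summ: "summable (\<lambda>k. norm (?a k))"
    by (rule summable_comparison_test') (rule ale)
  define \<tau> where "\<tau> = (\<lambda>N. A * q ^ N / (1 - q))"
  have tau: "(\<lambda>N. \<tau> N * W) \<longlonglongrightarrow> A * 0 / (1 - q) * W"
    unfolding \<tau>_def using q by (intro tendsto_intros LIMSEQ_power_zero) auto
  let ?S = "\<lambda>N z. \<Sum>k<N. push_coeff s k u * monomial k z"
  have S_mem: "?S N \<in> bergman D" for N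
    by (intro bergman_sum[OF open_D] bergman_scale[OF open_D] monomial_mem) auto
  have S_inner: "bergman_inner D (?S N) v = (\<Sum>k<N. ?a k)" for N
  proof -
    have "bergman_inner D (?S N) v = (\<Sum>k<N. bergman_inner D (\<lambda>z. push_coeff s k u * monomial k z) v)"
      by (rule bergman_inner_sum_left[OF open_D _ bergman_scale[OF open_D monomial_mem] v]) simp
    then show ?thesis by (simp only: bergman_inner_scale_left[OF open_D monomial_mem])
  qed
  have u_hol: "u holomorphic_on D" by (rule bergman_holomorphic[OF open_D u])
  have tail: "cmod (push s u z - (\<Sum>k<N. push_coeff s k u * z ^ k)) \<le> \<tau> N" if z: "z \<in> D" for z N
  proof -
    have z': "z \<in> ball 0 R" "cmod z \<le> r0" using z D_subset_R D_subset by auto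
    have sums: "(\<lambda>k. push_coeff s (k + N) u * z ^ (k + N)) sums (push s u z - (\<Sum>k<N. push_coeff s k u * z ^ k))"
      by (rule sums_split_initial_segment[OF push_power_series[OF u_hol z'(1)]])
    have le: "norm (push_coeff s (k + N) u * z ^ (k + N)) \<le> A * q ^ N * q ^ k" for k
    proof -
      have "norm (push_coeff s (k + N) u * z ^ (k + N)) \<le> A / \<rho> ^ (k + N) * r0 ^ (k + N)"
        unfolding norm_mult norm_power using A0 radii z' by (intro mult_mono coeff power_mono) auto
      also have "\<dots> = A * q ^ N * q ^ k" by (simp add: q_def power_divide power_add mult.commute mult.left_commute)
      finally show ?thesis .
    qed
    have geo: "(\<lambda>k. A * q ^ N * q ^ k) sums (A * q ^ N * (1 / (1 - q)))"
      by (intro sums_mult geometric_sums) (use q in auto)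
    show ?thesis
      using norm_sums_le[OF sums geo le] by (simp add: \<tau>_def)
  qed
  have "(\<lambda>N. bergman_inner D (transfer_op c R s u) v - (\<Sum>k<N. ?a k)) \<longlonglongrightarrow> 0"
  proof (rule Lim_null_comparison)
    show "\<forall>\<^sub>F N in sequentially. norm (bergman_inner D (transfer_op c R s u) v - (\<Sum>k<N. ?a k)) \<le> \<tau> N * W"
    proof (intro always_eventually allI)
      fix N
      have tau0: "0 \<le> \<tau> N" using A0 q by (simp add: \<tau>_def)
      let ?d = "\<lambda>z. transfer_op c R s u z - ?S N z"
      have d_eq: "?d = (\<lambda>z. if z \<in> D then push s u z - (\<Sum>k<N. push_coeff s k u * z ^ k) else 0)"
        by (auto simp: transfer_op_eq monomial_def fun_eq_iff)
      have d_mem: "?d \<in> bergman D" by (rule bergman_diff[OF open_D transfer_op_mem[OF u] S_mem])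
      have "sqnorm ?d \<le> (\<tau> N)\<^sup>2 * ?m"
        unfolding d_eq
        by (rule bergman_boundedI(2)[OF open_D bounded_D])
           (use tail in \<open>auto intro!: holomorphic_intros holomorphic_on_subset[OF push_holomorphic[OF u_hol] D_subset_R]\<close>)
      have "(cmod (bergman_inner D ?d v))\<^sup>2 \<le> sqnorm ?d * sqnorm v"
        by (rule bergman_Cauchy_Schwarz[OF open_D d_mem v])
      also have "\<dots> \<le> (\<tau> N)\<^sup>2 * ?m * sqnorm v"
        by (intro mult_right_mono sqnorm_nonneg) fact
      also have "\<dots> = (\<tau> N * W)\<^sup>2" using sqnorm_nonneg[of v] by (simp add: W_def power_mult_distrib)
      finally have "cmod (bergman_inner D ?d v) \<le> \<tau> N * W"
        by (rule power2_le_imp_le) (use tau0 W0 in simp)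
      then show "norm (bergman_inner D (transfer_op c R s u) v - (\<Sum>k<N. ?a k)) \<le> \<tau> N * W"
        unfolding bergman_inner_diff_left[OF open_D transfer_op_mem[OF u] S_mem v] S_inner .
    qed
    show "(\<lambda>N. \<tau> N * W) \<longlonglongrightarrow> 0" using tau by simp
  qed
  from tendsto_diff[OF tendsto_const[of "bergman_inner D (transfer_op c R s u) v"] this]
  have "?a sums bergman_inner D (transfer_op c R s u) v" by (simp add: sums_def)
  then show ?thesis by (rule norm_summable_imp_has_sum[OF summ])
qed

end

lemma summable_on_columns:
  fixes f :: "nat \<Rightarrow> nat \<Rightarrow> real"
  assumes nn: "\<And>i k. 0 \<le> f i k" and col: "\<And>k I. finite I \<Longrightarrow> (\<Sum>i\<in>I. f i k) \<le> b k" and b: "summable b"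
  shows "(\<lambda>(i, k). f i k) summable_on UNIV" and "(\<lambda>(k, i). f i k) summable_on UNIV"
proof -
  have b0: "0 \<le> b k" for k using col[of "{}" k] by simp
  show 1: "(\<lambda>(i, k). f i k) summable_on UNIV"
  proof (rule nonneg_bdd_above_summable_on)
    show "bdd_above (sum (\<lambda>(i, k). f i k) ` {F. F \<subseteq> UNIV \<and> finite F})"
    proof (rule bdd_aboveI2)
      fix X :: "(nat \<times> nat) set" assume "X \<in> {F. F \<subseteq> UNIV \<and> finite F}"
      then have X: "finite X" by simp
      have "sum (\<lambda>(i, k). f i k) X \<le> sum (\<lambda>(i, k). f i k) (fst ` X \<times> snd ` X)"
        by (rule sum_mono2) (use X nn in \<open>force simp: split_beta\<close>)+
      also have "\<dots> = (\<Sum>k\<in>snd ` X. \<Sum>i\<in>fst ` X. f i k)"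
        by (simp add: sum.cartesian_product[symmetric] sum.swap[of _ "fst ` X"])
      also have "\<dots> \<le> (\<Sum>k\<in>snd ` X. b k)" using X by (intro sum_mono col) auto
      also have "\<dots> \<le> suminf b" using X b0 by (intro sum_le_suminf b) auto
      finally show "sum (\<lambda>(i, k). f i k) X \<le> suminf b" .
    qed
  qed (auto simp: nn)
  then show "(\<lambda>(k, i). f i k) summable_on UNIV"
    using summable_on_swap[of "\<lambda>(i, k). f i k" UNIV UNIV] by (simp add: case_prod_unfold)
qed

text \<open>Serves to see that the matrix entries are entire in \<open>s\<close>: an exponential
  times a polynomial in \<open>s\<close> whose coefficients \<open>w j\<close> do not involve
  \<open>s\<close>. Each further derivative either brings down \<open>s * deriv L z\<close> or
  differentiates a coefficient.\<close>

lemma higher_deriv_exp_parameter: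
  fixes L W :: "complex \<Rightarrow> complex"
  assumes S: "open S" and L: "L holomorphic_on S" and W: "W holomorphic_on S"
  shows "\<exists>w. (\<forall>j. w j holomorphic_on S) \<and>
    (\<forall>s. \<forall>z\<in>S. (deriv ^^ k) (\<lambda>z. exp (s * L z) * W z) z = exp (s * L z) * (\<Sum>j\<le>k. s ^ j * w j z))"
proof (induction k)
  case 0
  show ?case by (rule exI[of _ "\<lambda>_. W"]) (simp add: W)
next
  case (Suc k)
  then obtain w where w: "\<And>j. w j holomorphic_on S"
    "\<And>s z. z \<in> S \<Longrightarrow> (deriv ^^ k) (\<lambda>z. exp (s * L z) * W z) z = exp (s * L z) * (\<Sum>j\<le>k. s ^ j * w j z)"
    by blast
  define w' where "w' = (\<lambda>j z. (if j = 0 then 0 else deriv L z * w (j - 1) z) + (if j \<le> k then deriv (w j) z else 0))"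
  have "w' j holomorphic_on S" for j
    unfolding w'_def by (cases "j = 0"; cases "j \<le> k") (auto intro!: holomorphic_intros holomorphic_deriv w L S)
  moreover have "(deriv ^^ Suc k) (\<lambda>z. exp (s * L z) * W z) z = exp (s * L z) * (\<Sum>j\<le>Suc k. s ^ j * w' j z)"
    if z: "z \<in> S" for s z
  proof -
    have "(deriv ^^ Suc k) (\<lambda>z. exp (s * L z) * W z) z = deriv (\<lambda>z. exp (s * L z) * (\<Sum>j\<le>k. s ^ j * w j z)) z"
      unfolding funpow.simps o_def
      by (rule deriv_cong_ev[OF _ refl]) (use eventually_nhds_in_open[OF S z] w(2) in \<open>auto elim: eventually_mono\<close>)
    also have "\<dots> = exp (s * L z) * (s * deriv L z * (\<Sum>j\<le>k. s ^ j * w j z) + (\<Sum>j\<le>k. s ^ j * deriv (w j) z))"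
      by (rule DERIV_imp_deriv)
         (auto intro!: derivative_eq_intros holomorphic_derivI[OF L S z] holomorphic_derivI[OF w(1) S z] simp: algebra_simps)
    also have "s * deriv L z * (\<Sum>j\<le>k. s ^ j * w j z) = (\<Sum>j\<le>k. s ^ Suc j * (deriv L z * w j z))"
      by (simp add: sum_distrib_left algebra_simps)
    also have "\<dots> = (\<Sum>j\<le>Suc k. s ^ j * (if j = 0 then 0 else deriv L z * w (j - 1) z))"
      by (subst sum.atMost_Suc_shift) simp
    also have "(\<Sum>j\<le>k. s ^ j * deriv (w j) z) = (\<Sum>j\<le>Suc k. s ^ j * (if j \<le> k then deriv (w j) z else 0))"
      by simp
    finally show ?thesis
      by (simp add: w'_def sum.distrib[symmetric] distrib_left del: sum.atMost_Suc)
  qed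
  ultimately show ?case by blast
qed

section \<open>The transfer matrix: determinant, dependence on s, eigenfunctions\<close>

context quadratic_family
begin

text \<open>The matrix of the operator in the monomials; conjugating by powers of \<open>\<mu>\<close>, between the radius \<open>r1\<close> of
  the images of the branches and the radius \<open>\<rho>\<close> of holomorphy, makes it decay in both indices.\<close>

definition transfer_matrix :: "complex \<Rightarrow> nat \<Rightarrow> nat \<Rightarrow> complex" where
  "transfer_matrix s k l = of_real (\<mu> ^ k / \<mu> ^ l) * push_coeff s k (monomial l)"

lemma norm_branch_le: "z \<in> cball 0 \<rho> \<Longrightarrow> cmod (g_plus c z) \<le> r1" "z \<in> cball 0 \<rho> \<Longrightarrow> cmod (g_minus c z) \<le> r1"
  using norm_g_plus_le[of z \<rho>] by (simp_all add: r1_def g_minus_eq)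

lemma push_coeff_monomial_le:
  "cmod (push_coeff s k (monomial l)) \<le> 2 * exp (cmod s * log_bound) * r1 ^ l / \<rho> ^ k"
proof -
  have "cmod (monomial l (g_plus c z)) \<le> r1 ^ l \<and> cmod (monomial l (g_minus c z)) \<le> r1 ^ l" if z: "z \<in> cball 0 \<rho>" for z
  proof -
    have "z \<in> ball 0 R" using z radii by auto
    then show ?thesis
      using g_in_D[of z] norm_branch_le[OF z] by (simp add: monomial_def norm_power power_mono)
  qed
  then have "cmod (push_coeff s k (monomial l)) \<le> exp (cmod s * log_bound) * (2 * r1 ^ l) / \<rho> ^ k"
    by (intro norm_push_coeff_le bergman_holomorphic[OF open_D monomial_mem]) auto
  then show ?thesis by (simp add: mult.commute mult.left_commute)
qed

lemma transfer_matrix_decay: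
  assumes "cmod s \<le> S"
  shows "geometric_decay (2 * exp (S * log_bound)) (\<mu> / \<rho>) (r1 / \<mu>) (transfer_matrix s)"
  unfolding geometric_decay_def
proof (intro allI)
  fix k l
  have "cmod (push_coeff s k (monomial l)) \<le> 2 * exp (cmod s * log_bound) * r1 ^ l / \<rho> ^ k"
    by (rule push_coeff_monomial_le)
  also have "\<dots> \<le> 2 * exp (S * log_bound) * r1 ^ l / \<rho> ^ k"
    using assms log_bound(1) r1 radii by (intro divide_right_mono mult_right_mono mult_left_mono) (auto intro: mult_right_mono)
  finally have "\<mu> ^ k / \<mu> ^ l * cmod (push_coeff s k (monomial l)) \<le> \<mu> ^ k / \<mu> ^ l * (2 * exp (S * log_bound) * r1 ^ l / \<rho> ^ k)"
    using radii by (intro mult_left_mono) auto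
  then show "cmod (transfer_matrix s k l) \<le> 2 * exp (S * log_bound) * (\<mu> / \<rho>) ^ k * (r1 / \<mu>) ^ l"
    using radii unfolding transfer_matrix_def norm_mult norm_of_real
    by (simp add: power_divide field_simps)
qed

lemma decay_rates: "0 < \<mu> / \<rho>" "\<mu> / \<rho> < 1" "0 < r1 / \<mu>" "r1 / \<mu> < 1"
  using radii r1 by simp_all

text \<open>\<open>P\<close> is Hilbert-Schmidt by Bessel's inequality for the monomials,
  \<open>Q\<close> by the bounds on the coefficient functionals. The powers of \<open>\<mu>\<close>
  cancel in \<open>P Q\<close>. In \<open>Q P\<close> they produce the rescaled matrix, and the
  basis disappears because a functional applied to the expansion of a monomial gives back its value
  on that monomial.\<close>

theorem dyn_zeta_eq: "dyn_zeta c R s = det_one_minus (transfer_matrix s)"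
proof -
  define e where "e = (SOME e. orthonormal_basis (bergman D) (bergman_inner D) e)"
  have onb: "orthonormal_basis (bergman D) (bergman_inner D) e"
    unfolding e_def by (rule someI_ex[OF orthonormal_basis_exists])
  note mem = onb_mem[OF open_D onb]
  let ?ip = "bergman_inner D"
  define P where "P = (\<lambda>i k. ?ip (monomial k) (e i) / of_real (\<mu> ^ k))"
  define Q where "Q = (\<lambda>k j. of_real (\<mu> ^ k) * push_coeff s k (e j))"
  have mu: "\<mu> ^ k > 0" for k using radii by simp
  have P: "(\<lambda>(i, k). (cmod (P i k))\<^sup>2) summable_on UNIV"
  proof (rule summable_on_columns(1))
    show "summable (\<lambda>k. measure lborel D * ((r0 / \<mu>)\<^sup>2) ^ k)"
      using radii by (intro summable_mult summable_geometric) (simp add: abs_square_less_1)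
    fix k and I :: "nat set" assume "finite I"
    have "(\<Sum>i\<in>I. (cmod (P i k))\<^sup>2) = (\<Sum>i\<in>I. (cmod (?ip (monomial k) (e i)))\<^sup>2) / (\<mu> ^ k)\<^sup>2"
      using radii(5) by (simp add: P_def norm_divide power_divide sum_divide_distrib norm_power)
    also have "\<dots> \<le> sqnorm (monomial k) / (\<mu> ^ k)\<^sup>2"
      by (intro divide_right_mono Bessel_inequality[OF open_D onb monomial_mem \<open>finite I\<close>]) simp
    also have "\<dots> \<le> (r0 ^ k)\<^sup>2 * measure lborel D / (\<mu> ^ k)\<^sup>2"
      by (intro divide_right_mono sqnorm_monomial) simp
    also have "\<dots> = measure lborel D * ((r0 / \<mu>)\<^sup>2) ^ k"
      by (simp add: power_divide power_mult[symmetric] mult.commute)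
    finally show "(\<Sum>i\<in>I. (cmod (P i k))\<^sup>2) \<le> measure lborel D * ((r0 / \<mu>)\<^sup>2) ^ k" .
  qed simp
  obtain B where B: "0 \<le> B" "\<And>u k. u \<in> bergman D \<Longrightarrow> (cmod (push_coeff s k u))\<^sup>2 \<le> B / \<rho> ^ (2 * k) * sqnorm u"
    using push_coeff_square_bound by blast
  have add: "push_coeff s k (\<lambda>z. u z + v z) = push_coeff s k u + push_coeff s k v"
    if "u \<in> bergman D" "v \<in> bergman D" for u v k
    using that by (intro push_coeff_add bergman_holomorphic[OF open_D])
  have scale: "push_coeff s k (\<lambda>z. a * u z) = a * push_coeff s k u" if "u \<in> bergman D" for a u k
    using that by (intro push_coeff_scale bergman_holomorphic[OF open_D])
  have Q: "(\<lambda>(k, j). (cmod (Q k j))\<^sup>2) summable_on UNIV"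
  proof (rule summable_on_columns(2))
    show "summable (\<lambda>k. B * ((\<mu> / \<rho>)\<^sup>2) ^ k)"
      using decay_rates by (intro summable_mult summable_geometric) (simp add: abs_square_less_1)
    fix k and J :: "nat set" assume "finite J"
    have "(\<Sum>j\<in>J. (cmod (Q k j))\<^sup>2) = (\<mu> ^ k)\<^sup>2 * (\<Sum>j\<in>J. (cmod (push_coeff s k (e j)))\<^sup>2)"
      using radii(5) by (simp add: Q_def norm_mult power_mult_distrib sum_distrib_left norm_power)
    also have "\<dots> \<le> (\<mu> ^ k)\<^sup>2 * (B / \<rho> ^ (2 * k))"
      by (intro mult_left_mono functional_square_sum[OF open_D onb _ _ _ \<open>finite J\<close>, of "push_coeff s k"] add scale B(2)) auto
    also have "\<dots> = B * ((\<mu> / \<rho>)\<^sup>2) ^ k"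
      by (simp add: power_divide power_mult[symmetric] mult.commute)
    finally show "(\<Sum>j\<in>J. (cmod (Q k j))\<^sup>2) \<le> B * ((\<mu> / \<rho>)\<^sup>2) ^ k" .
  qed simp
  have PQ: "?ip (transfer_op c R s (e j)) (e i) = (\<Sum>\<^sub>\<infinity>k. P i k * Q k j)" for i j
  proof -
    have "P i k * Q k j = push_coeff s k (e j) * ?ip (monomial k) (e i)" for k
      using radii(5) by (simp add: P_def Q_def)
    then show ?thesis
      using infsumI[OF transfer_op_inner[OF mem[of j] mem[of i], of s]] by simp
  qed
  have QP: "(\<Sum>\<^sub>\<infinity>i. Q k i * P i l) = transfer_matrix s k l" for k l
  proof -
    have 1: "Q k i * P i l = of_real (\<mu> ^ k / \<mu> ^ l) * (?ip (monomial l) (e i) * push_coeff s k (e i))" for i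
      by (simp add: P_def Q_def)
    have 2: "((\<lambda>i. ?ip (monomial l) (e i) * push_coeff s k (e i)) has_sum push_coeff s k (monomial l)) UNIV"
      by (rule functional_onb_expansion[OF open_D onb add scale B(2) monomial_mem])
    show ?thesis
      unfolding 1 transfer_matrix_def by (rule infsumI[OF has_sum_cmult_right[OF 2]])
  qed
  have "trace_exterior_power ?ip e n (transfer_op c R s)
      = (\<Sum>\<^sub>\<infinity>S\<in>{S. finite S \<and> card S = n}. principal_minor (transfer_matrix s) S)" for n
  proof -
    have "(\<lambda>i j. ?ip (transfer_op c R s (e j)) (e i)) = (\<lambda>i j. \<Sum>\<^sub>\<infinity>k. P i k * Q k j)"
      by (simp add: PQ fun_eq_iff)
    moreover have "(\<lambda>k l. \<Sum>\<^sub>\<infinity>i. Q k i * P i l) = transfer_matrix s"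
      by (simp add: QP fun_eq_iff)
    ultimately show ?thesis
      unfolding trace_exterior_power_def using infsum_principal_minor_commute[OF P Q, of n] by simp
  qed
  then show ?thesis
    using det_one_minus_eq_suminf[OF transfer_matrix_decay[OF order_refl] _ decay_rates, of s]
    by (simp add: dyn_zeta_def Let_def fredholm_det_one_minus_def e_def[symmetric])
qed

lemma transfer_matrix_holomorphic: "(\<lambda>s. transfer_matrix s k l) holomorphic_on UNIV"
proof -
  let ?W = "\<lambda>z. g_plus c z ^ l + g_minus c z ^ l"
  have W: "?W holomorphic_on ball 0 R"
    by (intro holomorphic_intros g_plus_holomorphic g_minus_holomorphic)
  obtain w where w: "\<And>s z. z \<in> ball 0 R \<Longrightarrow> (deriv ^^ k) (\<lambda>z. exp (s * log_deriv z) * ?W z) z = exp (s * log_deriv z) * (\<Sum>j\<le>k. s ^ j * w j z)"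
    using higher_deriv_exp_parameter[OF open_ball log_deriv_holomorphic W, of k] by blast
  have "push_coeff s k (monomial l) = exp (s * log_deriv 0) * (\<Sum>j\<le>k. s ^ j * w j 0) / fact k" for s
  proof -
    have "push s (monomial l) z = exp (s * log_deriv z) * ?W z" if "z \<in> ball 0 R" for z
      using g_in_D[OF that] by (simp add: push_def abs_deriv_pow_eq monomial_def)
    then have "(deriv ^^ k) (push s (monomial l)) 0 = (deriv ^^ k) (\<lambda>z. exp (s * log_deriv z) * ?W z) 0"
      using eventually_nhds_in_open[of "ball 0 R" "0::complex"] R_pos
      by (intro higher_deriv_cong_ev) (auto elim: eventually_mono)
    then show ?thesis using w[of 0 s] R_pos by (simp add: push_coeff_def)
  qed
  then show ?thesis
    unfolding transfer_matrix_def by (auto intro!: holomorphic_intros)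
qed

text \<open>Each truncated determinant is entire, and on a disc of radius 1 about any point the same
  decay constants serve all \<open>s\<close>, so the truncations converge uniformly there.\<close>

theorem dyn_zeta_holomorphic: "dyn_zeta c R holomorphic_on UNIV"
proof -
  let ?F = "\<lambda>N s. truncated_det (transfer_matrix s) N"
  have "(\<lambda>s. det_one_minus (transfer_matrix s)) holomorphic_on UNIV"
  proof (rule holomorphic_uniform_sequence[where f = ?F])
    show "?F N holomorphic_on UNIV" for N
      unfolding truncated_det_def principal_minor_def
      by (intro holomorphic_intros transfer_matrix_holomorphic)
    fix x :: complex
    define C where "C = 2 * exp ((cmod x + 1) * log_bound)"
    obtain \<tau> where tau: "\<tau> \<longlonglongrightarrow> (0::real)"
      "\<And>M N. geometric_decay C (\<mu> / \<rho>) (r1 / \<mu>) M \<Longrightarrow> cmod (det_one_minus M - truncated_det M N) \<le> \<tau> N"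
      using truncated_det_tendsto_uniformly[OF _ decay_rates, of C] unfolding C_def by (metis exp_ge_zero mult_nonneg_nonneg zero_le_numeral)
    have "uniform_limit (cball x 1) ?F (\<lambda>s. det_one_minus (transfer_matrix s)) sequentially"
    proof (rule uniform_limitI)
      fix \<epsilon> :: real assume "0 < \<epsilon>"
      with tau(1) have "\<forall>\<^sub>F N in sequentially. \<tau> N < \<epsilon>" by (rule order_tendstoD)
      then show "\<forall>\<^sub>F N in sequentially. \<forall>s\<in>cball x 1. dist (?F N s) (det_one_minus (transfer_matrix s)) < \<epsilon>"
      proof (rule eventually_mono, intro ballI)
        fix N s assume N: "\<tau> N < \<epsilon>" and s: "s \<in> cball x 1"
        have "cmod s \<le> cmod x + 1"
          using s norm_triangle_ineq2[of s x] by (simp add: dist_norm norm_minus_commute)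
        then have "cmod (det_one_minus (transfer_matrix s) - ?F N s) \<le> \<tau> N"
          unfolding C_def using tau(2)[unfolded C_def] transfer_matrix_decay by blast
        then show "dist (?F N s) (det_one_minus (transfer_matrix s)) < \<epsilon>"
          using N by (simp add: dist_norm norm_minus_commute)
      qed
    qed
    then show "\<exists>d>0. cball x d \<subseteq> UNIV \<and> uniform_limit (cball x d) ?F (\<lambda>s. det_one_minus (transfer_matrix s)) sequentially"
      by (intro exI[of _ 1]) auto
  qed simp
  then show ?thesis unfolding dyn_zeta_eq[abs_def] .
qed

text \<open>A fixed vector is only known to be bounded, but one application of the matrix improves
  it to order \<open>(\<mu> / \<rho>) ^ k\<close>. Undoing the weights leaves coefficients of order
  \<open>1 / \<rho> ^ k\<close>, those of a function \<open>v\<close> holomorphic on the disc of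
  radius \<open>\<rho>\<close>; the fixed vector equation says that \<open>v\<close> and
  \<open>push s v\<close> have the same Taylor coefficients.\<close>

theorem dyn_zeta_zero_imp_eigenfunction:
  assumes zero: "dyn_zeta c R s = 0"
  obtains v where "v holomorphic_on ball 0 \<rho>" "\<exists>z\<in>ball 0 \<rho>. v z \<noteq> 0"
    "\<And>z. z \<in> ball 0 \<rho> \<Longrightarrow> v z = abs_deriv_pow c s z * (v (g_plus c z) + v (g_minus c z))"
proof -
  define C where "C = 2 * exp (cmod s * log_bound)"
  have C: "0 \<le> C" by (simp add: C_def)
  have decay: "geometric_decay C (\<mu> / \<rho>) (r1 / \<mu>) (transfer_matrix s)"
    unfolding C_def by (rule transfer_matrix_decay) simp
  have "has_fixed_vector (transfer_matrix s)"
    by (rule det_one_minus_eq_0_imp_fixed_vector[OF decay C decay_rates]) (use zero dyn_zeta_eq in simp)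
  then obtain y where bdd: "bounded (range y)" and y_nz: "\<exists>k. y k \<noteq> 0"
    and y: "\<And>k. y k = (\<Sum>l. transfer_matrix s k l * y l)"
    unfolding has_fixed_vector_def by blast
  from bdd obtain B where "\<forall>k. cmod (y k) \<le> B" unfolding bounded_iff by blast
  then have B: "cmod (y k) \<le> B" for k by blast
  define K where "K = C * B / (1 - r1 / \<mu>)"
  have yk: "cmod (y k) \<le> K * (\<mu> / \<rho>) ^ k" for k
  proof -
    have "cmod (\<Sum>l. transfer_matrix s k l * y l) \<le> C * (\<mu> / \<rho>) ^ k * B / (1 - r1 / \<mu>)"
      by (rule geometric_decay_row(2)[OF decay C decay_rates(1,3,4) B])
    then show ?thesis unfolding y[of k, symmetric] by (simp add: K_def ac_simps)
  qed
  have K0: "0 \<le> K" using order_trans[OF norm_ge_zero yk[of 0]] by simp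
  define x where "x = (\<lambda>k. y k / of_real (\<mu> ^ k))"
  have mu: "\<mu> ^ k > 0" for k using radii by simp
  have xk: "cmod (x k) \<le> K / \<rho> ^ k" for k
    using yk[of k] mu[of k] radii by (simp add: x_def norm_divide norm_power power_divide field_simps)
  have x_sums: "(\<lambda>l. push_coeff s k (monomial l) * x l) sums x k" for k
  proof -
    have "(\<lambda>l. transfer_matrix s k l * y l) sums y k"
      using geometric_decay_row(1)[OF decay C decay_rates(1,3,4) B, of k] y[of k]
      by (simp add: summable_norm_cancel sums_iff)
    then have "(\<lambda>l. transfer_matrix s k l * y l / of_real (\<mu> ^ k)) sums x k"
      unfolding x_def by (rule sums_divide)
    moreover have "transfer_matrix s k l * y l / of_real (\<mu> ^ k) = push_coeff s k (monomial l) * x l" for l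
      using radii(5) by (simp add: transfer_matrix_def x_def)
    ultimately show ?thesis by simp
  qed
  have summ: "summable (\<lambda>l. x l * w ^ l)" if "cmod w < \<rho>" for w
  proof (rule summable_norm_cancel, rule summable_comparison_test')
    show "summable (\<lambda>l. K * (cmod w / \<rho>) ^ l)"
      using that radii by (intro summable_mult summable_geometric) simp
    show "norm (norm (x l * w ^ l)) \<le> K * (cmod w / \<rho>) ^ l" for l
      using mult_right_mono[OF xk[of l], of "cmod w ^ l"] by (simp add: norm_mult norm_power power_divide)
  qed
  define v where "v = (\<lambda>w. \<Sum>l. x l * w ^ l)"
  have v_sums: "(\<lambda>l. x l * w ^ l) sums v w" if "w \<in> ball 0 \<rho>" for w
    unfolding v_def using summable_sums[OF summ] that by simp
  have v_hol: "v holomorphic_on ball 0 \<rho>"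
    by (rule power_series_holomorphic[of 0 \<rho> x]) (use v_sums in simp)
  have g_ball: "g_plus c z \<in> ball 0 \<rho>" "g_minus c z \<in> ball 0 \<rho>" if "z \<in> cball 0 \<rho>" for z
    using norm_branch_le[OF that] r1 radii by auto
  \<comment> \<open>On the disc of radius \<open>R\<close> these are the images of the Taylor
    polynomials of \<open>v\<close>. The branches send the closed disc of radius
    \<open>\<rho>\<close> into radius \<open>r1 < \<rho>\<close>, so they converge uniformly there
    to \<open>push s v\<close>, and their Taylor coefficients are partial sums of the series in
    \<open>x_sums\<close>.\<close>
  define S where "S = (\<lambda>N z. \<Sum>l<N. x l * push s (monomial l) z)"
  have S_hol: "S N holomorphic_on ball 0 R" for N
    unfolding S_def by (intro holomorphic_intros push_holomorphic bergman_holomorphic[OF open_D monomial_mem])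
  define V where "V = push s v"
  have V_hol: "V holomorphic_on ball 0 \<rho>"
  proof -
    have sub: "ball 0 \<rho> \<subseteq> ball (0::complex) R" using radii by auto
    have "(v \<circ> g_plus c) holomorphic_on ball 0 \<rho>" "(v \<circ> g_minus c) holomorphic_on ball 0 \<rho>"
      by (rule holomorphic_on_compose[OF holomorphic_on_subset[OF g_plus_holomorphic sub] holomorphic_on_subset[OF v_hol]];
          use g_ball in force)
         (rule holomorphic_on_compose[OF holomorphic_on_subset[OF g_minus_holomorphic sub] holomorphic_on_subset[OF v_hol]];
          use g_ball in force)
    then show ?thesis
      unfolding V_def push_def[abs_def] abs_deriv_pow_eq o_def
      by (intro holomorphic_intros holomorphic_on_subset[OF log_deriv_holomorphic sub])
  qed
  define q where "q = r1 / \<rho>"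
  have q: "0 \<le> q" "q < 1" using r1 radii by (simp_all add: q_def)
  define \<tau> where "\<tau> = (\<lambda>N. exp (cmod s * log_bound) * (2 * (K * q ^ N * (1 / (1 - q)))))"
  have tau: "\<tau> \<longlonglongrightarrow> exp (cmod s * log_bound) * (2 * (K * 0 * (1 / (1 - q))))"
    unfolding \<tau>_def using q by (intro tendsto_intros LIMSEQ_power_zero) auto
  have SV: "cmod (V z - S N z) \<le> \<tau> N" if z: "z \<in> cball 0 \<rho>" for z N
  proof -
    let ?d = "\<lambda>w. v w - (\<Sum>l<N. x l * w ^ l)"
    have d: "cmod (?d w) \<le> K * q ^ N * (1 / (1 - q))" if w: "cmod w \<le> r1" for w
    proof -
      have "w \<in> ball 0 \<rho>" using w r1 radii by simp
      from sums_split_initial_segment[OF v_sums[OF this], of N]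
      have s: "(\<lambda>l. x (l + N) * w ^ (l + N)) sums ?d w" .
      have le: "norm (x (l + N) * w ^ (l + N)) \<le> K * q ^ N * q ^ l" for l
      proof -
        have "norm (x (l + N) * w ^ (l + N)) \<le> K / \<rho> ^ (l + N) * r1 ^ (l + N)"
          unfolding norm_mult norm_power using K0 radii w by (intro mult_mono xk power_mono) auto
        then show ?thesis by (simp add: q_def power_divide power_add mult.commute mult.left_commute)
      qed
      have "(\<lambda>l. K * q ^ N * q ^ l) sums (K * q ^ N * (1 / (1 - q)))"
        by (intro sums_mult geometric_sums) (use q in auto)
      from norm_sums_le[OF s this le] show ?thesis .
    qed
    have zR: "z \<in> ball 0 R" using z radii by auto
    have "V z - S N z = push s ?d z"
      using g_in_D[OF zR]
      by (simp add: V_def S_def push_def monomial_def algebra_simps sum_distrib_left sum.distrib)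
    also have "cmod \<dots> \<le> \<tau> N"
      unfolding \<tau>_def by (rule norm_push_le[OF z d d]) (use norm_branch_le[OF z] in auto)
    finally show ?thesis .
  qed
  have coeff: "(deriv ^^ k) V 0 / fact k = x k" for k
  proof -
    have dS: "(deriv ^^ k) (S N) 0 / fact k = (\<Sum>l<N. push_coeff s k (monomial l) * x l)" for N
    proof (induction N)
      case 0
      have "S 0 = (\<lambda>z. 0)" by (simp add: S_def fun_eq_iff)
      then show ?case by simp
    next
      case (Suc N)
      have eq: "S (Suc N) = (\<lambda>z. S N z + x N * push s (monomial N) z)" by (simp add: S_def fun_eq_iff)
      have ph: "push s (monomial N) holomorphic_on ball 0 R"
        by (rule push_holomorphic[OF bergman_holomorphic[OF open_D monomial_mem]])
      have "(deriv ^^ k) (S (Suc N)) 0 = (deriv ^^ k) (S N) 0 + x N * (deriv ^^ k) (push s (monomial N)) 0"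
        unfolding eq using R_pos
        by (subst higher_deriv_add[OF S_hol _ open_ball])
           (auto intro!: holomorphic_intros ph higher_deriv_cmult[OF ph])
      then show ?case using Suc by (simp add: push_coeff_def add_divide_distrib mult.commute)
    qed
    \<comment> \<open>\<open>V\<close> is known to be holomorphic on the open disc of radius
      \<open>\<rho>\<close>, so the Cauchy estimate is taken on a smaller circle.\<close>
    let ?r = "\<rho> / 2"
    have sub: "cball 0 ?r \<subseteq> ball (0::complex) \<rho>" "cball 0 ?r \<subseteq> ball (0::complex) R" using radii by auto
    have diff: "cmod ((deriv ^^ k) V 0 / fact k - (\<Sum>l<N. push_coeff s k (monomial l) * x l)) \<le> \<tau> N / ?r ^ k" for N
    proof -
      have hV: "V holomorphic_on cball 0 ?r" and hS: "S N holomorphic_on cball 0 ?r"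
        using holomorphic_on_subset[OF V_hol sub(1)] holomorphic_on_subset[OF S_hol sub(2)] by auto
      have hol: "(\<lambda>z. V z - S N z) holomorphic_on cball 0 ?r" by (intro holomorphic_intros hV hS)
      have bs: "ball 0 ?r \<subseteq> cball (0::complex) ?r" by auto
      have "norm ((deriv ^^ k) (\<lambda>z. V z - S N z) 0) \<le> fact k * \<tau> N / ?r ^ k"
      proof (rule Cauchy_inequality)
        show "(\<lambda>z. V z - S N z) holomorphic_on ball 0 ?r" using holomorphic_on_subset[OF hol bs] .
        show "continuous_on (cball 0 ?r) (\<lambda>z. V z - S N z)" by (rule holomorphic_on_imp_continuous_on[OF hol])
        show "0 < ?r" using radii by simp
        show "norm (V w - S N w) \<le> \<tau> N" if "norm (0 - w) = ?r" for w
          by (rule SV) (use that radii in simp)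
      qed
      moreover have "(deriv ^^ k) (\<lambda>z. V z - S N z) 0 = (deriv ^^ k) V 0 - (deriv ^^ k) (S N) 0"
        by (rule higher_deriv_diff[OF holomorphic_on_subset[OF hV bs] holomorphic_on_subset[OF hS bs] open_ball])
           (use radii in simp)
      moreover have "(deriv ^^ k) V 0 / fact k - (\<Sum>l<N. push_coeff s k (monomial l) * x l) = ((deriv ^^ k) V 0 - (deriv ^^ k) (S N) 0) / fact k"
        by (simp add: dS[symmetric] diff_divide_distrib)
      ultimately show ?thesis by (simp add: norm_divide field_simps)
    qed
    have "(\<lambda>N. (deriv ^^ k) V 0 / fact k - (\<Sum>l<N. push_coeff s k (monomial l) * x l)) \<longlonglongrightarrow> 0"
    proof (rule Lim_null_comparison[OF always_eventually])
      show "\<forall>N. norm ((deriv ^^ k) V 0 / fact k - (\<Sum>l<N. push_coeff s k (monomial l) * x l)) \<le> \<tau> N / ?r ^ k" using diff by blast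
      show "(\<lambda>N. \<tau> N / ?r ^ k) \<longlonglongrightarrow> 0" using tendsto_divide[OF tau tendsto_const[of "?r ^ k"]] radii by simp
    qed
    from tendsto_diff[OF tendsto_const[of "(deriv ^^ k) V 0 / fact k"] this]
    have "(\<lambda>l. push_coeff s k (monomial l) * x l) sums ((deriv ^^ k) V 0 / fact k)" by (simp add: sums_def)
    then show ?thesis using x_sums[of k] sums_unique2 by blast
  qed
  have Vv: "V z = v z" if "z \<in> ball 0 \<rho>" for z
    using holomorphic_power_series[OF V_hol that] v_sums[OF that] sums_unique2 by (simp add: coeff) blast
  have "\<exists>z\<in>ball 0 \<rho>. v z \<noteq> 0"
  proof (rule ccontr)
    assume "\<not> ?thesis"
    then have 0: "V z = 0" if "z \<in> ball 0 \<rho>" for z using Vv that by simp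
    have "(deriv ^^ k) V 0 = (deriv ^^ k) (\<lambda>_. 0) 0" for k
      using eventually_nhds_in_open[of "ball 0 \<rho>" "0::complex"] radii 0
      by (intro higher_deriv_cong_ev) (auto elim: eventually_mono)
    then have "x k = 0" for k using coeff[of k] by simp
    then have "y k = 0" for k using radii(5) by (simp add: x_def)
    then show False using y_nz by blast
  qed
  then show thesis
    by (rule that[OF v_hol]) (use Vv in \<open>simp add: V_def push_def\<close>)
qed

end

section \<open>Real eigenfunctions of the transfer operator\<close>

text \<open>One integration by parts, after dividing the amplitude by the derivative
  \<open>\<phi>\<close> of the phase. In the constant,
  \<open>2 / (\<kappa> * (b - a)) + 2 / \<kappa>\<close> comes from the two end points,
  \<open>1 / \<kappa>\<close> from \<open>G'\<close> and \<open>2 / \<kappa>\<^sup>2\<close> from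
  the derivative of \<open>1 / \<phi>\<close>. An integral rather than a supremum on the right
  allows square integral estimates after summation over pairs of words.\<close>

lemma oscillatory_integral_bound:
  fixes G G' :: "real \<Rightarrow> complex" and \<Phi> \<phi> \<phi>' :: "real \<Rightarrow> real"
  assumes ab: "a < b" and t: "t \<noteq> 0" and \<kappa>: "0 < \<kappa>"
    and \<Phi>: "\<And>y. y \<in> {a..b} \<Longrightarrow> (\<Phi> has_real_derivative \<phi> y) (at y within {a..b})"
    and \<phi>: "\<And>y. y \<in> {a..b} \<Longrightarrow> (\<phi> has_real_derivative \<phi>' y) (at y within {a..b})"
    and G: "\<And>y. y \<in> {a..b} \<Longrightarrow> (G has_vector_derivative G' y) (at y within {a..b})"
    and lower: "\<And>y. y \<in> {a..b} \<Longrightarrow> \<kappa> \<le> \<bar>\<phi> y\<bar>" and upper: "\<And>y. y \<in> {a..b} \<Longrightarrow> \<bar>\<phi>' y\<bar> \<le> 2"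
    and cont: "continuous_on {a..b} G'" "continuous_on {a..b} \<phi>'"
  shows "cmod (integral {a..b} (\<lambda>y. exp (\<i> * of_real (t * \<Phi> y)) * G y))
    \<le> (2 / (\<kappa> * (b - a)) + 2 / \<kappa>\<^sup>2 + 3 / \<kappa>) / \<bar>t\<bar> * integral {a..b} (\<lambda>y. cmod (G y) + cmod (G' y))"
proof -
  let ?I = "{a..b}"
  have cG: "continuous_on ?I G"
    using G by (intro continuous_on_vector_derivative) auto
  have c\<phi>: "continuous_on ?I \<phi>" using \<phi> by (rule DERIV_continuous_on)
  have c\<Phi>: "continuous_on ?I \<Phi>" using \<Phi> by (rule DERIV_continuous_on)
  have nz: "\<phi> y \<noteq> 0" if "y \<in> ?I" for y using lower[OF that] \<kappa> by auto
  let ?e = "\<lambda>y. exp (\<i> * of_real (t * \<Phi> y))"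
  have ne: "cmod (?e y) = 1" for y by (metis norm_exp_i_times)
  define J where "J = integral ?I (\<lambda>y. cmod (G y) + cmod (G' y))"
  have intG: "(\<lambda>y. cmod (G y)) integrable_on ?I" "(\<lambda>y. cmod (G' y)) integrable_on ?I"
    "(\<lambda>y. cmod (G y) + cmod (G' y)) integrable_on ?I"
    by (intro integrable_continuous_interval continuous_intros cG cont)+
  have boundary: "cmod (G p) \<le> (1 / (b - a) + 1) * J" if p: "p = a \<or> p = b" for p
  proof -
    \<comment> \<open>An end value is bounded by integrals alone: with \<open>p'\<close> the
      opposite end point, the function (y - p') G(y) vanishes at \<open>p'\<close>.\<close>
    define p' where "p' = (if p = a then b else a)"
    have po: "\<bar>p - p'\<bar> = b - a" using p ab by (auto simp: p'_def)
    have "((\<lambda>y. G y + (y - p') *\<^sub>R G' y) has_integral ((b - p') *\<^sub>R G b - (a - p') *\<^sub>R G a)) ?I"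
    proof (rule fundamental_theorem_of_calculus)
      fix y assume y: "y \<in> ?I"
      show "((\<lambda>y. (y - p') *\<^sub>R G y) has_vector_derivative G y + (y - p') *\<^sub>R G' y) (at y within ?I)"
        by (auto intro!: derivative_eq_intros G[OF y])
    qed (use ab in simp)
    then have "integral ?I (\<lambda>y. G y + (y - p') *\<^sub>R G' y) = (b - p') *\<^sub>R G b - (a - p') *\<^sub>R G a" by (rule integral_unique)
    then have "cmod (integral ?I (\<lambda>y. G y + (y - p') *\<^sub>R G' y)) = (b - a) * cmod (G p)"
      using p ab by (auto simp: p'_def norm_minus_commute)
    moreover have "cmod (integral ?I (\<lambda>y. G y + (y - p') *\<^sub>R G' y)) \<le> integral ?I (\<lambda>y. (1 + (b - a)) * (cmod (G y) + cmod (G' y)))"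
    proof (rule integral_norm_bound_integral)
      show "(\<lambda>y. G y + (y - p') *\<^sub>R G' y) integrable_on ?I"
        by (intro integrable_continuous_interval continuous_intros cG cont)
      show "(\<lambda>y. (1 + (b - a)) * (cmod (G y) + cmod (G' y))) integrable_on ?I"
        by (intro integrable_continuous_interval continuous_intros cG cont)
      fix y assume y: "y \<in> ?I"
      have "\<bar>y - p'\<bar> \<le> b - a" using y by (auto simp: p'_def)
      have "cmod (G y + (y - p') *\<^sub>R G' y) \<le> cmod (G y) + \<bar>y - p'\<bar> * cmod (G' y)"
        using norm_triangle_ineq[of "G y" "(y - p') *\<^sub>R G' y"] by simp
      also have "\<dots> \<le> cmod (G y) + (b - a) * cmod (G' y)"
        using \<open>\<bar>y - p'\<bar> \<le> b - a\<close> by (intro add_left_mono mult_right_mono) auto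
      also have "\<dots> \<le> (1 + (b - a)) * (cmod (G y) + cmod (G' y))"
      proof -
        have "0 \<le> (b - a) * cmod (G y)" using ab by simp
        then show ?thesis using norm_ge_zero[of "G' y"] unfolding distrib_left distrib_right mult_1 by linarith
      qed
      finally show "cmod (G y + (y - p') *\<^sub>R G' y) \<le> (1 + (b - a)) * (cmod (G y) + cmod (G' y))" .
    qed
    moreover have "integral ?I (\<lambda>y. (1 + (b - a)) * (cmod (G y) + cmod (G' y))) = (1 + (b - a)) * J"
      unfolding J_def by (rule integral_mult_right)
    ultimately have "(b - a) * cmod (G p) \<le> (1 + (b - a)) * J" by (simp only:)
    then show ?thesis using ab by (simp add: field_simps)
  qed
  let ?B = "\<lambda>y. ?e y * (G y / of_real (\<phi> y))"
  let ?R = "\<lambda>y. ?e y * (G' y / of_real (\<phi> y) - G y * of_real (\<phi>' y) / of_real ((\<phi> y)\<^sup>2))"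
  have FTC: "((\<lambda>y. \<i> * of_real t * (?e y * G y) + ?R y) has_integral (?B b - ?B a)) ?I"
  proof (rule fundamental_theorem_of_calculus)
    fix y assume y: "y \<in> ?I"
    have e: "(?e has_vector_derivative (\<i> * of_real (t * \<phi> y) * ?e y)) (at y within ?I)"
    proof -
      have "((\<lambda>y. \<i> * of_real (t * \<Phi> y)) has_vector_derivative \<i> * of_real (t * \<phi> y)) (at y within ?I)"
        by (intro has_vector_derivative_mult_right has_vector_derivative_of_real DERIV_cmult)
           (use \<Phi>[OF y] in \<open>simp add: has_real_derivative_iff_has_vector_derivative\<close>)
      from field_vector_diff_chain_within[OF this, of exp "exp (\<i> * of_real (t * \<Phi> y))"]
      show ?thesis by (simp add: o_def DERIV_exp has_field_derivative_at_within mult.commute)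
    qed
    have f: "((\<lambda>y. complex_of_real (1 / \<phi> y)) has_vector_derivative of_real (- \<phi>' y / (\<phi> y)\<^sup>2)) (at y within ?I)"
      by (rule has_vector_derivative_of_real)
         (use \<phi>[OF y] nz[OF y] in \<open>auto intro!: derivative_eq_intros simp: power2_eq_square field_simps simp flip: has_real_derivative_iff_has_vector_derivative\<close>)
    have "((\<lambda>y. ?e y * (G y * complex_of_real (1 / \<phi> y))) has_vector_derivative
        ?e y * (G y * of_real (- \<phi>' y / (\<phi> y)\<^sup>2) + G' y * of_real (1 / \<phi> y)) + (\<i> * of_real (t * \<phi> y) * ?e y) * (G y * of_real (1 / \<phi> y))) (at y within ?I)"
      by (intro has_vector_derivative_mult e f G y)
    moreover have "?e y * (G y * of_real (- \<phi>' y / (\<phi> y)\<^sup>2) + G' y * of_real (1 / \<phi> y)) + (\<i> * of_real (t * \<phi> y) * ?e y) * (G y * of_real (1 / \<phi> y))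
        = \<i> * of_real t * (?e y * G y) + ?R y"
      using nz[OF y] by (simp add: field_simps power2_eq_square)
    ultimately show "(?B has_vector_derivative \<i> * of_real t * (?e y * G y) + ?R y) (at y within ?I)"
      by (simp add: add.commute)
  qed (use ab in simp)
  have cR: "continuous_on ?I ?R"
    by (intro continuous_intros c\<Phi> c\<phi> cG cont) (use nz in auto)
  have ceG: "continuous_on ?I (\<lambda>y. ?e y * G y)"
    by (intro continuous_intros c\<Phi> cG)
  have "?B b - ?B a = \<i> * of_real t * integral ?I (\<lambda>y. ?e y * G y) + integral ?I ?R"
  proof -
    have "integral ?I (\<lambda>y. \<i> * of_real t * (?e y * G y) + ?R y)
        = integral ?I (\<lambda>y. \<i> * of_real t * (?e y * G y)) + integral ?I ?R"
      by (intro Henstock_Kurzweil_Integration.integral_add integrable_continuous_interval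
          continuous_on_mult[OF continuous_on_const ceG] cR)
    then show ?thesis
      unfolding integral_unique[OF FTC] Henstock_Kurzweil_Integration.integral_mult_right .
  qed
  then have eq: "\<i> * of_real t * integral ?I (\<lambda>y. ?e y * G y) = ?B b - ?B a - integral ?I ?R"
    by (simp only: add_diff_cancel_right')
  have "\<bar>t\<bar> * cmod (integral ?I (\<lambda>y. ?e y * G y)) = cmod (?B b - ?B a - integral ?I ?R)"
    using arg_cong[OF eq, of cmod] unfolding norm_mult norm_ii norm_of_real mult_1 .
  also have "\<dots> \<le> cmod (?B b) + cmod (?B a) + cmod (integral ?I ?R)"
    using norm_triangle_ineq4[of "?B b - ?B a" "integral ?I ?R"] norm_triangle_ineq4[of "?B b" "?B a"] by linarith
  also have "\<dots> \<le> (1 / (b - a) + 1) * J / \<kappa> + (1 / (b - a) + 1) * J / \<kappa> + (1 / \<kappa> + 2 / \<kappa>\<^sup>2) * J"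
  proof (intro add_mono)
    have B: "cmod (?B p) \<le> (1 / (b - a) + 1) * J / \<kappa>" if p: "p = a \<or> p = b" for p
    proof -
      have pI: "p \<in> ?I" using p ab by auto
      have "cmod (?B p) = cmod (G p) / \<bar>\<phi> p\<bar>" by (simp add: norm_mult norm_divide ne)
      also have "\<dots> \<le> cmod (G p) / \<kappa>" using lower[OF pI] \<kappa> by (intro divide_left_mono) auto
      also have "\<dots> \<le> (1 / (b - a) + 1) * J / \<kappa>" using boundary[OF p] \<kappa> by (intro divide_right_mono) auto
      finally show ?thesis .
    qed
    show "cmod (?B b) \<le> (1 / (b - a) + 1) * J / \<kappa>" "cmod (?B a) \<le> (1 / (b - a) + 1) * J / \<kappa>"
      by (rule B; simp)+
    have "cmod (integral ?I ?R) \<le> integral ?I (\<lambda>y. (1 / \<kappa> + 2 / \<kappa>\<^sup>2) * (cmod (G y) + cmod (G' y)))"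
    proof (rule integral_norm_bound_integral)
      show "?R integrable_on ?I" by (rule integrable_continuous_interval[OF cR])
      show "(\<lambda>y. (1 / \<kappa> + 2 / \<kappa>\<^sup>2) * (cmod (G y) + cmod (G' y))) integrable_on ?I"
        by (intro integrable_continuous_interval continuous_intros cG cont)
      fix y assume y: "y \<in> ?I"
      have 1: "cmod (G' y / of_real (\<phi> y)) \<le> 1 / \<kappa> * cmod (G' y)"
        using lower[OF y] \<kappa> divide_left_mono[of \<kappa> "\<bar>\<phi> y\<bar>" "cmod (G' y)"] by (simp add: norm_divide)
      have 2: "cmod (G y * of_real (\<phi>' y) / of_real ((\<phi> y)\<^sup>2)) \<le> 2 / \<kappa>\<^sup>2 * cmod (G y)"
      proof -
        have "\<kappa>\<^sup>2 \<le> \<bar>\<phi> y\<bar>\<^sup>2" using lower[OF y] \<kappa> by (intro power_mono) auto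
        then have "cmod (G y) * \<bar>\<phi>' y\<bar> / \<bar>\<phi> y\<bar>\<^sup>2 \<le> cmod (G y) * 2 / \<kappa>\<^sup>2"
          using upper[OF y] \<kappa> by (intro frac_le mult_left_mono mult_nonneg_nonneg) auto
        then show ?thesis by (simp add: norm_mult norm_divide norm_power mult.commute)
      qed
      have "cmod (?R y) \<le> 1 / \<kappa> * cmod (G' y) + 2 / \<kappa>\<^sup>2 * cmod (G y)"
        unfolding norm_mult ne using norm_triangle_ineq4[of "G' y / of_real (\<phi> y)" "G y * of_real (\<phi>' y) / of_real ((\<phi> y)\<^sup>2)"] 1 2 by simp
      also have "\<dots> \<le> (1 / \<kappa> + 2 / \<kappa>\<^sup>2) * (cmod (G y) + cmod (G' y))"
        using \<kappa> by (simp add: distrib_left distrib_right)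
      finally show "cmod (?R y) \<le> (1 / \<kappa> + 2 / \<kappa>\<^sup>2) * (cmod (G y) + cmod (G' y))" .
    qed
    then show "cmod (integral ?I ?R) \<le> (1 / \<kappa> + 2 / \<kappa>\<^sup>2) * J" unfolding J_def by simp
  qed
  also have "\<dots> = (2 / (\<kappa> * (b - a)) + 2 / \<kappa>\<^sup>2 + 3 / \<kappa>) * J"
  proof -
    have "(1 / d + 1) * J / \<kappa> + (1 / d + 1) * J / \<kappa> + (1 / \<kappa> + 2 / \<kappa>\<^sup>2) * J = (2 / (\<kappa> * d) + 2 / \<kappa>\<^sup>2 + 3 / \<kappa>) * J"
      if "d \<noteq> 0" for d
      using \<kappa> that by (simp add: field_simps power2_eq_square)
    then show ?thesis using ab by simp
  qed
  finally have "cmod (integral ?I (\<lambda>y. ?e y * G y)) \<le> (2 / (\<kappa> * (b - a)) + 2 / \<kappa>\<^sup>2 + 3 / \<kappa>) * J / \<bar>t\<bar>"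
    using t by (simp add: pos_le_divide_eq mult.commute)
  then show ?thesis unfolding J_def by simp
qed

fun sgn_bit :: "bool \<Rightarrow> real" where
  "sgn_bit True = 1" | "sgn_bit False = - 1"

lemma abs_sgn_bit [simp]: "\<bar>sgn_bit b\<bar> = 1"
  by (cases b) auto

section \<open>Words of real inverse branches and their logarithmic derivatives\<close>

context quadratic_family
begin

abbreviation "I \<equiv> {-\<zeta>..\<zeta>}"

text \<open>\<open>q\<close> is \<open>g_plus c\<close> on the real line and \<open>m\<close> its
  minimum on \<open>I\<close>. The images of \<open>I\<close> under the two branches are
  \<open>{m..\<zeta>}\<close> and its reflection, with a gap around 0.\<close>

definition "q x = sqrt (x - c)"
definition "m = q (-\<zeta>)"

lemma c_eq: "c = \<zeta> - \<zeta>\<^sup>2" using zeta_eq by simp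

lemma q_squared: "c \<le> x \<Longrightarrow> (q x)\<^sup>2 = x - c" by (simp add: q_def)

text \<open>\<open>m > 1\<close> is what later makes \<open>2 * \<kappa> = 1 / m\<close> less than
  1; \<open>5 / 4\<close> is the value of \<zeta> (\<zeta> - 2) at \<zeta> = 5/2.\<close>

lemma m_squared: "m\<^sup>2 = \<zeta>\<^sup>2 - 2 * \<zeta>" and m_ge: "5 / 4 < m\<^sup>2" and m_gt_1: "1 < m"
proof -
  have *: "\<zeta>\<^sup>2 - 2 * \<zeta> = -\<zeta> - c" using zeta_eq by simp
  have "(5 / 2) * (1 / 2) < \<zeta> * (\<zeta> - 2)" using zeta_gt by (intro mult_strict_mono) auto
  then have 5: "5 / 4 < \<zeta>\<^sup>2 - 2 * \<zeta>" by (simp add: power2_eq_square algebra_simps)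
  then show 1: "m\<^sup>2 = \<zeta>\<^sup>2 - 2 * \<zeta>" unfolding m_def using * by (subst q_squared) auto
  show "5 / 4 < m\<^sup>2" using 1 5 by simp
  have "1 < sqrt (-\<zeta> - c)" using 5 * by (intro real_less_rsqrt) simp
  then show "1 < m" by (simp add: m_def q_def)
qed

lemma shift_bounds:
  assumes "x \<in> I"
  shows "m\<^sup>2 \<le> x - c" "x - c \<le> \<zeta>\<^sup>2" "5 / 4 < x - c" "c < x"
  using assms m_squared m_ge zeta_eq by auto

lemma q_bounds:
  assumes "x \<in> I"
  shows "m \<le> q x" "q x \<le> \<zeta>" "1 < q x"
proof -
  show "m \<le> q x" using assms unfolding m_def q_def by (intro real_sqrt_le_mono) simp
  then show "1 < q x" using m_gt_1 by simp
  show "q x \<le> \<zeta>" unfolding q_def using shift_bounds(2)[OF assms] zeta_gt by (intro real_le_lsqrt) auto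
qed

lemma sgn_q_mem: "x \<in> I \<Longrightarrow> sgn_bit b * q x \<in> I"
  using q_bounds[of x] by (cases b) auto

lemma m_le_zeta: "m < \<zeta>"
  using m_squared zeta_gt by (intro power2_less_imp_less[of m \<zeta>]) auto

text \<open>A word lists the branches in the order in which they are applied. The function \<open>word_log w\<close> is the
  logarithm of \<open>\<bar>word_deriv w\<bar>\<close>, and \<open>slope w\<close> is minus its derivative.\<close>

fun word_map :: "bool list \<Rightarrow> real \<Rightarrow> real" where
  "word_map [] x = x"
| "word_map (b # w) x = word_map w (sgn_bit b * q x)"

fun word_log :: "bool list \<Rightarrow> real \<Rightarrow> real" where
  "word_log [] x = 0"
| "word_log (b # w) x = - ln (2 * q x) + word_log w (sgn_bit b * q x)"

fun word_deriv :: "bool list \<Rightarrow> real \<Rightarrow> real" where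
  "word_deriv [] x = 1"
| "word_deriv (b # w) x = word_deriv w (sgn_bit b * q x) * (sgn_bit b / (2 * q x))"

fun slope :: "bool list \<Rightarrow> real \<Rightarrow> real" where
  "slope [] x = 0"
| "slope (b # w) x = 1 / (2 * (x - c)) + sgn_bit b / (2 * q x) * slope w (sgn_bit b * q x)"

fun slope_deriv :: "bool list \<Rightarrow> real \<Rightarrow> real" where
  "slope_deriv [] x = 0"
| "slope_deriv (b # w) x = - 1 / (2 * (x - c)\<^sup>2) - sgn_bit b / (4 * q x * (x - c)) * slope w (sgn_bit b * q x)
    + 1 / (4 * (x - c)) * slope_deriv w (sgn_bit b * q x)"

lemma word_map_mem: "x \<in> I \<Longrightarrow> word_map w x \<in> I"
proof (induction w arbitrary: x)
  case (Cons b w)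
  then show ?case using sgn_q_mem by simp
qed simp

lemma q_has_derivative:
  assumes "x \<in> I"
  shows "(q has_real_derivative 1 / (2 * q x)) (at x)"
  unfolding q_def using shift_bounds(4)[OF assms] by (auto intro!: derivative_eq_intros simp: field_simps)

lemma sgn_q_has_derivative:
  assumes "x \<in> I"
  shows "((\<lambda>x. sgn_bit b * q x) has_real_derivative sgn_bit b / (2 * q x)) (at x)"
  using DERIV_cmult[OF q_has_derivative[OF assms], of "sgn_bit b"] by simp

lemma word_map_has_derivative: "x \<in> I \<Longrightarrow> (word_map w has_real_derivative word_deriv w x) (at x)"
proof (induction w arbitrary: x)
  case Nil
  have "word_map [] = (\<lambda>x. x)" by (rule ext) simp
  then show ?case by simp
next
  case (Cons b w)
  show ?case
    using DERIV_chain[OF Cons.IH[OF sgn_q_mem[OF Cons.prems]] sgn_q_has_derivative[OF Cons.prems]]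
    by (simp add: o_def)
qed

lemma word_log_has_derivative: "x \<in> I \<Longrightarrow> (word_log w has_real_derivative - slope w x) (at x)"
proof (induction w arbitrary: x)
  case Nil
  have "word_log [] = (\<lambda>x. 0)" by (rule ext) simp
  then show ?case by simp
next
  case (Cons b w)
  have q: "0 < q x" "(q x)\<^sup>2 = x - c" using q_bounds[OF Cons.prems] shift_bounds[OF Cons.prems] q_squared by auto
  have "((\<lambda>x. - ln (2 * q x)) has_real_derivative - (1 / (2 * (x - c)))) (at x)"
    using q by (auto intro!: derivative_eq_intros q_has_derivative[OF Cons.prems] simp: field_simps power2_eq_square)
  from DERIV_add[OF this DERIV_chain2[OF Cons.IH[OF sgn_q_mem[OF Cons.prems]] sgn_q_has_derivative[OF Cons.prems, of b]]]
  show ?case by (simp add: algebra_simps)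
qed

lemma slope_has_derivative: "x \<in> I \<Longrightarrow> (slope w has_real_derivative slope_deriv w x) (at x)"
proof (induction w arbitrary: x)
  case Nil
  have "slope [] = (\<lambda>x. 0)" by (rule ext) simp
  then show ?case by simp
next
  case (Cons b w)
  have q: "0 < q x" "(q x)\<^sup>2 = x - c" "0 < x - c" using q_bounds[OF Cons.prems] shift_bounds[OF Cons.prems] q_squared by auto
  have 1: "((\<lambda>x. 1 / (2 * (x - c))) has_real_derivative - 1 / (2 * (x - c)\<^sup>2)) (at x)"
  proof -
    have eq: "1 / (2 * d) = 1 / 2 * inverse d" "- 1 / (2 * d\<^sup>2) = 1 / 2 * (- (inverse d * 1 * inverse d))" for d :: real
      by (cases "d = 0"; simp add: field_simps power2_eq_square)+
    have "((\<lambda>x. inverse (x - c)) has_real_derivative - (inverse (x - c) * 1 * inverse (x - c))) (at x)"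
      by (rule DERIV_inverse') (use q(3) in \<open>auto intro!: derivative_eq_intros\<close>)
    from DERIV_cmult[OF this, of "1 / 2"] show ?thesis
      unfolding eq(2)[of "x - c"] eq(1)[of "_ - c"] .
  qed
  have 2: "((\<lambda>x. sgn_bit b / (2 * q x)) has_real_derivative - sgn_bit b / (4 * q x * (x - c))) (at x)"
    unfolding q(2)[symmetric] using q(1)
    by (auto intro!: derivative_eq_intros q_has_derivative[OF Cons.prems] simp: field_simps power2_eq_square)
  have 3: "((\<lambda>x. slope w (sgn_bit b * q x)) has_real_derivative slope_deriv w (sgn_bit b * q x) * (sgn_bit b / (2 * q x))) (at x)"
    by (rule DERIV_chain2[OF Cons.IH[OF sgn_q_mem[OF Cons.prems]] sgn_q_has_derivative[OF Cons.prems]])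
  have s: "sgn_bit b * sgn_bit b = 1" by (cases b) auto
  have "(sgn_bit b / (2 * q x)) * (slope_deriv w (sgn_bit b * q x) * (sgn_bit b / (2 * q x)))
     = (sgn_bit b * sgn_bit b) * slope_deriv w (sgn_bit b * q x) / (4 * (q x)\<^sup>2)"
    by (simp add: power2_eq_square)
  also have "\<dots> = 1 / (4 * (x - c)) * slope_deriv w (sgn_bit b * q x)"
    by (simp add: s q(2))
  finally have e1: "slope_deriv w (sgn_bit b * q x) * (sgn_bit b / (2 * q x)) * (sgn_bit b / (2 * q x))
      = 1 / (4 * (x - c)) * slope_deriv w (sgn_bit b * q x)" by (simp only: mult.commute)
  have e2: "- sgn_bit b / (4 * q x * (x - c)) * slope w (sgn_bit b * q x) = - (sgn_bit b / (4 * q x * (x - c)) * slope w (sgn_bit b * q x))"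
    by simp
  have fn: "slope (b # w) = (\<lambda>x. 1 / (2 * (x - c)) + sgn_bit b / (2 * q x) * slope w (sgn_bit b * q x))"
    by (rule ext) simp
  show ?case
    unfolding fn
    by (rule DERIV_cong[OF DERIV_add[OF 1 DERIV_mult[OF 2 3]]]) (unfold slope_deriv.simps, use e1 e2 in linarith)
qed

lemma abs_word_deriv: "x \<in> I \<Longrightarrow> \<bar>word_deriv w x\<bar> = exp (word_log w x)"
proof (induction w arbitrary: x)
  case (Cons b w)
  have "0 < q x" using q_bounds[OF Cons.prems] by simp
  then have "\<bar>sgn_bit b / (2 * q x)\<bar> = exp (- ln (2 * q x))"
    by (simp add: abs_divide abs_mult exp_minus inverse_eq_divide)
  then show ?case
    by (simp only: word_deriv.simps word_log.simps abs_mult[of "word_deriv _ _"] exp_add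
        Cons.IH[OF sgn_q_mem[OF Cons.prems]] mult.commute)
qed simp

lemma word_log_le: "x \<in> I \<Longrightarrow> word_log w x \<le> - real (length w) * ln (2 * m)"
proof (induction w arbitrary: x)
  case (Cons b w)
  have "ln (2 * m) \<le> ln (2 * q x)" using q_bounds[OF Cons.prems] m_gt_1 by simp
  then show ?case using Cons.IH[OF sgn_q_mem[OF Cons.prems], of b] by (simp add: algebra_simps)
qed simp

text \<open>The invariant on which everything rests: it is preserved by both branches precisely because
  \<open>\<zeta> \<ge> 5 / 2\<close>, that is, \<open>c \<le> - 3.75\<close>.\<close>

lemma slope_bounds: "x \<in> I \<Longrightarrow> - 1 / 8 \<le> (x - c) * slope w x \<and> (x - c) * slope w x \<le> 5 / 8"
proof (induction w arbitrary: x)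
  case (Cons b w)
  let ?p = "q x"
  let ?y = "sgn_bit b * ?p"
  have p: "1 < ?p" "?p \<le> \<zeta>" "?p\<^sup>2 = x - c" using q_bounds[OF Cons.prems] shift_bounds[OF Cons.prems] q_squared by auto
  have y: "?y \<in> I" by (rule sgn_q_mem[OF Cons.prems])
  define X where "X = (?y - c) * slope w ?y"
  have X: "- 1 / 8 \<le> X" "X \<le> 5 / 8" using Cons.IH[OF y] by (auto simp: X_def)
  have yc: "0 < ?y - c" using shift_bounds[OF y] by simp
  \<comment> \<open>Both bounds on \<theta> = p / (y - c) below are this one inequality: for y = p
    it says \<theta> \<le> 2/5, for y = - p it says \<theta> \<le> 2. It follows from 2 \<zeta>^2
    \<ge> 5 \<zeta>.\<close>
  have key: "3 * ?p \<le> - 2 * c"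
  proof -
    have "5 * \<zeta> \<le> 2 * \<zeta> * \<zeta>" using zeta_gt by (intro mult_right_mono) auto
    then have "3 * \<zeta> \<le> - 2 * c" using c_eq by (simp add: power2_eq_square)
    then show ?thesis using p(2) by linarith
  qed
  \<comment> \<open>The scaled slope becomes 1/2 plus or minus \<theta> X / 2. The
    \<open>True\<close> branch reproduces the upper bound, 1/2 + (2/5)(5/8)/2 = 5/8. The
    \<open>False\<close> branch reproduces both, 1/2 - 2 (5/8)/2 = -1/8 and 1/2 + 2 (1/8)/2 =
    5/8.\<close>
  have eq: "(x - c) * slope (b # w) x = 1 / 2 + sgn_bit b * (?p / (2 * (?y - c))) * X"
    using p yc unfolding X_def by (simp add: p(3)[symmetric] field_simps power2_eq_square)
  show ?case
  proof (cases b)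
    case True
    define \<theta> where "\<theta> = ?p / (?y - c)"
    have th: "0 \<le> \<theta>" "\<theta> \<le> 2 / 5" using key p yc True unfolding \<theta>_def by (auto simp: field_simps)
    have "\<theta> * X \<le> \<theta> * (5 / 8)" "\<theta> * (- 1 / 8) \<le> \<theta> * X" using X th(1) by (intro mult_left_mono; simp)+
    moreover have "(x - c) * slope (b # w) x = 1 / 2 + \<theta> * X / 2" using eq True by (simp add: \<theta>_def)
    ultimately show ?thesis using th by linarith
  next
    case False
    define \<theta> where "\<theta> = ?p / (?y - c)"
    have th: "0 \<le> \<theta>" "\<theta> \<le> 2" using key p yc False unfolding \<theta>_def by (auto simp: field_simps)
    have "\<theta> * X \<le> \<theta> * (5 / 8)" "\<theta> * (- 1 / 8) \<le> \<theta> * X" using X th(1) by (intro mult_left_mono; simp)+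
    moreover have "(x - c) * slope (b # w) x = 1 / 2 - \<theta> * X / 2" using eq False by (simp add: \<theta>_def)
    ultimately show ?thesis using th by linarith
  qed
qed simp

lemma abs_slope_le: "x \<in> I \<Longrightarrow> \<bar>slope w x\<bar> \<le> 1 / 2"
proof -
  assume x: "x \<in> I"
  have "5 / 4 * \<bar>slope w x\<bar> \<le> (x - c) * \<bar>slope w x\<bar>" using shift_bounds(3)[OF x] by (intro mult_right_mono) auto
  also have "\<dots> = \<bar>(x - c) * slope w x\<bar>" using shift_bounds(3)[OF x] by (simp add: abs_mult)
  also have "\<dots> \<le> 5 / 8" using slope_bounds[OF x, of w] by linarith
  finally show ?thesis by simp
qed

text \<open>The three summands of the recursion are at most 8/25, 1/10 and 1/5, so the bound 1
  reproduces itself.\<close>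

lemma abs_slope_deriv_le: "x \<in> I \<Longrightarrow> \<bar>slope_deriv w x\<bar> \<le> 1"
proof (induction w arbitrary: x)
  case (Cons b w)
  let ?y = "sgn_bit b * q x"
  have y: "?y \<in> I" by (rule sgn_q_mem[OF Cons.prems])
  have b: "5 / 4 < x - c" "1 < q x" using shift_bounds[OF Cons.prems] q_bounds[OF Cons.prems] by auto
  have 1: "\<bar>- 1 / (2 * (x - c)\<^sup>2)\<bar> \<le> 8 / 25"
  proof -
    have "(5 / 4)\<^sup>2 \<le> (x - c)\<^sup>2" using b by (intro power_mono) auto
    then have "1 / (2 * (x - c)\<^sup>2) \<le> 1 / (2 * (5 / 4)\<^sup>2)" by (intro frac_le) (auto simp: power2_eq_square)
    then show ?thesis by (simp add: power2_eq_square)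
  qed
  have 2: "\<bar>sgn_bit b / (4 * q x * (x - c)) * slope w ?y\<bar> \<le> 1 / 5 * (1 / 2)"
  proof -
    have "1 * (5 / 4) \<le> q x * (x - c)" using b by (intro mult_mono) auto
    then have "1 / (4 * q x * (x - c)) \<le> 1 / 5" using b by (simp add: field_simps)
    moreover have "\<bar>sgn_bit b / (4 * q x * (x - c))\<bar> = 1 / (4 * q x * (x - c))" using b by (simp add: abs_mult)
    ultimately show ?thesis unfolding abs_mult using abs_slope_le[OF y] by (intro mult_mono) auto
  qed
  have 3: "\<bar>1 / (4 * (x - c)) * slope_deriv w ?y\<bar> \<le> 1 / 5 * 1"
  proof -
    have "\<bar>1 / (4 * (x - c))\<bar> \<le> 1 / 5" using b by (simp add: field_simps)
    then show ?thesis unfolding abs_mult using Cons.IH[OF y] by (intro mult_mono) auto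
  qed
  show ?case unfolding slope_deriv.simps using 1 2 3 by linarith
qed simp

text \<open>The sum is minus the derivative of the phase of a pair of words. The slope at
  \<open>y\<close> may be negative, but not below -(1/8) / (-c), since y - c \<ge> -c. At
  \<open>- y\<close> the value \<open>q (- y)\<close> is at most sqrt (-c), which improves \<theta>
  to 11/10 and the scaled slope to 1/2 - (11/10)(5/8)/2 = 5/32, which exceeds 1/8 by 1/32.\<close>

lemma slope_sum_lower:
  assumes y: "y \<in> I" "0 \<le> y" and w': "w' \<noteq> []"
  shows "1 / (32 * (- c)) \<le> slope w y + slope w' (- y)"
proof -
  obtain b v where bv: "w' = b # v" using w' by (cases w') auto
  have y': "- y \<in> I" using y by simp
  let ?p = "q (- y)"
  let ?z = "sgn_bit b * ?p"
  have p: "1 < ?p" "?p\<^sup>2 = - y - c" using q_bounds[OF y'] shift_bounds[OF y'] q_squared by auto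
  have z: "?z \<in> I" by (rule sgn_q_mem[OF y'])
  have zc: "0 < ?z - c" using shift_bounds[OF z] by simp
  define X where "X = (?z - c) * slope v ?z"
  have X: "- 1 / 8 \<le> X" "X \<le> 5 / 8" using slope_bounds[OF z, of v] by (auto simp: X_def)
  \<comment> \<open>11/21 is the constant that gives \<theta> \<le> 11/10 on the
    \<open>False\<close> branch; it is admissible since (21/11)^2 < 3.65 < -c.\<close>
  have p2: "?p \<le> 11 / 21 * (- c)"
  proof (rule power2_le_imp_le)
    have "- c * 1 \<le> - c * ((11 / 21)\<^sup>2 * (- c))" using c by (intro mult_left_mono) (auto simp: power2_eq_square)
    then have "- c \<le> (11 / 21 * (- c))\<^sup>2" by (simp add: power2_eq_square)
    then show "?p\<^sup>2 \<le> (11 / 21 * (- c))\<^sup>2" using p(2) y(2) by linarith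
  qed (use c in simp)
  have eq: "(- y - c) * slope w' (- y) = 1 / 2 + sgn_bit b * (?p / (2 * (?z - c))) * X"
    using p zc unfolding X_def bv by (simp add: p(2)[symmetric] field_simps power2_eq_square)
  define \<theta> where "\<theta> = ?p / (?z - c)"
  have th: "0 \<le> \<theta>" using p zc by (simp add: \<theta>_def)
  have tX: "\<theta> * X \<le> \<theta> * (5 / 8)" "\<theta> * (- 1 / 8) \<le> \<theta> * X" using X th by (intro mult_left_mono; simp)+
  have "5 / 32 \<le> (- y - c) * slope w' (- y)"
  proof (cases b)
    case True
    have "\<theta> \<le> 11 / 10" using p2 p zc True c unfolding \<theta>_def by (simp add: field_simps)
    moreover have "(- y - c) * slope w' (- y) = 1 / 2 + \<theta> * X / 2" using eq True by (simp add: \<theta>_def)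
    ultimately show ?thesis using tX by linarith
  next
    case False
    have "\<theta> \<le> 11 / 10" using p2 p zc False unfolding \<theta>_def by (simp add: field_simps)
    moreover have "(- y - c) * slope w' (- y) = 1 / 2 - \<theta> * X / 2" using eq False by (simp add: \<theta>_def)
    ultimately show ?thesis using tX by linarith
  qed
  moreover have yc: "5 / 4 < - y - c" using shift_bounds[OF y'] by simp
  ultimately have "(5 / 32) / (- y - c) \<le> slope w' (- y)" by (simp add: field_simps)
  moreover have "(5 / 32) / (- c) \<le> (5 / 32) / (- y - c)" using yc y(2) c by (intro divide_left_mono mult_pos_pos) auto
  moreover have "- (1 / 8) / (- c) \<le> slope w y"
  proof -
    have yc': "0 < y - c" using shift_bounds[OF y(1)] by simp
    have "- (1 / 8) / (y - c) \<le> slope w y" using slope_bounds[OF y(1), of w] yc' by (simp add: field_simps)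
    moreover have "(1 / 8) / (y - c) \<le> (1 / 8) / (- c)" using yc' y(2) c by (intro divide_left_mono mult_pos_pos) auto
    ultimately show ?thesis by linarith
  qed
  moreover have "(5 / 32) / (- c) + - (1 / 8) / (- c) = 1 / (32 * (- c))" using c by (simp add: field_simps)
  ultimately show ?thesis by linarith
qed

end

section \<open>Square integrals of sums over words\<close>

context quadratic_family
begin

lemma continuous_on_q: "continuous_on I q"
  unfolding q_def by (intro continuous_intros)

lemma continuous_on_sgn_q: "continuous_on I (\<lambda>x. sgn_bit b * q x)"
  by (intro continuous_intros continuous_on_q)

lemma continuous_on_word_map: "continuous_on I (word_map w)"
  by (rule DERIV_continuous_on[OF has_field_derivative_at_within[OF word_map_has_derivative]])

lemma continuous_on_word_log: "continuous_on I (word_log w)"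
  by (rule DERIV_continuous_on[OF has_field_derivative_at_within[OF word_log_has_derivative]])

lemma continuous_on_slope: "continuous_on I (slope w)"
  by (rule DERIV_continuous_on[OF has_field_derivative_at_within[OF slope_has_derivative]])

lemma continuous_on_word_deriv: "continuous_on I (word_deriv w)"
proof (induction w)
  case (Cons b w)
  have "continuous_on I (\<lambda>x. word_deriv w (sgn_bit b * q x))"
    by (rule continuous_on_compose2[OF Cons continuous_on_sgn_q]) (use sgn_q_mem in auto)
  then show ?case
    unfolding word_deriv.simps[abs_def] using q_bounds by (intro continuous_intros continuous_on_q) force+
qed (simp add: word_deriv.simps[abs_def])

lemma continuous_on_slope_deriv: "continuous_on I (slope_deriv w)"
proof (induction w)
  case (Cons b w)
  have 1: "continuous_on I (\<lambda>x. slope_deriv w (sgn_bit b * q x))"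
    by (rule continuous_on_compose2[OF Cons continuous_on_sgn_q]) (use sgn_q_mem in auto)
  have 2: "continuous_on I (\<lambda>x. slope w (sgn_bit b * q x))"
    by (rule continuous_on_compose2[OF continuous_on_slope continuous_on_sgn_q]) (use sgn_q_mem in auto)
  show ?case
    unfolding slope_deriv.simps[abs_def] using q_bounds shift_bounds
    by (intro continuous_intros continuous_on_q 1 2) force+
qed (simp add: slope_deriv.simps[abs_def])

lemma integral_quadratic_substitution:
  assumes "continuous_on {m..\<zeta>} G"
  shows "integral I (\<lambda>x. G (q x)) = integral {m..\<zeta>} (\<lambda>y. 2 * y * G y :: real)"
proof -
  have ends: "m\<^sup>2 + c = -\<zeta>" "\<zeta>\<^sup>2 + c = \<zeta>" using m_squared c_eq by auto
  have "((\<lambda>y. (2 * y) *\<^sub>R G (q (y\<^sup>2 + c))) has_integral (integral {m\<^sup>2 + c..\<zeta>\<^sup>2 + c} (\<lambda>x. G (q x)))) {m..\<zeta>}"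
  proof (rule has_integral_substitution[where c = "-\<zeta>" and d = \<zeta> and g = "\<lambda>y. y\<^sup>2 + c"])
    show "m \<le> \<zeta>" using m_le_zeta by simp
    show "m\<^sup>2 + c \<le> \<zeta>\<^sup>2 + c" unfolding ends using zeta_gt by simp
    show "(\<lambda>y. y\<^sup>2 + c) ` {m..\<zeta>} \<subseteq> {-\<zeta>..\<zeta>}"
    proof clarify
      fix y assume y: "y \<in> {m..\<zeta>}"
      then have "m\<^sup>2 \<le> y\<^sup>2" "y\<^sup>2 \<le> \<zeta>\<^sup>2" using m_gt_1 by (intro power_mono; simp)+
      then show "y\<^sup>2 + c \<in> {-\<zeta>..\<zeta>}" using ends by auto
    qed
    show "continuous_on {-\<zeta>..\<zeta>} (\<lambda>x. G (q x))"
      by (rule continuous_on_compose2[OF assms continuous_on_q]) (use q_bounds in auto)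
    show "((\<lambda>y. y\<^sup>2 + c) has_real_derivative 2 * y) (at y within {m..\<zeta>})" for y
      by (auto intro!: derivative_eq_intros)
  qed
  then have "integral I (\<lambda>x. G (q x)) = integral {m..\<zeta>} (\<lambda>y. (2 * y) *\<^sub>R G (q (y\<^sup>2 + c)))"
    unfolding ends by (rule integral_unique[symmetric])
  also have "\<dots> = integral {m..\<zeta>} (\<lambda>y. 2 * y * G y)"
  proof (rule Henstock_Kurzweil_Integration.integral_cong)
    fix y assume "y \<in> {m..\<zeta>}"
    then have "q (y\<^sup>2 + c) = y" using m_gt_1 by (simp add: q_def)
    then show "(2 * y) *\<^sub>R G (q (y\<^sup>2 + c)) = 2 * y * G y" by simp
  qed
  finally show ?thesis .
qed

lemma continuous_on_reflect: "continuous_on I f \<Longrightarrow> continuous_on {m..\<zeta>} (\<lambda>y. f (- y))"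
  using m_gt_1 by (intro continuous_on_compose2[of I f _ uminus] continuous_intros) auto

lemma continuous_on_positive: "continuous_on I f \<Longrightarrow> continuous_on {m..\<zeta>} f"
  using m_gt_1 by (elim continuous_on_subset) auto

text \<open>The two halves omit the gap between \<open>- m\<close> and \<open>m\<close>, over which
  the integral is nonnegative.\<close>

lemma integral_symmetric_le:
  assumes f: "continuous_on I f" and nn: "\<And>x. x \<in> I \<Longrightarrow> 0 \<le> f x"
  shows "integral {m..\<zeta>} (\<lambda>y. f y + f (- y)) \<le> integral I (f :: real \<Rightarrow> real)"
proof -
  have int: "f integrable_on I" by (rule integrable_continuous_interval[OF f])
  have i: "f integrable_on {x..y}" if "-\<zeta> \<le> x" "y \<le> \<zeta>" for x y
    by (rule integrable_subinterval_real[OF int]) (use that in auto)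
  have "integral {m..\<zeta>} (\<lambda>y. f y + f (- y)) = integral {m..\<zeta>} f + integral {m..\<zeta>} (\<lambda>y. f (- y))"
    by (intro Henstock_Kurzweil_Integration.integral_add integrable_continuous_interval continuous_on_reflect continuous_on_positive f)
  also have "integral {m..\<zeta>} (\<lambda>y. f (- y)) = integral {-\<zeta>..-m} f"
    using Henstock_Kurzweil_Integration.integral_reflect_real[of \<zeta> m "\<lambda>y. f (- y)"] by simp
  also have "integral {m..\<zeta>} f + integral {-\<zeta>..-m} f \<le> integral I f"
  proof -
    have 1: "integral {-\<zeta>..-m} f + integral {-m..\<zeta>} f = integral I f"
      by (rule Henstock_Kurzweil_Integration.integral_combine[OF _ _ int]) (use m_le_zeta m_gt_1 in auto)
    have 2: "integral {-m..m} f + integral {m..\<zeta>} f = integral {-m..\<zeta>} f"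
      by (rule Henstock_Kurzweil_Integration.integral_combine[OF _ _ i]) (use m_le_zeta m_gt_1 in auto)
    have "0 \<le> integral {-m..m} f"
      by (rule Henstock_Kurzweil_Integration.integral_nonneg[OF i nn]) (use m_le_zeta m_gt_1 in auto)
    then show ?thesis using 1 2 by linarith
  qed
  finally show ?thesis .
qed

definition weight :: "real \<Rightarrow> real \<Rightarrow> real" where
  "weight \<sigma> y = exp ((1 - 2 * \<sigma>) * ln (2 * y))"

lemma weight_bounds:
  assumes "1 / 2 \<le> \<sigma>" "m \<le> y"
  shows "0 < weight \<sigma> y" "weight \<sigma> y \<le> exp (- (2 * \<sigma> - 1) * ln (2 * m))" "weight \<sigma> y \<le> 1"
proof -
  have l: "0 \<le> ln (2 * m)" "ln (2 * m) \<le> ln (2 * y)" using m_gt_1 assms(2) by auto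
  have "(2 * \<sigma> - 1) * ln (2 * m) \<le> (2 * \<sigma> - 1) * ln (2 * y)" using assms(1) l by (intro mult_left_mono) auto
  then show 1: "weight \<sigma> y \<le> exp (- (2 * \<sigma> - 1) * ln (2 * m))" by (simp add: weight_def algebra_simps)
  have "0 \<le> (2 * \<sigma> - 1) * ln (2 * m)" using assms(1) l by (intro mult_nonneg_nonneg) auto
  then have "exp (- (2 * \<sigma> - 1) * ln (2 * m)) \<le> 1" unfolding exp_le_one_iff mult_minus_left by linarith
  then show "weight \<sigma> y \<le> 1" using 1 by linarith
qed (simp add: weight_def)

lemma continuous_on_weight: "continuous_on {m..\<zeta>} (weight \<sigma>)"
  unfolding weight_def[abs_def] using m_gt_1 by (intro continuous_intros) auto

text \<open>The Jacobian \<open>2 y\<close> of the substitution \<open>y = q x\<close> combines with the factor \<open>(2 y) powr (- 2 * \<sigma>)\<close> of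
  the operator to a bounded weight precisely when \<open>\<sigma> \<ge> 1 / 2\<close>; this is where the line \<open>Re s = 1 / 2\<close>
  comes from.\<close>

lemma integral_transfer:
  assumes "continuous_on {m..\<zeta>} G"
  shows "integral I (\<lambda>x. exp (2 * \<sigma> * - ln (2 * q x)) * G (q x)) = integral {m..\<zeta>} (\<lambda>y. weight \<sigma> y * G y)"
proof -
  have "continuous_on {m..\<zeta>} (\<lambda>y. exp (2 * \<sigma> * - ln (2 * y)) * G y)"
    using m_gt_1 by (intro continuous_intros assms) auto
  from integral_quadratic_substitution[OF this]
  have "integral I (\<lambda>x. exp (2 * \<sigma> * - ln (2 * q x)) * G (q x)) = integral {m..\<zeta>} (\<lambda>y. 2 * y * (exp (2 * \<sigma> * - ln (2 * y)) * G y))" .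
  also have "\<dots> = integral {m..\<zeta>} (\<lambda>y. weight \<sigma> y * G y)"
  proof (rule Henstock_Kurzweil_Integration.integral_cong)
    fix y assume "y \<in> {m..\<zeta>}"
    then have "0 < y" using m_gt_1 by simp
    then have "2 * y * exp (2 * \<sigma> * - ln (2 * y)) = exp (ln (2 * y)) * exp (2 * \<sigma> * - ln (2 * y))" by simp
    also have "\<dots> = weight \<sigma> y" unfolding weight_def exp_add[symmetric] by (simp add: algebra_simps)
    finally show "2 * y * (exp (2 * \<sigma> * - ln (2 * y)) * G y) = weight \<sigma> y * G y" by (simp add: mult.assoc[symmetric])
  qed
  finally show ?thesis .
qed

text \<open>The weight left after the substitution is at most 1 and the two images of
  \<open>I\<close> do not overlap, so the operator with exponent 2 \<sigma> does not increase
  integrals of nonnegative functions.\<close>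

lemma integral_transfer_le:
  assumes \<sigma>: "1 / 2 \<le> \<sigma>" and f: "continuous_on I f" and nn: "\<And>x. x \<in> I \<Longrightarrow> 0 \<le> f x"
  shows "integral I (\<lambda>x. exp (2 * \<sigma> * - ln (2 * q x)) * (f (q x) + f (- q x))) \<le> integral I f"
proof -
  have cont: "continuous_on {m..\<zeta>} (\<lambda>y. f y + f (- y))"
    by (intro continuous_intros continuous_on_positive continuous_on_reflect f)
  have "integral I (\<lambda>x. exp (2 * \<sigma> * - ln (2 * q x)) * (f (q x) + f (- q x)))
      = integral {m..\<zeta>} (\<lambda>y. weight \<sigma> y * (f y + f (- y)))"
    by (rule integral_transfer[OF cont])
  also have "\<dots> \<le> integral {m..\<zeta>} (\<lambda>y. f y + f (- y))"
  proof (rule Henstock_Kurzweil_Integration.integral_le)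
    fix y assume y: "y \<in> {m..\<zeta>}"
    then have "0 \<le> f y + f (- y)" using m_gt_1 by (intro add_nonneg_nonneg nn) auto
    then show "weight \<sigma> y * (f y + f (- y)) \<le> f y + f (- y)"
      using mult_right_mono[OF weight_bounds(3)[OF \<sigma>, of y]] y by simp
  qed (intro integrable_continuous_interval continuous_intros continuous_on_weight cont)+
  also have "\<dots> \<le> integral I f" by (rule integral_symmetric_le[OF f nn])
  finally show ?thesis .
qed

abbreviation words :: "nat \<Rightarrow> bool list set" where
  "words n \<equiv> {w. length w = n}"

lemma finite_words: "finite (words n)" and card_words: "card (words n) = 2 ^ n"
  using finite_lists_length_eq[of "UNIV :: bool set" n] card_lists_length_eq[of "UNIV :: bool set" n] by auto

lemma sum_words_Suc:
  fixes f :: "bool list \<Rightarrow> 'a::comm_monoid_add"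
  shows "(\<Sum>w\<in>words (Suc n). f w) = (\<Sum>w\<in>words n. f (True # w)) + (\<Sum>w\<in>words n. f (False # w))"
proof -
  have "words (Suc n) = (#) True ` words n \<union> (#) False ` words n"
    by (auto simp: length_Suc_conv)
  moreover have "(#) True ` words n \<inter> (#) False ` words n = {}" by auto
  ultimately have "(\<Sum>w\<in>words (Suc n). f w) = (\<Sum>w\<in>(#) True ` words n. f w) + (\<Sum>w\<in>(#) False ` words n. f w)"
    using finite_words by (simp add: sum.union_disjoint)
  then show ?thesis by (simp add: sum.reindex)
qed

lemma sum_integral_words_le:
  assumes \<sigma>: "1 / 2 \<le> \<sigma>" and f: "continuous_on I f" and nn: "\<And>x. x \<in> I \<Longrightarrow> 0 \<le> f x"
  shows "(\<Sum>w\<in>words n. integral I (\<lambda>x. exp (2 * \<sigma> * word_log w x) * f (word_map w x))) \<le> integral I f"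
proof (induction n)
  case (Suc n)
  define k where "k = (\<lambda>w x. exp (2 * \<sigma> * word_log w x) * f (word_map w x))"
  have k: "continuous_on I (k w)" for w
    unfolding k_def
    by (intro continuous_intros continuous_on_word_log continuous_on_compose2[OF f continuous_on_word_map])
       (use word_map_mem in auto)
  have k0: "0 \<le> k w x" if "x \<in> I" for w x unfolding k_def using that by (auto intro!: mult_nonneg_nonneg nn word_map_mem)
  have eq: "k (b # w) x = exp (2 * \<sigma> * - ln (2 * q x)) * k w (sgn_bit b * q x)" for b w x
    by (simp add: k_def exp_add[symmetric] algebra_simps)
  have kc: "continuous_on I (\<lambda>x. exp (2 * \<sigma> * - ln (2 * q x)) * k w (sgn_bit b * q x))" for b w
    unfolding eq[symmetric] by (rule k)
  have "(\<Sum>w\<in>words (Suc n). integral I (k w)) = (\<Sum>w\<in>words n. integral I (k (True # w)) + integral I (k (False # w)))"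
    by (simp add: sum_words_Suc sum.distrib)
  also have "\<dots> = (\<Sum>w\<in>words n. integral I (\<lambda>x. exp (2 * \<sigma> * - ln (2 * q x)) * (k w (q x) + k w (- q x))))"
  proof (rule sum.cong[OF refl])
    fix w
    have "integral I (k (True # w)) + integral I (k (False # w)) = integral I (\<lambda>x. k (True # w) x + k (False # w) x)"
      by (rule Henstock_Kurzweil_Integration.integral_add[symmetric]) (intro integrable_continuous_interval k)+
    then show "integral I (k (True # w)) + integral I (k (False # w)) = integral I (\<lambda>x. exp (2 * \<sigma> * - ln (2 * q x)) * (k w (q x) + k w (- q x)))"
      unfolding eq by (simp add: distrib_left)
  qed
  also have "\<dots> \<le> (\<Sum>w\<in>words n. integral I (k w))"
    by (intro sum_mono integral_transfer_le[OF \<sigma> k k0])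
  also have "\<dots> \<le> integral I f" using Suc by (simp add: k_def)
  finally show ?case by (simp add: k_def)
qed simp

text \<open>Cauchy-Schwarz over the \<open>2 ^ n\<close> words is the source of the factor; the sum
  of the squared terms is again an iterate of the operator, now with exponent 2 \<sigma>, and loses
  nothing.\<close>

lemma integral_square_sum_words_le:
  assumes \<sigma>: "1 / 2 \<le> \<sigma>" and f: "continuous_on I f" and nn: "\<And>x. x \<in> I \<Longrightarrow> 0 \<le> f x"
  shows "integral I (\<lambda>x. (\<Sum>w\<in>words n. exp (\<sigma> * word_log w x) * f (word_map w x))\<^sup>2) \<le> 2 ^ n * integral I (\<lambda>x. (f x)\<^sup>2)"
proof -
  let ?F = "\<lambda>w x. exp (\<sigma> * word_log w x) * f (word_map w x)"
  have F: "continuous_on I (?F w)" for w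
    by (intro continuous_intros continuous_on_word_log continuous_on_compose2[OF f continuous_on_word_map])
       (use word_map_mem in auto)
  have "integral I (\<lambda>x. (\<Sum>w\<in>words n. ?F w x)\<^sup>2) \<le> integral I (\<lambda>x. 2 ^ n * (\<Sum>w\<in>words n. (?F w x)\<^sup>2))"
  proof (rule Henstock_Kurzweil_Integration.integral_le)
    fix x
    have "(\<Sum>w\<in>words n. ?F w x * 1)\<^sup>2 \<le> (\<Sum>w\<in>words n. (?F w x)\<^sup>2) * (\<Sum>w\<in>words n. 1\<^sup>2)"
      by (rule Cauchy_Schwarz_ineq_sum)
    then show "(\<Sum>w\<in>words n. ?F w x)\<^sup>2 \<le> 2 ^ n * (\<Sum>w\<in>words n. (?F w x)\<^sup>2)"
      by (simp add: card_words mult.commute)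
  qed (intro integrable_continuous_interval continuous_intros F)+
  also have "\<dots> = 2 ^ n * (\<Sum>w\<in>words n. integral I (\<lambda>x. (?F w x)\<^sup>2))"
    by (subst Henstock_Kurzweil_Integration.integral_sum[symmetric])
       (auto simp: finite_words intro!: integrable_continuous_interval continuous_intros F)
  also have "(\<Sum>w\<in>words n. integral I (\<lambda>x. (?F w x)\<^sup>2)) = (\<Sum>w\<in>words n. integral I (\<lambda>x. exp (2 * \<sigma> * word_log w x) * (f (word_map w x))\<^sup>2))"
  proof -
    have "(?F w x)\<^sup>2 = exp (2 * \<sigma> * word_log w x) * (f (word_map w x))\<^sup>2" for w x
      by (simp add: power_mult_distrib exp_double[symmetric] mult.assoc)
    then show ?thesis by simp
  qed
  also have "2 ^ n * \<dots> \<le> 2 ^ n * integral I (\<lambda>x. (f x)\<^sup>2)"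
    by (intro mult_left_mono sum_integral_words_le[OF \<sigma>, of "\<lambda>x. (f x)\<^sup>2"] continuous_intros f) auto
  finally show ?thesis .
qed

end

section \<open>The correlation of an eigenfunction with its reflection\<close>

context quadratic_family
begin

text \<open>The largest modulus of the derivative of a branch on \<open>I\<close>, attained at
  \<open>- \<zeta>\<close>.\<close>

definition "\<kappa> = 1 / (2 * m)"
definition "phase_gap = 1 / (32 * (- c))"
text \<open>The constant of \<open>oscillatory_integral_bound\<close> on \<open>{m..\<zeta>}\<close>
  with \<open>phase_gap\<close> as lower bound for the phase derivative; it depends neither on
  \<open>s\<close> nor on the words.\<close>

definition "osc_const = 2 / (phase_gap * (\<zeta> - m)) + 2 / phase_gap\<^sup>2 + 3 / phase_gap"

lemma phase_gap_pos: "0 < phase_gap" using c by (simp add: phase_gap_def)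

lemma osc_const_nonneg: "0 \<le> osc_const"
  using phase_gap_pos m_le_zeta by (simp add: osc_const_def)

end

text \<open>Only real variable data are kept from the holomorphic eigenfunction. The second equation
  is the derivative of the first: the exponential factor contributes -s / (2 (x - c)), and the minus
  sign before \<open>u' (- q x)\<close> comes from the derivative of the reflected branch.\<close>

locale eigenfunction = quadratic_family +
  fixes s :: complex and u u' :: "real \<Rightarrow> complex"
  assumes \<sigma>: "1 / 2 \<le> Re s"
    and u_deriv: "x \<in> I \<Longrightarrow> (u has_vector_derivative u' x) (at x within I)"
    and u'_cont: "continuous_on I u'"
    and eigen: "x \<in> I \<Longrightarrow> u x = exp (s * of_real (- ln (2 * q x))) * (u (q x) + u (- q x))"
    and eigen': "x \<in> I \<Longrightarrow> u' x = - s / of_real (2 * (x - c)) * u x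
      + exp (s * of_real (- ln (2 * q x))) * (u' (q x) - u' (- q x)) / of_real (2 * q x)"
begin

abbreviation "\<sigma> \<equiv> Re s"
abbreviation "t \<equiv> Im s"

definition "N = integral I (\<lambda>x. (cmod (u x))\<^sup>2)"

lemma u_cont: "continuous_on I u"
  using u_deriv by (intro continuous_on_vector_derivative) auto

lemma q_mem: "x \<in> I \<Longrightarrow> q x \<in> I" "x \<in> I \<Longrightarrow> - q x \<in> I"
  using sgn_q_mem[of x True] sgn_q_mem[of x False] by simp_all

lemma norm_exp_s: "cmod (exp (s * of_real r)) = exp (\<sigma> * r)"
  by (simp add: norm_exp_eq_Re)

lemma N_nonneg: "0 \<le> N"
  unfolding N_def by (intro Henstock_Kurzweil_Integration.integral_nonneg integrable_continuous_interval continuous_intros u_cont) auto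

lemma N_eq_0D:
  assumes "N = 0" "x \<in> I"
  shows "u x = 0"
proof -
  have c: "continuous_on I (\<lambda>x. (cmod (u x))\<^sup>2)" by (intro continuous_intros u_cont)
  then have "((\<lambda>x. (cmod (u x))\<^sup>2) has_integral 0) (cbox (-\<zeta>) \<zeta>)"
    using integrable_integral[OF integrable_continuous_interval[OF c]] assms(1) by (simp add: N_def)
  then have "(cmod (u x))\<^sup>2 = 0"
    using c assms(2) zeta_gt by (intro has_integral_0_cbox_imp_0[of "-\<zeta>" \<zeta>]) auto
  then show ?thesis by simp
qed

text \<open>In \<open>u' = A + B\<close> the part \<open>A\<close> is at most a multiple of |s| |u|,
  while \<open>B\<close> is the operator applied to \<open>u'\<close> with a sign and an extra
  contraction 1 / (2 q). As x - c > 5/4, a factor 4/5 < 1 remains in front of the square integral of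
  \<open>u'\<close>, which is absorbed on the left.\<close>

lemma derivative_square_integral_le: "integral I (\<lambda>x. (cmod (u' x))\<^sup>2) \<le> 8 / 5 * (cmod s)\<^sup>2 * N"
proof -
  let ?N1 = "integral I (\<lambda>x. (cmod (u' x))\<^sup>2)"
  let ?T = "\<lambda>x. exp (2 * \<sigma> * - ln (2 * q x)) * ((cmod (u' (q x)))\<^sup>2 + (cmod (u' (- q x)))\<^sup>2)"
  have cT: "continuous_on I ?T"
    using q_bounds
    by (intro continuous_intros continuous_on_q continuous_on_compose2[OF u'_cont continuous_on_q]
        continuous_on_compose2[OF u'_cont, of _ "\<lambda>x. - q x"]) (use q_mem in force)+
  have point: "(cmod (u' x))\<^sup>2 \<le> 8 / 25 * (cmod s)\<^sup>2 * (cmod (u x))\<^sup>2 + 4 / 5 * ?T x" if x: "x \<in> I" for x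
  proof -
    have b: "5 / 4 < x - c" "1 < q x" "(q x)\<^sup>2 = x - c" using shift_bounds[OF x] q_bounds[OF x] q_squared by auto
    define A where "A = - s / of_real (2 * (x - c)) * u x"
    define E where "E = exp (s * of_real (- ln (2 * q x)))"
    define B where "B = E * (u' (q x) - u' (- q x)) / of_real (2 * q x)"
    have "cmod A \<le> 2 / 5 * (cmod s * cmod (u x))"
    proof -
      have "cmod A = (cmod s * cmod (u x)) / (2 * (x - c))"
        unfolding A_def norm_mult norm_divide norm_minus_cancel norm_of_real using b by simp
      also have "\<dots> \<le> (cmod s * cmod (u x)) / (5 / 2)" using b by (intro divide_left_mono) auto
      finally show ?thesis by simp
    qed
    then have A: "(cmod A)\<^sup>2 \<le> 4 / 25 * (cmod s)\<^sup>2 * (cmod (u x))\<^sup>2"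
      using power_mono[of "cmod A" "2 / 5 * (cmod s * cmod (u x))" 2] by (simp add: power_mult_distrib power_divide mult.assoc)
    have E: "(cmod E)\<^sup>2 = exp (2 * \<sigma> * - ln (2 * q x))"
      unfolding E_def norm_exp_s by (simp add: exp_double[symmetric] mult.assoc)
    have D: "(cmod (u' (q x) - u' (- q x)))\<^sup>2 \<le> 2 * ((cmod (u' (q x)))\<^sup>2 + (cmod (u' (- q x)))\<^sup>2)"
    proof -
      have "(cmod (u' (q x) - u' (- q x)))\<^sup>2 \<le> (cmod (u' (q x)) + cmod (u' (- q x)))\<^sup>2"
        by (intro power_mono norm_triangle_ineq4) auto
      then show ?thesis using sum_squares_bound[of "cmod (u' (q x))" "cmod (u' (- q x))"] by (simp add: power2_sum)
    qed
    have "(cmod B)\<^sup>2 = (cmod E)\<^sup>2 * (cmod (u' (q x) - u' (- q x)))\<^sup>2 / (4 * (x - c))"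
      unfolding B_def norm_mult norm_divide norm_of_real using b by (simp add: power_divide power_mult_distrib)
    also have "\<dots> \<le> (cmod E)\<^sup>2 * (2 * ((cmod (u' (q x)))\<^sup>2 + (cmod (u' (- q x)))\<^sup>2)) / 5"
      using b D by (intro frac_le mult_left_mono) auto
    finally have B: "(cmod B)\<^sup>2 \<le> 2 / 5 * ?T x" unfolding E by (simp add: algebra_simps)
    have "(cmod (A + B))\<^sup>2 \<le> (cmod A + cmod B)\<^sup>2" by (intro power_mono norm_triangle_ineq) auto
    also have "\<dots> \<le> 2 * (cmod A)\<^sup>2 + 2 * (cmod B)\<^sup>2"
      using sum_squares_bound[of "cmod A" "cmod B"] by (simp add: power2_sum)
    finally show ?thesis using A B eigen'[OF x] unfolding A_def B_def E_def by simp
  qed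
  have iu: "((\<lambda>x. (cmod (u x))\<^sup>2) has_integral N) I"
    unfolding N_def by (intro integrable_integral integrable_continuous_interval continuous_intros u_cont)
  have iu': "((\<lambda>x. (cmod (u' x))\<^sup>2) has_integral ?N1) I"
    by (intro integrable_integral integrable_continuous_interval continuous_intros u'_cont)
  have iT: "(?T has_integral integral I ?T) I"
    by (rule integrable_integral[OF integrable_continuous_interval[OF cT]])
  have "?N1 \<le> 8 / 25 * (cmod s)\<^sup>2 * N + 4 / 5 * integral I ?T"
    by (rule has_integral_le[OF iu' has_integral_add[OF has_integral_mult_right[OF iu] has_integral_mult_right[OF iT]] point])
  moreover have "integral I ?T \<le> ?N1"
    by (rule integral_transfer_le[OF \<sigma>, of "\<lambda>x. (cmod (u' x))\<^sup>2"]) (intro continuous_intros u'_cont, simp)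
  ultimately show ?thesis by linarith
qed

lemma eigen_iterate: "x \<in> I \<Longrightarrow> u x = (\<Sum>w\<in>words n. exp (s * of_real (word_log w x)) * u (word_map w x))"
proof (induction n arbitrary: x)
  case (Suc n)
  have IH: "u (sgn_bit b * q x) = (\<Sum>w\<in>words n. exp (s * of_real (word_log w (sgn_bit b * q x))) * u (word_map w (sgn_bit b * q x)))" for b
    by (rule Suc.IH[OF sgn_q_mem[OF Suc.prems]])
  have "u x = exp (s * of_real (- ln (2 * q x))) * u (sgn_bit True * q x) + exp (s * of_real (- ln (2 * q x))) * u (sgn_bit False * q x)"
    using eigen[OF Suc.prems] by (simp add: distrib_left)
  moreover have "exp (s * of_real (- ln (2 * q x))) * u (sgn_bit b * q x)
      = (\<Sum>w\<in>words n. exp (s * of_real (word_log (b # w) x)) * u (word_map (b # w) x))" for b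
    unfolding IH[of b] sum_distrib_left
    by (intro sum.cong refl) (simp only: word_log.simps word_map.simps of_real_add distrib_left exp_add mult.assoc)
  ultimately show ?case unfolding sum_words_Suc by (simp only:)
qed simp

text \<open>Sums of moduli over the words, for \<open>u\<close> and for \<open>u'\<close>. The
  derivative of the word is left out of \<open>B\<close>, being estimated separately by
  \<open>\<kappa> ^ n\<close>.\<close>

definition "A n x = (\<Sum>w\<in>words n. exp (\<sigma> * word_log w x) * cmod (u (word_map w x)))"
definition "B n x = (\<Sum>w\<in>words n. exp (\<sigma> * word_log w x) * cmod (u' (word_map w x)))"

lemma A_cont: "continuous_on I (A n)" and B_cont: "continuous_on I (B n)"
  unfolding A_def[abs_def] B_def[abs_def]
  by (intro continuous_intros continuous_on_word_log continuous_on_compose2[OF u_cont continuous_on_word_map];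
      use word_map_mem in blast)
     (intro continuous_intros continuous_on_word_log continuous_on_compose2[OF u'_cont continuous_on_word_map];
      use word_map_mem in blast)

lemma A_square_le: "integral I (\<lambda>x. (A n x)\<^sup>2) \<le> 2 ^ n * N"
  unfolding A_def N_def by (rule integral_square_sum_words_le[OF \<sigma>]) (intro continuous_intros u_cont, simp)

lemma B_square_le: "integral I (\<lambda>x. (B n x)\<^sup>2) \<le> 2 ^ n * (8 / 5 * (cmod s)\<^sup>2 * N)"
proof -
  have "integral I (\<lambda>x. (B n x)\<^sup>2) \<le> 2 ^ n * integral I (\<lambda>x. (cmod (u' x))\<^sup>2)"
    unfolding B_def by (rule integral_square_sum_words_le[OF \<sigma>]) (intro continuous_intros u'_cont, simp)
  also have "\<dots> \<le> 2 ^ n * (8 / 5 * (cmod s)\<^sup>2 * N)"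
    by (intro mult_left_mono derivative_square_integral_le) simp
  finally show ?thesis .
qed

text \<open>The amplitude of a word: its term in \<open>eigen_iterate\<close> stripped of the phase
  exp (i t word_log w). In the derivative \<open>F'\<close> a size growing with \<open>t\<close> can
  enter through \<open>u'\<close> alone.\<close>

definition "F w x = of_real (exp (\<sigma> * word_log w x)) * u (word_map w x)"
definition "F' w x = of_real (exp (\<sigma> * word_log w x)) * (of_real (- \<sigma> * slope w x) * u (word_map w x)
    + of_real (word_deriv w x) * u' (word_map w x))"

lemma F_has_derivative:
  assumes x: "x \<in> I"
  shows "(F w has_vector_derivative F' w x) (at x within I)"
proof -
  have "((\<lambda>x. exp (\<sigma> * word_log w x)) has_real_derivative exp (\<sigma> * word_log w x) * (\<sigma> * - slope w x)) (at x within I)"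
    by (rule DERIV_chain2[OF DERIV_exp DERIV_cmult[OF has_field_derivative_at_within[OF word_log_has_derivative[OF x]]]])
  then have 1: "((\<lambda>x. complex_of_real (exp (\<sigma> * word_log w x))) has_vector_derivative of_real (exp (\<sigma> * word_log w x) * (\<sigma> * - slope w x))) (at x within I)"
    by (intro has_vector_derivative_of_real) (simp add: has_real_derivative_iff_has_vector_derivative)
  have wm: "word_map w ` I \<subseteq> I" using word_map_mem by blast
  have 2: "((u \<circ> word_map w) has_vector_derivative (word_deriv w x *\<^sub>R u' (word_map w x))) (at x within I)"
  proof (rule vector_diff_chain_within)
    show "(word_map w has_vector_derivative word_deriv w x) (at x within I)"
      unfolding has_real_derivative_iff_has_vector_derivative[symmetric]
      by (rule has_field_derivative_at_within[OF word_map_has_derivative[OF x]])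
    show "(u has_vector_derivative u' (word_map w x)) (at (word_map w x) within word_map w ` I)"
      by (rule has_vector_derivative_within_subset[OF u_deriv[OF word_map_mem[OF x]] wm])
  qed
  from has_vector_derivative_mult[OF 1 2]
  show ?thesis
    unfolding F_def[abs_def] F'_def o_def by (simp add: scaleR_conv_of_real algebra_simps)
qed

lemma F'_cont: "continuous_on I (F' w)"
  unfolding F'_def[abs_def]
  by (intro continuous_intros continuous_on_word_log continuous_on_slope continuous_on_word_deriv
      continuous_on_compose2[OF u_cont continuous_on_word_map] continuous_on_compose2[OF u'_cont continuous_on_word_map];
      use word_map_mem in blast)

lemma norm_F: "cmod (F w x) = exp (\<sigma> * word_log w x) * cmod (u (word_map w x))"
  by (simp add: F_def norm_mult)

text \<open>The contraction of words of length \<open>n\<close> damps the derivative of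
  \<open>u\<close>, which has size |s|; the other part is bounded through the slopes, independently
  of \<open>n\<close> and \<open>s\<close>.\<close>

lemma norm_F'_le:
  assumes x: "x \<in> I" and w: "length w = n" and "\<sigma> \<le> 1"
  shows "cmod (F' w x) \<le> 1 / 2 * cmod (F w x) + \<kappa> ^ n * (exp (\<sigma> * word_log w x) * cmod (u' (word_map w x)))"
proof -
  have 1: "\<bar>- \<sigma> * slope w x\<bar> \<le> 1 * (1 / 2)"
    unfolding abs_mult using \<sigma> \<open>\<sigma> \<le> 1\<close> abs_slope_le[OF x, of w] by (intro mult_mono) auto
  have 2: "\<bar>word_deriv w x\<bar> \<le> \<kappa> ^ n"
  proof -
    have "\<bar>word_deriv w x\<bar> \<le> exp (- real n * ln (2 * m))"
      unfolding abs_word_deriv[OF x] using word_log_le[OF x, of w] w by simp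
    also have "\<dots> = \<kappa> ^ n"
      using m_gt_1 by (simp add: \<kappa>_def exp_minus exp_of_nat_mult power_one_over inverse_eq_divide)
    finally show ?thesis .
  qed
  have "cmod (F' w x) \<le> exp (\<sigma> * word_log w x) * (\<bar>- \<sigma> * slope w x\<bar> * cmod (u (word_map w x)) + \<bar>word_deriv w x\<bar> * cmod (u' (word_map w x)))"
    unfolding F'_def norm_mult[of "of_real (exp (\<sigma> * word_log w x))"] norm_of_real abs_exp_cancel
    by (intro mult_left_mono order_trans[OF norm_triangle_ineq]) (simp_all add: norm_mult abs_mult)
  also have "\<dots> \<le> exp (\<sigma> * word_log w x) * (1 / 2 * cmod (u (word_map w x)) + \<kappa> ^ n * cmod (u' (word_map w x)))"
    using 1 2 by (intro mult_left_mono add_mono mult_right_mono) auto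
  finally show ?thesis by (simp add: norm_F distrib_left mult.assoc mult.left_commute)
qed

definition "cross = integral {m..\<zeta>} (\<lambda>y. of_real (weight \<sigma> y) * (u y * cnj (u (- y))))"

lemma N_le_cross: "(1 - exp (- (2 * \<sigma> - 1) * ln (2 * m))) * N \<le> 2 * cmod cross"
proof -
  let ?\<theta> = "exp (- (2 * \<sigma> - 1) * ln (2 * m))"
  note cu = continuous_on_positive[OF u_cont] continuous_on_reflect[OF u_cont]
  have cw: "continuous_on {m..\<zeta>} (\<lambda>y. complex_of_real (weight \<sigma> y))" by (intro continuous_intros continuous_on_weight)
  have "N = integral I (\<lambda>x. exp (2 * \<sigma> * - ln (2 * q x)) * (cmod (u (q x) + u (- q x)))\<^sup>2)"
    unfolding N_def
  proof (rule Henstock_Kurzweil_Integration.integral_cong)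
    fix x assume "x \<in> I"
    then show "(cmod (u x))\<^sup>2 = exp (2 * \<sigma> * - ln (2 * q x)) * (cmod (u (q x) + u (- q x)))\<^sup>2"
      using eigen[of x] norm_exp_s[of "- ln (2 * q x)"]
      by (simp add: norm_mult power_mult_distrib exp_double[symmetric] mult.assoc)
  qed
  also have "\<dots> = integral {m..\<zeta>} (\<lambda>y. weight \<sigma> y * (cmod (u y + u (- y)))\<^sup>2)"
    by (rule integral_transfer) (intro continuous_intros cu)
  also have "\<dots> = integral {m..\<zeta>} (\<lambda>y. weight \<sigma> y * ((cmod (u y))\<^sup>2 + (cmod (u (- y)))\<^sup>2)
      + 2 * Re (of_real (weight \<sigma> y) * (u y * cnj (u (- y)))))"
  proof (rule Henstock_Kurzweil_Integration.integral_cong)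
    fix y
    have "(cmod (u y + u (- y)))\<^sup>2 = (cmod (u y))\<^sup>2 + (cmod (u (- y)))\<^sup>2 + 2 * Re (u y * cnj (u (- y)))"
      unfolding cmod_power2 by (simp add: power2_eq_square algebra_simps)
    then show "weight \<sigma> y * (cmod (u y + u (- y)))\<^sup>2 = weight \<sigma> y * ((cmod (u y))\<^sup>2 + (cmod (u (- y)))\<^sup>2)
      + 2 * Re (of_real (weight \<sigma> y) * (u y * cnj (u (- y))))"
      by (simp add: algebra_simps)
  qed
  also have "\<dots> = integral {m..\<zeta>} (\<lambda>y. weight \<sigma> y * ((cmod (u y))\<^sup>2 + (cmod (u (- y)))\<^sup>2)) + 2 * Re cross"
  proof -
    have i: "(\<lambda>y. of_real (weight \<sigma> y) * (u y * cnj (u (- y)))) integrable_on {m..\<zeta>}"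
      by (intro integrable_continuous_interval continuous_intros cu cw)
    have "integral {m..\<zeta>} (\<lambda>y. Re (of_real (weight \<sigma> y) * (u y * cnj (u (- y))))) = Re cross"
      using integral_linear[OF i bounded_linear_Re] by (simp add: cross_def o_def)
    then show ?thesis
      by (subst Henstock_Kurzweil_Integration.integral_add)
         (auto intro!: integrable_continuous_interval continuous_intros cu cw continuous_on_weight)
  qed
  also have "integral {m..\<zeta>} (\<lambda>y. weight \<sigma> y * ((cmod (u y))\<^sup>2 + (cmod (u (- y)))\<^sup>2)) \<le> ?\<theta> * N"
  proof -
    have "integral {m..\<zeta>} (\<lambda>y. weight \<sigma> y * ((cmod (u y))\<^sup>2 + (cmod (u (- y)))\<^sup>2)) \<le> integral {m..\<zeta>} (\<lambda>y. ?\<theta> * ((cmod (u y))\<^sup>2 + (cmod (u (- y)))\<^sup>2))"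
    proof (rule Henstock_Kurzweil_Integration.integral_le)
      show "weight \<sigma> y * ((cmod (u y))\<^sup>2 + (cmod (u (- y)))\<^sup>2) \<le> ?\<theta> * ((cmod (u y))\<^sup>2 + (cmod (u (- y)))\<^sup>2)" if "y \<in> {m..\<zeta>}" for y
        by (intro mult_right_mono weight_bounds(2)[OF \<sigma>]) (use that in auto)
    qed (intro integrable_continuous_interval continuous_intros cu continuous_on_weight)+
    also have "\<dots> = ?\<theta> * integral {m..\<zeta>} (\<lambda>y. (cmod (u y))\<^sup>2 + (cmod (u (- y)))\<^sup>2)" by simp
    also have "\<dots> \<le> ?\<theta> * N"
      unfolding N_def by (intro mult_left_mono integral_symmetric_le[of "\<lambda>x. (cmod (u x))\<^sup>2"] continuous_intros u_cont) auto
    finally show ?thesis .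
  qed
  also have "2 * Re cross \<le> 2 * cmod cross" using complex_Re_le_cmod[of cross] by simp
  finally show ?thesis by (simp add: algebra_simps)
qed

lemma weight_has_derivative:
  assumes "y \<in> {m..\<zeta>}"
  shows "(weight \<sigma> has_real_derivative (1 - 2 * \<sigma>) / y * weight \<sigma> y) (at y within {m..\<zeta>})"
  unfolding weight_def[abs_def] using assms m_gt_1 by (auto intro!: derivative_eq_intros)

lemma reflect_has_derivative:
  assumes y: "y \<in> {m..\<zeta>}"
  shows "((\<lambda>y. F w (- y)) has_vector_derivative - F' w (- y)) (at y within {m..\<zeta>})"
proof -
  have "((F w \<circ> uminus) has_vector_derivative (-1) *\<^sub>R F' w (- y)) (at y within {m..\<zeta>})"
  proof (rule vector_diff_chain_within)
    show "(uminus has_vector_derivative -1) (at y within {m..\<zeta>})"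
      by (auto intro!: derivative_eq_intros)
    show "(F w has_vector_derivative F' w (- y)) (at (- y) within uminus ` {m..\<zeta>})"
      by (rule has_vector_derivative_within_subset[OF F_has_derivative]) (use y m_gt_1 in auto)
  qed
  then show ?thesis by (simp add: o_def)
qed

definition "pair_fun w w' y = of_real (weight \<sigma> y) * (F w y * cnj (F w' (- y)))"
definition "pair_deriv w w' y = of_real (weight \<sigma> y) * (F w y * cnj (- F' w' (- y)) + F' w y * cnj (F w' (- y)))
    + of_real ((1 - 2 * \<sigma>) / y * weight \<sigma> y) * (F w y * cnj (F w' (- y)))"

lemma pair_has_derivative:
  assumes y: "y \<in> {m..\<zeta>}"
  shows "(pair_fun w w' has_vector_derivative pair_deriv w w' y) (at y within {m..\<zeta>})"
proof -
  have sub: "{m..\<zeta>} \<subseteq> I" using m_gt_1 by auto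
  have 1: "((\<lambda>y. complex_of_real (weight \<sigma> y)) has_vector_derivative of_real ((1 - 2 * \<sigma>) / y * weight \<sigma> y)) (at y within {m..\<zeta>})"
    by (rule has_vector_derivative_of_real)
       (use weight_has_derivative[OF y] in \<open>simp add: has_real_derivative_iff_has_vector_derivative\<close>)
  have 2: "(F w has_vector_derivative F' w y) (at y within {m..\<zeta>})"
    by (rule has_vector_derivative_within_subset[OF F_has_derivative sub]) (use y sub in auto)
  have 3: "((\<lambda>y. cnj (F w' (- y))) has_vector_derivative cnj (- F' w' (- y))) (at y within {m..\<zeta>})"
    by (rule has_vector_derivative_cnj[OF reflect_has_derivative[OF y]])
  show ?thesis
    unfolding pair_fun_def[abs_def] pair_deriv_def by (rule has_vector_derivative_mult[OF 1 has_vector_derivative_mult[OF 2 3]])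
qed

text \<open>Each pair of words is treated by \<open>oscillatory_integral_bound\<close>, whose
  constant is the same for all pairs. After that only norms are summed, and the double sum of norms
  factors into products of \<open>A n\<close> and \<open>B n\<close> at \<open>y\<close> and
  \<open>- y\<close>.\<close>

lemma cross_bound:
  assumes n: "0 < n" and t: "1 \<le> \<bar>t\<bar>" and s1: "\<sigma> \<le> 1"
  shows "cmod cross \<le> osc_const * (3 / 2 * 2 ^ n / \<bar>t\<bar> + 21 / 10 * (2 * \<kappa>) ^ n) * N"
proof -
  let ?J = "{m..\<zeta>}"
  let ?W = "words n"
  note pos = continuous_on_positive and refl = continuous_on_reflect
  have sub: "?J \<subseteq> I" using m_gt_1 by auto
  have cF: "continuous_on I (F w)" for w using F_has_derivative by (intro continuous_on_vector_derivative) auto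
  have cpair: "continuous_on ?J (pair_fun w w')" for w w'
    using pair_has_derivative by (intro continuous_on_vector_derivative) auto
  have cderiv: "continuous_on ?J (pair_deriv w w')" for w w'
    unfolding pair_deriv_def[abs_def] using m_gt_1
    by (intro continuous_intros continuous_on_weight pos[OF cF] pos[OF F'_cont] refl[OF cF] refl[OF F'_cont]) auto
  let ?\<Phi> = "\<lambda>w w' y. word_log w y - word_log w' (- y)"
  let ?e = "\<lambda>w w' y. exp (\<i> * of_real (t * ?\<Phi> w w' y))"
  have cphase: "continuous_on ?J (\<lambda>y. ?e w w' y * pair_fun w w' y)" for w w'
    by (intro continuous_intros cpair pos[OF continuous_on_word_log] refl[OF continuous_on_word_log])
  have expand: "of_real (weight \<sigma> y) * (u y * cnj (u (- y))) = (\<Sum>w\<in>?W. \<Sum>w'\<in>?W. ?e w w' y * pair_fun w w' y)" if y: "y \<in> ?J" for y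
  proof -
    have yI: "y \<in> I" "- y \<in> I" using y sub by auto
    have ex: "exp (s * of_real r) = exp (\<i> * of_real (t * r)) * of_real (exp (\<sigma> * r))" for r
    proof -
      have "s * of_real r = \<i> * of_real (t * r) + of_real (\<sigma> * r)" by (simp add: complex_eq_iff)
      then show ?thesis by (simp only: exp_add exp_of_real)
    qed
    have 1: "u y = (\<Sum>w\<in>?W. exp (\<i> * of_real (t * word_log w y)) * F w y)"
      unfolding F_def mult.assoc[symmetric] ex[symmetric] by (rule eigen_iterate[OF yI(1)])
    have "u (- y) = (\<Sum>w\<in>?W. exp (\<i> * of_real (t * word_log w (- y))) * F w (- y))"
      unfolding F_def mult.assoc[symmetric] ex[symmetric] by (rule eigen_iterate[OF yI(2)])
    then have 2: "cnj (u (- y)) = (\<Sum>w\<in>?W. exp (\<i> * of_real (- (t * word_log w (- y)))) * cnj (F w (- y)))"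
      by (simp add: exp_cnj)
    have 3: "exp (\<i> * of_real (t * word_log w y)) * F w y * (exp (\<i> * of_real (- (t * word_log w' (- y)))) * cnj (F w' (- y)))
        = ?e w w' y * (F w y * cnj (F w' (- y)))" for w w'
    proof -
      have "\<i> * of_real (t * ?\<Phi> w w' y) = \<i> * of_real (t * word_log w y) + \<i> * of_real (- (t * word_log w' (- y)))"
        by (simp add: algebra_simps)
      then show ?thesis by (simp only: exp_add mult.assoc mult.left_commute)
    qed
    show ?thesis
      unfolding 1 2 sum_product 3 unfolding sum_distrib_left pair_fun_def
      by (intro sum.cong HOL.refl) (simp only: mult.left_commute)
  qed
  \<comment> \<open>The coefficient 3 is made up of 1 from the amplitude itself, 1/2 from each of
    the two derivatives through the slopes, and 1 from the derivative of the weight, as |1 - 2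
    \<sigma>| / y \<le> 1.\<close>
  define H where "H = (\<lambda>y. 3 * (A n y * A n (- y)) + \<kappa> ^ n * (B n y * A n (- y) + A n y * B n (- y)))"
  have cH: "continuous_on ?J H"
    unfolding H_def by (intro continuous_intros pos[OF A_cont] pos[OF B_cont] refl[OF A_cont] refl[OF B_cont])
  have norms: "(\<Sum>w\<in>?W. \<Sum>w'\<in>?W. cmod (pair_fun w w' y) + cmod (pair_deriv w w' y)) \<le> H y" if y: "y \<in> ?J" for y
  proof -
    have yI: "y \<in> I" "- y \<in> I" using y sub by auto
    have w01: "0 < weight \<sigma> y" "weight \<sigma> y \<le> 1" using weight_bounds[OF \<sigma>, of y] y by auto
    have k0: "0 \<le> \<kappa> ^ n" using m_gt_1 by (simp add: \<kappa>_def)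
    define a b where "a = (\<lambda>w. cmod (F w y))" and "b = (\<lambda>w. exp (\<sigma> * word_log w y) * cmod (u' (word_map w y)))"
    define a' b' where "a' = (\<lambda>w. cmod (F w (- y)))" and "b' = (\<lambda>w. exp (\<sigma> * word_log w (- y)) * cmod (u' (word_map w (- y))))"
    have nn: "0 \<le> a w" "0 \<le> b w" "0 \<le> a' w" "0 \<le> b' w" for w by (simp_all add: a_def b_def a'_def b'_def)
    have pair: "cmod (pair_fun w w' y) + cmod (pair_deriv w w' y) \<le> 3 * (a w * a' w') + \<kappa> ^ n * (b w * a' w' + a w * b' w')"
      if w: "w \<in> ?W" "w' \<in> ?W" for w w'
    proof -
      have d: "cmod (F' w y) \<le> 1 / 2 * a w + \<kappa> ^ n * b w" "cmod (F' w' (- y)) \<le> 1 / 2 * a' w' + \<kappa> ^ n * b' w'"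
        using norm_F'_le[OF yI(1) _ s1, of w n] norm_F'_le[OF yI(2) _ s1, of w' n] w
        by (auto simp: a_def b_def a'_def b'_def)
      have "cmod (pair_fun w w' y) = weight \<sigma> y * (a w * a' w')"
        using w01 by (simp add: pair_fun_def norm_mult a_def a'_def)
      also have "\<dots> \<le> 1 * (a w * a' w')" using w01 nn by (intro mult_right_mono) auto
      finally have 1: "cmod (pair_fun w w' y) \<le> a w * a' w'" by simp
      have c1: "\<bar>(1 - 2 * \<sigma>) / y * weight \<sigma> y\<bar> \<le> 1"
      proof -
        have "\<bar>(1 - 2 * \<sigma>) / y\<bar> \<le> 1" using \<sigma> s1 y m_gt_1 by (auto simp: abs_divide divide_le_eq)
        then show ?thesis unfolding abs_mult using w01 mult_mono[of "\<bar>(1 - 2 * \<sigma>) / y\<bar>" 1 "\<bar>weight \<sigma> y\<bar>" 1] by simp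
      qed
      have "cmod (pair_deriv w w' y) \<le> weight \<sigma> y * (a w * cmod (F' w' (- y)) + cmod (F' w y) * a' w') + \<bar>(1 - 2 * \<sigma>) / y * weight \<sigma> y\<bar> * (a w * a' w')"
      proof -
        have "cmod (F w y * cnj (- F' w' (- y)) + F' w y * cnj (F w' (- y))) \<le> a w * cmod (F' w' (- y)) + cmod (F' w y) * a' w'"
          using norm_triangle_ineq[of "F w y * cnj (- F' w' (- y))" "F' w y * cnj (F w' (- y))"] by (simp add: norm_mult a_def a'_def)
        then have "cmod (of_real (weight \<sigma> y) * (F w y * cnj (- F' w' (- y)) + F' w y * cnj (F w' (- y)))) \<le> weight \<sigma> y * (a w * cmod (F' w' (- y)) + cmod (F' w y) * a' w')"
          unfolding norm_mult[of "of_real (weight \<sigma> y)"] norm_of_real using w01 by (simp add: mult_left_mono)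
        moreover have "cmod (of_real ((1 - 2 * \<sigma>) / y * weight \<sigma> y) * (F w y * cnj (F w' (- y)))) = \<bar>(1 - 2 * \<sigma>) / y * weight \<sigma> y\<bar> * (a w * a' w')"
          unfolding norm_mult norm_of_real complex_mod_cnj a_def a'_def ..
        ultimately show ?thesis unfolding pair_deriv_def
          using norm_triangle_ineq[of "of_real (weight \<sigma> y) * (F w y * cnj (- F' w' (- y)) + F' w y * cnj (F w' (- y)))" "of_real ((1 - 2 * \<sigma>) / y * weight \<sigma> y) * (F w y * cnj (F w' (- y)))"]
          by linarith
      qed
      also have "\<dots> \<le> 1 * (a w * cmod (F' w' (- y)) + cmod (F' w y) * a' w') + 1 * (a w * a' w')"
        using w01 c1 nn by (intro add_mono mult_right_mono) auto
      also have "\<dots> \<le> (a w * (1 / 2 * a' w' + \<kappa> ^ n * b' w') + (1 / 2 * a w + \<kappa> ^ n * b w) * a' w') + a w * a' w'"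
        unfolding mult_1 using d nn by (intro add_mono mult_left_mono mult_right_mono) auto
      also have "\<dots> = 2 * (a w * a' w') + \<kappa> ^ n * (b w * a' w' + a w * b' w')"
        by (simp add: algebra_simps)
      finally show ?thesis using 1 by linarith
    qed
    have "(\<Sum>w\<in>?W. \<Sum>w'\<in>?W. cmod (pair_fun w w' y) + cmod (pair_deriv w w' y))
        \<le> (\<Sum>w\<in>?W. \<Sum>w'\<in>?W. 3 * (a w * a' w') + \<kappa> ^ n * (b w * a' w' + a w * b' w'))"
      by (intro sum_mono pair)
    also have "\<dots> = 3 * (sum a ?W * sum a' ?W) + \<kappa> ^ n * (sum b ?W * sum a' ?W + sum a ?W * sum b' ?W)"
      by (simp add: sum.distrib sum_distrib_left[symmetric] sum_product)
    also have "\<dots> = H y" unfolding H_def A_def B_def a_def a'_def b_def b'_def norm_F ..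
    finally show ?thesis .
  qed
  have osc: "cmod (integral ?J (\<lambda>y. ?e w w' y * pair_fun w w' y))
      \<le> osc_const / \<bar>t\<bar> * integral ?J (\<lambda>y. cmod (pair_fun w w' y) + cmod (pair_deriv w w' y))" if w: "w' \<in> ?W" for w w'
    unfolding osc_const_def
  proof (rule oscillatory_integral_bound[where \<phi> = "\<lambda>y. - (slope w y + slope w' (- y))" and \<phi>' = "\<lambda>y. - (slope_deriv w y - slope_deriv w' (- y))"])
    show "m < \<zeta>" "0 < phase_gap" by (rule m_le_zeta, rule phase_gap_pos)
    show "t \<noteq> 0" using t by auto
    fix y assume y: "y \<in> ?J"
    have yI: "y \<in> I" "- y \<in> I" "0 \<le> y" using y sub m_gt_1 by auto
    have um: "(uminus has_real_derivative -1) (at y)" by (auto intro!: derivative_eq_intros)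
    have d1: "((\<lambda>y. word_log w' (- y)) has_real_derivative - slope w' (- y) * -1) (at y)"
      by (rule DERIV_chain2[OF word_log_has_derivative[OF yI(2)] um])
    have "(?\<Phi> w w' has_real_derivative (- slope w y - - slope w' (- y) * -1)) (at y)"
      by (rule DERIV_diff[OF word_log_has_derivative[OF yI(1)] d1])
    then show "(?\<Phi> w w' has_real_derivative - (slope w y + slope w' (- y))) (at y within ?J)"
      by (rule has_field_derivative_at_within[OF DERIV_cong]) simp
    have d2: "((\<lambda>y. slope w' (- y)) has_real_derivative slope_deriv w' (- y) * -1) (at y)"
      by (rule DERIV_chain2[OF slope_has_derivative[OF yI(2)] um])
    have "((\<lambda>y. - (slope w y + slope w' (- y))) has_real_derivative - (slope_deriv w y + slope_deriv w' (- y) * -1)) (at y)"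
      by (rule DERIV_minus[OF DERIV_add[OF slope_has_derivative[OF yI(1)] d2]])
    then show "((\<lambda>y. - (slope w y + slope w' (- y))) has_real_derivative - (slope_deriv w y - slope_deriv w' (- y))) (at y within ?J)"
      by (rule has_field_derivative_at_within[OF DERIV_cong]) simp
    show "(pair_fun w w' has_vector_derivative pair_deriv w w' y) (at y within ?J)" by (rule pair_has_derivative[OF y])
    have "w' \<noteq> []" using w n by auto
    then have "phase_gap \<le> slope w y + slope w' (- y)"
      unfolding phase_gap_def by (rule slope_sum_lower[OF yI(1,3)])
    then show "phase_gap \<le> \<bar>- (slope w y + slope w' (- y))\<bar>" by simp
    show "\<bar>- (slope_deriv w y - slope_deriv w' (- y))\<bar> \<le> 2"
      using abs_slope_deriv_le[OF yI(1), of w] abs_slope_deriv_le[OF yI(2), of w'] by linarith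
  next
    show "continuous_on ?J (pair_deriv w w')" by (rule cderiv)
    show "continuous_on ?J (\<lambda>y. - (slope_deriv w y - slope_deriv w' (- y)))"
      by (intro continuous_intros pos[OF continuous_on_slope_deriv] refl[OF continuous_on_slope_deriv])
  qed
  have "cross = integral ?J (\<lambda>y. \<Sum>w\<in>?W. \<Sum>w'\<in>?W. ?e w w' y * pair_fun w w' y)"
    unfolding cross_def by (rule Henstock_Kurzweil_Integration.integral_cong) (rule expand)
  also have "\<dots> = (\<Sum>w\<in>?W. integral ?J (\<lambda>y. \<Sum>w'\<in>?W. ?e w w' y * pair_fun w w' y))"
    by (rule Henstock_Kurzweil_Integration.integral_sum[OF finite_words])
       (intro integrable_continuous_interval continuous_on_sum cphase)
  also have "\<dots> = (\<Sum>w\<in>?W. \<Sum>w'\<in>?W. integral ?J (\<lambda>y. ?e w w' y * pair_fun w w' y))"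
    by (intro sum.cong HOL.refl Henstock_Kurzweil_Integration.integral_sum[OF finite_words] integrable_continuous_interval cphase)
  finally have "cmod cross \<le> (\<Sum>w\<in>?W. \<Sum>w'\<in>?W. cmod (integral ?J (\<lambda>y. ?e w w' y * pair_fun w w' y)))"
    by (simp only:) (intro order_trans[OF norm_sum] sum_mono norm_sum)
  also have "\<dots> \<le> (\<Sum>w\<in>?W. \<Sum>w'\<in>?W. osc_const / \<bar>t\<bar> * integral ?J (\<lambda>y. cmod (pair_fun w w' y) + cmod (pair_deriv w w' y)))"
    by (intro sum_mono osc)
  also have "\<dots> = osc_const / \<bar>t\<bar> * integral ?J (\<lambda>y. \<Sum>w\<in>?W. \<Sum>w'\<in>?W. cmod (pair_fun w w' y) + cmod (pair_deriv w w' y))"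
  proof -
    have "integral ?J (\<lambda>y. \<Sum>w\<in>?W. \<Sum>w'\<in>?W. cmod (pair_fun w w' y) + cmod (pair_deriv w w' y))
        = (\<Sum>w\<in>?W. integral ?J (\<lambda>y. \<Sum>w'\<in>?W. cmod (pair_fun w w' y) + cmod (pair_deriv w w' y)))"
      by (rule Henstock_Kurzweil_Integration.integral_sum[OF finite_words])
         (intro integrable_continuous_interval continuous_intros cpair cderiv)
    also have "\<dots> = (\<Sum>w\<in>?W. \<Sum>w'\<in>?W. integral ?J (\<lambda>y. cmod (pair_fun w w' y) + cmod (pair_deriv w w' y)))"
      by (intro sum.cong HOL.refl Henstock_Kurzweil_Integration.integral_sum[OF finite_words] integrable_continuous_interval continuous_intros cpair cderiv)
    finally show ?thesis by (simp only: sum_distrib_left)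
  qed
  also have "\<dots> \<le> osc_const / \<bar>t\<bar> * integral ?J H"
    using osc_const_nonneg
    by (intro mult_left_mono Henstock_Kurzweil_Integration.integral_le integrable_continuous_interval continuous_intros cpair cderiv cH norms) auto
  also have "\<dots> \<le> osc_const / \<bar>t\<bar> * (3 / 2 * (2 ^ n * N) + \<kappa> ^ n * (21 / 10 * \<bar>t\<bar> * (2 ^ n * N)))"
  proof (rule mult_left_mono)
    have k0: "0 \<le> \<kappa> ^ n" using m_gt_1 by (simp add: \<kappa>_def)
    let ?S = "\<lambda>f y. (f y)\<^sup>2 + (f (- y))\<^sup>2"
    \<comment> \<open>Arithmetic-geometric mean with weight |t|, which balances \<open>B n\<close>,
      of size |t|, against \<open>A n\<close>.\<close>
    have ag: "x * y \<le> 1 / 2 * (x\<^sup>2 / \<bar>t\<bar> + \<bar>t\<bar> * y\<^sup>2)" for x y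
    proof -
      have "0 \<le> (x - \<bar>t\<bar> * y)\<^sup>2 / \<bar>t\<bar>" by simp
      also have "\<dots> = x\<^sup>2 / \<bar>t\<bar> - 2 * (x * y) + \<bar>t\<bar> * y\<^sup>2" using t by (simp add: power2_diff field_simps power2_eq_square)
      finally have "2 * (x * y) \<le> x\<^sup>2 / \<bar>t\<bar> + \<bar>t\<bar> * y\<^sup>2" by linarith
      then show ?thesis by simp
    qed
    have "integral ?J H \<le> integral ?J (\<lambda>y. 3 / 2 * ?S (A n) y + \<kappa> ^ n * (1 / 2 * (?S (B n) y / \<bar>t\<bar> + \<bar>t\<bar> * ?S (A n) y)))"
    proof (rule Henstock_Kurzweil_Integration.integral_le)
      show "H integrable_on ?J" by (rule integrable_continuous_interval[OF cH])
      show "(\<lambda>y. 3 / 2 * ?S (A n) y + \<kappa> ^ n * (1 / 2 * (?S (B n) y / \<bar>t\<bar> + \<bar>t\<bar> * ?S (A n) y))) integrable_on ?J"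
        using t by (intro integrable_continuous_interval continuous_intros pos[OF A_cont] pos[OF B_cont] refl[OF A_cont] refl[OF B_cont]) auto
      fix y
      have 1: "2 * (A n y * A n (- y)) \<le> ?S (A n) y" using sum_squares_bound[of "A n y" "A n (- y)"] by simp
      have "B n y * A n (- y) + A n y * B n (- y) \<le> 1 / 2 * (?S (B n) y / \<bar>t\<bar> + \<bar>t\<bar> * ?S (A n) y)"
        using ag[of "B n y" "A n (- y)"] ag[of "B n (- y)" "A n y"] by (simp add: add_divide_distrib distrib_left mult.commute)
      then show "H y \<le> 3 / 2 * ?S (A n) y + \<kappa> ^ n * (1 / 2 * (?S (B n) y / \<bar>t\<bar> + \<bar>t\<bar> * ?S (A n) y))"
        unfolding H_def using 1 k0 by (intro add_mono mult_left_mono) auto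
    qed
    also have "\<dots> = 3 / 2 * integral ?J (?S (A n)) + \<kappa> ^ n * (1 / 2 * (integral ?J (?S (B n)) / \<bar>t\<bar> + \<bar>t\<bar> * integral ?J (?S (A n))))"
    proof -
      have a: "?S (A n) integrable_on ?J" and b: "?S (B n) integrable_on ?J"
        by (intro integrable_continuous_interval continuous_intros pos[OF A_cont] pos[OF B_cont] refl[OF A_cont] refl[OF B_cont])+
      have "((\<lambda>y. 3 / 2 * ?S (A n) y + \<kappa> ^ n * (1 / 2 * (?S (B n) y / \<bar>t\<bar> + \<bar>t\<bar> * ?S (A n) y))) has_integral
        (3 / 2 * integral ?J (?S (A n)) + \<kappa> ^ n * (1 / 2 * (integral ?J (?S (B n)) / \<bar>t\<bar> + \<bar>t\<bar> * integral ?J (?S (A n)))))) ?J"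
        by (intro has_integral_add has_integral_mult_right has_integral_divide integrable_integral a b)
      then show ?thesis by (rule integral_unique)
    qed
    also have "\<dots> \<le> 3 / 2 * (2 ^ n * N) + \<kappa> ^ n * (1 / 2 * (2 ^ n * (16 / 5 * \<bar>t\<bar>\<^sup>2 * N) / \<bar>t\<bar> + \<bar>t\<bar> * (2 ^ n * N)))"
    proof -
      have SA: "integral ?J (?S (A n)) \<le> 2 ^ n * N"
        by (rule order_trans[OF integral_symmetric_le[of "\<lambda>x. (A n x)\<^sup>2"] A_square_le]) (intro continuous_intros A_cont, simp)
      have "integral ?J (?S (B n)) \<le> 2 ^ n * (8 / 5 * (cmod s)\<^sup>2 * N)"
        by (rule order_trans[OF integral_symmetric_le[of "\<lambda>x. (B n x)\<^sup>2"] B_square_le]) (intro continuous_intros B_cont, simp)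
      \<comment> \<open>This holds by \<sigma> \<le> 1 \<le> |t|. It doubles 8/5 to 16/5, and (16/5
        + 1) / 2 = 21/10 is the constant of the lemma.\<close>
      also have "(cmod s)\<^sup>2 \<le> 2 * \<bar>t\<bar>\<^sup>2"
      proof -
        have "\<sigma>\<^sup>2 \<le> 1\<^sup>2" using \<sigma> s1 by (intro power_mono) auto
        moreover have "1\<^sup>2 \<le> \<bar>t\<bar>\<^sup>2" using t by (intro power_mono) auto
        ultimately show ?thesis by (simp add: cmod_power2)
      qed
      then have "2 ^ n * (8 / 5 * (cmod s)\<^sup>2 * N) \<le> 2 ^ n * (8 / 5 * (2 * \<bar>t\<bar>\<^sup>2) * N)"
        using N_nonneg by (intro mult_left_mono mult_right_mono) auto
      finally have SB: "integral ?J (?S (B n)) \<le> 2 ^ n * (16 / 5 * \<bar>t\<bar>\<^sup>2 * N)" by simp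
      show ?thesis
        using SA SB k0 by (intro add_mono mult_left_mono divide_right_mono) auto
    qed
    also have "\<dots> = 3 / 2 * (2 ^ n * N) + \<kappa> ^ n * (21 / 10 * \<bar>t\<bar> * (2 ^ n * N))"
      using t by (simp add: field_simps power2_eq_square)
    finally show "integral ?J H \<le> 3 / 2 * (2 ^ n * N) + \<kappa> ^ n * (21 / 10 * \<bar>t\<bar> * (2 ^ n * N))" .
  qed (use osc_const_nonneg in simp)
  also have "\<dots> = osc_const * (3 / 2 * 2 ^ n / \<bar>t\<bar> + 21 / 10 * (2 * \<kappa>) ^ n) * N"
    using t by (simp add: field_simps power_mult_distrib)
  finally show ?thesis .
qed

text \<open>At a maximum point of |u| each of the two terms of the eigenvalue equation has weight (2
  q)^(-\<sigma>) < 1/2, because q > 1 and \<sigma> \<ge> 1; hence the maximum is 0.\<close>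

lemma zero_if_large_real_part:
  assumes "1 \<le> \<sigma>" "x \<in> I"
  shows "u x = 0"
proof -
  have "continuous_on I (\<lambda>x. cmod (u x))" by (intro continuous_intros u_cont)
  then obtain x0 where x0: "x0 \<in> I" "\<And>y. y \<in> I \<Longrightarrow> cmod (u y) \<le> cmod (u x0)"
    using continuous_attains_sup[of I "\<lambda>x. cmod (u x)"] zeta_gt by auto
  have q2: "ln 2 < ln (2 * q x0)" using q_bounds[OF x0(1)] by simp
  then have "0 \<le> ln (2 * q x0)" using ln_ge_zero[of 2] by linarith
  then have "1 * ln (2 * q x0) \<le> \<sigma> * ln (2 * q x0)" using assms(1) by (intro mult_right_mono)
  then have "exp (\<sigma> * - ln (2 * q x0)) < exp (- ln 2)" using q2 by simp
  then have e: "exp (\<sigma> * - ln (2 * q x0)) < 1 / 2" by (simp add: exp_minus)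
  have "cmod (u x0) = exp (\<sigma> * - ln (2 * q x0)) * cmod (u (q x0) + u (- q x0))"
    using eigen[OF x0(1)] norm_exp_s[of "- ln (2 * q x0)"] by (simp add: norm_mult)
  also have "\<dots> \<le> exp (\<sigma> * - ln (2 * q x0)) * (2 * cmod (u x0))"
    using norm_triangle_ineq[of "u (q x0)" "u (- q x0)"] x0(2)[OF q_mem(1)[OF x0(1)]] x0(2)[OF q_mem(2)[OF x0(1)]]
    by (intro mult_left_mono) auto
  finally have "(1 - 2 * exp (\<sigma> * - ln (2 * q x0))) * cmod (u x0) \<le> 0" by (simp add: algebra_simps)
  moreover have "0 < 1 - 2 * exp (\<sigma> * - ln (2 * q x0))" using e by simp
  ultimately have "cmod (u x0) \<le> 0" by (simp add: mult_le_0_iff)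
  then show ?thesis using x0(2)[OF assms(2)] by simp
qed

end

section \<open>Zeros of the dynamical zeta function\<close>

context quadratic_family
begin

lemma g_plus_of_real: "x \<in> I \<Longrightarrow> g_plus c (of_real x) = of_real (q x)"
  using shift_bounds[of x] by (simp add: g_plus_def q_def flip: of_real_diff)

lemma abs_deriv_pow_of_real:
  assumes x: "x \<in> I"
  shows "abs_deriv_pow c s (of_real x) = exp (s * of_real (- ln (2 * q x)))"
proof -
  have q: "0 < q x" using q_bounds[OF x] by simp
  have "abs_deriv_ext c (of_real x) = of_real (1 / (2 * q x))"
    by (simp add: abs_deriv_ext_eq g_plus_of_real[OF x])
  moreover have "Ln (of_real (1 / (2 * q x))) = of_real (ln (1 / (2 * q x)))"
    using q by (intro Ln_of_real) simp
  moreover have "ln (1 / (2 * q x)) = - ln (2 * q x)" using q by (simp add: ln_div)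
  ultimately show ?thesis by (simp add: abs_deriv_pow_def)
qed

lemma log_deriv_has_derivative:
  assumes z: "z \<in> ball 0 R"
  shows "(log_deriv has_field_derivative - 1 / (2 * (z - of_real c))) (at z)"
proof -
  let ?g = "g_plus c z"
  have g: "?g \<noteq> 0" "?g\<^sup>2 = z - of_real c" using g_plus_nonzero[OF z] g_plus_squared by auto
  have ext: "abs_deriv_ext c z \<notin> \<real>\<^sub>\<le>\<^sub>0"
  proof -
    have "Re (abs_deriv_ext c z) > 0"
      using Re_g_plus_pos[OF z] by (auto simp: abs_deriv_ext_eq Re_divide intro!: divide_pos_pos add_pos_nonneg)
    then show ?thesis by (auto simp: complex_nonpos_Reals_iff)
  qed
  have "(abs_deriv_ext c has_field_derivative - 1 / (4 * ?g ^ 3)) (at z)"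
    unfolding abs_deriv_ext_eq[abs_def] using g(1)
    by (auto intro!: derivative_eq_intros g_plus_has_field_derivative[OF z] simp: power3_eq_cube field_simps)
  from DERIV_chain2[OF has_field_derivative_Ln[OF ext] this]
  have "(log_deriv has_field_derivative inverse (abs_deriv_ext c z) * (- 1 / (4 * ?g ^ 3))) (at z)"
    unfolding log_deriv_def[abs_def] .
  moreover have "inverse (abs_deriv_ext c z) * (- 1 / (4 * ?g ^ 3)) = - 1 / (2 * ?g\<^sup>2)"
    using g(1) by (simp add: abs_deriv_ext_eq field_simps power3_eq_cube power2_eq_square)
  ultimately show ?thesis by (simp add: g(2))
qed

text \<open>The interval \<open>I\<close> lies in the disc of radius \<open>\<rho>\<close>, where
  the eigenvalue equation holds and may be differentiated. The restriction cannot vanish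
  identically: 0 is a limit point of the interval, so by the identity theorem \<open>v\<close> would
  be zero.\<close>

lemma zero_imp_real_eigenfunction:
  assumes zero: "dyn_zeta c R s = 0" and s: "1 / 2 \<le> Re s"
  obtains u u' x where "eigenfunction c R s u u'" "x \<in> I" "u x \<noteq> 0"
proof -
  obtain v where v: "v holomorphic_on ball 0 \<rho>" "\<exists>z\<in>ball 0 \<rho>. v z \<noteq> 0"
    and veq: "\<And>z. z \<in> ball 0 \<rho> \<Longrightarrow> v z = abs_deriv_pow c s z * (v (g_plus c z) + v (g_minus c z))"
    using dyn_zeta_zero_imp_eigenfunction[OF zero] by blast
  have I_ball: "of_real x \<in> ball (0::complex) \<rho>" if "x \<in> I" for x
    using that zeta_less_r0 radii by auto
  have sub: "ball 0 \<rho> \<subseteq> ball (0::complex) R" using radii by auto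
  have dv: "(v has_field_derivative deriv v z) (at z)" if "z \<in> ball 0 \<rho>" for z
    by (rule holomorphic_derivI[OF v(1) open_ball that])
  have g_ball: "g_plus c z \<in> ball 0 \<rho>" "g_minus c z \<in> ball 0 \<rho>" if "z \<in> ball 0 \<rho>" for z
    using norm_branch_le[of z] that r1 radii by auto
  have deq: "deriv v z = - s / (2 * (z - of_real c)) * v z
      + abs_deriv_pow c s z * (deriv v (g_plus c z) - deriv v (g_minus c z)) / (2 * g_plus c z)" if z: "z \<in> ball 0 \<rho>" for z
  proof -
    have zR: "z \<in> ball 0 R" using z sub by blast
    define P where "P = abs_deriv_pow c s z"
    have "((\<lambda>z. abs_deriv_pow c s z) has_field_derivative P * (s * (- 1 / (2 * (z - of_real c))))) (at z)"
      unfolding P_def abs_deriv_pow_eq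
      by (rule DERIV_chain2[OF DERIV_exp DERIV_cmult[OF log_deriv_has_derivative[OF zR]]])
    moreover have "((\<lambda>z. v (g_plus c z) + v (g_minus c z)) has_field_derivative
        deriv v (g_plus c z) * (1 / (2 * g_plus c z)) + deriv v (g_minus c z) * (1 / (2 * g_minus c z))) (at z)"
      by (intro DERIV_add DERIV_chain2[OF dv[OF g_ball(1)[OF z]] g_plus_has_field_derivative[OF zR]]
          DERIV_chain2[OF dv[OF g_ball(2)[OF z]] g_minus_has_field_derivative[OF zR]])
    ultimately have d: "((\<lambda>z. abs_deriv_pow c s z * (v (g_plus c z) + v (g_minus c z))) has_field_derivative
        P * (s * (- 1 / (2 * (z - of_real c)))) * (v (g_plus c z) + v (g_minus c z))
        + (deriv v (g_plus c z) * (1 / (2 * g_plus c z)) + deriv v (g_minus c z) * (1 / (2 * g_minus c z))) * P) (at z)"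
      unfolding P_def by (rule DERIV_mult)
    have "(v has_field_derivative
        P * (s * (- 1 / (2 * (z - of_real c)))) * (v (g_plus c z) + v (g_minus c z))
        + (deriv v (g_plus c z) * (1 / (2 * g_plus c z)) + deriv v (g_minus c z) * (1 / (2 * g_minus c z))) * P) (at z)"
      by (rule has_field_derivative_transform_within_open[OF d open_ball z]) (rule veq[symmetric])
    then have "deriv v z = P * (s * (- 1 / (2 * (z - of_real c)))) * (v (g_plus c z) + v (g_minus c z))
        + (deriv v (g_plus c z) * (1 / (2 * g_plus c z)) + deriv v (g_minus c z) * (1 / (2 * g_minus c z))) * P"
      by (rule DERIV_imp_deriv)
    also have "P * (s * (- 1 / (2 * (z - of_real c)))) * (v (g_plus c z) + v (g_minus c z))
        = - s / (2 * (z - of_real c)) * (P * (v (g_plus c z) + v (g_minus c z)))"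
      by simp
    also have "P * (v (g_plus c z) + v (g_minus c z)) = v z" unfolding P_def by (rule veq[OF z, symmetric])
    also have "(deriv v (g_plus c z) * (1 / (2 * g_plus c z)) + deriv v (g_minus c z) * (1 / (2 * g_minus c z))) * P
        = P * (deriv v (g_plus c z) - deriv v (g_minus c z)) / (2 * g_plus c z)"
      by (simp add: g_minus_eq diff_divide_distrib algebra_simps)
    finally show ?thesis unfolding P_def .
  qed
  have g_minus_of_real: "g_minus c (of_real x) = of_real (- q x)" if "x \<in> I" for x
    using g_plus_of_real[OF that] by (simp add: g_minus_eq)
  define u where "u = (\<lambda>x::real. v (of_real x))"
  define u' where "u' = (\<lambda>x::real. deriv v (of_real x))"
  have eig: "eigenfunction c R s u u'"
  proof
    show "1 / 2 \<le> Re s" by (rule s)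
    show "continuous_on I u'"
      unfolding u'_def
      by (rule continuous_on_compose2[OF holomorphic_on_imp_continuous_on[OF holomorphic_deriv[OF v(1) open_ball]]])
         (use I_ball in \<open>auto intro!: continuous_intros\<close>)
    fix x assume x: "x \<in> I"
    have "((v \<circ> complex_of_real) has_vector_derivative (1 * deriv v (of_real x))) (at x within I)"
    proof (rule field_vector_diff_chain_within)
      show "(complex_of_real has_vector_derivative 1) (at x within I)"
        by (rule has_vector_derivative_of_real[of "\<lambda>x. x" 1, simplified])
      show "(v has_field_derivative deriv v (of_real x)) (at (of_real x) within complex_of_real ` I)"
        by (rule has_field_derivative_at_within[OF dv[OF I_ball[OF x]]])
    qed
    then show "(u has_vector_derivative u' x) (at x within I)" by (simp add: u_def u'_def o_def)
    show "u x = exp (s * of_real (- ln (2 * q x))) * (u (q x) + u (- q x))"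
      unfolding u_def abs_deriv_pow_of_real[OF x, symmetric] g_plus_of_real[OF x, symmetric] g_minus_of_real[OF x, symmetric]
      by (rule veq[OF I_ball[OF x]])
    have r: "complex_of_real (2 * (x - c)) = 2 * (of_real x - of_real c)" "complex_of_real (2 * q x) = 2 * g_plus c (of_real x)"
      using g_plus_of_real[OF x] by simp_all
    show "u' x = - s / of_real (2 * (x - c)) * u x
        + exp (s * of_real (- ln (2 * q x))) * (u' (q x) - u' (- q x)) / of_real (2 * q x)"
      unfolding r u_def u'_def abs_deriv_pow_of_real[OF x, symmetric] g_plus_of_real[OF x, symmetric] g_minus_of_real[OF x, symmetric]
      by (rule deq[OF I_ball[OF x]])
  qed
  have "\<exists>x\<in>I. u x \<noteq> 0"
  proof (rule ccontr)
    assume "\<not> ?thesis"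
    then have u0: "v z = 0" if "z \<in> complex_of_real ` I" for z using that by (auto simp: u_def)
    have lim: "0 islimpt (complex_of_real ` I)"
      unfolding islimpt_approachable
    proof (intro allI impI)
      fix e :: real assume e: "0 < e"
      let ?x = "min (e / 2) 1"
      have "?x \<in> I" "?x \<noteq> 0" "\<bar>?x\<bar> < e" using e zeta_gt by auto
      then show "\<exists>x'\<in>complex_of_real ` I. x' \<noteq> 0 \<and> dist x' 0 < e"
        by (intro bexI[of _ "of_real ?x"]) (simp_all only: dist_norm diff_zero norm_of_real of_real_eq_0_iff simp_thms imageI)
    qed
    have "v w = 0" if "w \<in> ball 0 \<rho>" for w
      by (rule analytic_continuation[OF v(1) open_ball connected_ball _ _ lim u0 that]) (use I_ball radii in auto)
    then show False using v(2) by blast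
  qed
  then show thesis using that[OF eig] by blast
qed

lemma zeros_bounded:
  assumes \<epsilon>: "0 < \<epsilon>"
  obtains T where "\<And>s. 1 / 2 + \<epsilon> < Re s \<Longrightarrow> dyn_zeta c R s = 0 \<Longrightarrow> Re s < 1 \<and> \<bar>Im s\<bar> < T"
proof -
  \<comment> \<open>The factor in front of \<open>N\<close> for real part 1/2 + \<epsilon>. It is
    smaller for larger real parts, so one value serves the whole half plane.\<close>
  define \<theta> where "\<theta> = exp (- (2 * \<epsilon>) * ln (2 * m))"
  have l: "0 < ln (2 * m)" using m_gt_1 by simp
  have th: "\<theta> < 1" using \<epsilon> l by (simp add: \<theta>_def)
  have "(\<lambda>n. 2 * osc_const * (21 / 10 * (2 * \<kappa>) ^ n)) \<longlonglongrightarrow> 2 * osc_const * (21 / 10 * 0)"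
    using m_gt_1 by (intro tendsto_intros LIMSEQ_power_zero) (simp add: \<kappa>_def)
  then have "\<forall>\<^sub>F n in sequentially. 2 * osc_const * (21 / 10 * (2 * \<kappa>) ^ n) < (1 - \<theta>) / 2"
    by (rule order_tendstoD) (use th in simp)
  then have "\<forall>\<^sub>F n in sequentially. 2 * osc_const * (21 / 10 * (2 * \<kappa>) ^ n) < (1 - \<theta>) / 2 \<and> 0 < n"
    using eventually_gt_at_top[of 0] by (rule eventually_conj)
  then obtain n where n: "2 * osc_const * (21 / 10 * (2 * \<kappa>) ^ n) < (1 - \<theta>) / 2" "0 < n"
    by (auto simp: eventually_sequentially)
  define K where "K = 2 * osc_const * (3 / 2 * 2 ^ n)"
  have K: "0 \<le> K" using osc_const_nonneg by (simp add: K_def)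
  \<comment> \<open>Makes \<open>K / T\<close> less than \<open>(1 - \<theta>) / 2\<close>, the
    other half being spent on the choice of \<open>n\<close>; the summand 1 ensures
    \<open>1 \<le> T\<close>, which \<open>cross_bound\<close> asks of |t|.\<close>
  define T where "T = 1 + 2 * K / (1 - \<theta>)"
  have T: "1 \<le> T" "K / T < (1 - \<theta>) / 2"
  proof -
    show "1 \<le> T" using K th by (simp add: T_def)
    then have "0 < T" by simp
    have "(1 - \<theta>) * T = (1 - \<theta>) + 2 * K" using th by (simp add: T_def distrib_left)
    then have "K < (1 - \<theta>) / 2 * T" using th by simp
    then show "K / T < (1 - \<theta>) / 2" using \<open>0 < T\<close> by (simp only: pos_divide_less_eq)
  qed
  show thesis
  proof (rule that)
    fix s assume s: "1 / 2 + \<epsilon> < Re s" and zero: "dyn_zeta c R s = 0"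
    have s2: "1 / 2 \<le> Re s" using s \<epsilon> by simp
    obtain u u' x where eig: "eigenfunction c R s u u'" and x: "x \<in> I" "u x \<noteq> 0"
      using zero_imp_real_eigenfunction[OF zero s2] by blast
    interpret eigenfunction c R s u u' by (rule eig)
    have s1: "Re s < 1" using zero_if_large_real_part[OF _ x(1)] x(2) by force
    moreover have "\<bar>Im s\<bar> < T"
    proof (rule ccontr)
      assume "\<not> \<bar>Im s\<bar> < T"
      then have t: "T \<le> \<bar>Im s\<bar>" by simp
      have "N \<noteq> 0" using N_eq_0D[OF _ x(1)] x(2) by blast
      then have N: "0 < N" using N_nonneg by simp
      have "exp (- (2 * Re s - 1) * ln (2 * m)) \<le> \<theta>"
        unfolding \<theta>_def exp_le_cancel_iff using s l by (intro mult_right_mono) auto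
      then have "(1 - \<theta>) * N \<le> (1 - exp (- (2 * Re s - 1) * ln (2 * m))) * N"
        using N by (intro mult_right_mono) auto
      also have "\<dots> \<le> 2 * cmod cross" by (rule N_le_cross)
      also have "cmod cross \<le> osc_const * (3 / 2 * 2 ^ n / \<bar>Im s\<bar> + 21 / 10 * (2 * \<kappa>) ^ n) * N"
        by (rule cross_bound[OF n(2)]) (use t T s1 in auto)
      then have "2 * cmod cross \<le> (K / \<bar>Im s\<bar> + 2 * osc_const * (21 / 10 * (2 * \<kappa>) ^ n)) * N"
        by (simp add: K_def algebra_simps)
      also have "\<dots> < (1 - \<theta>) * N"
      proof (rule mult_strict_right_mono[OF _ N])
        have "K / \<bar>Im s\<bar> \<le> K / T" using K t T by (intro divide_left_mono) auto
        then have "K / \<bar>Im s\<bar> < (1 - \<theta>) / 2" using T(2) by (rule le_less_trans)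
        from add_strict_mono[OF this n(1)]
        show "K / \<bar>Im s\<bar> + 2 * osc_const * (21 / 10 * (2 * \<kappa>) ^ n) < 1 - \<theta>" by (simp only: field_sum_of_halves)
      qed
      finally show False by simp
    qed
    ultimately show "Re s < 1 \<and> \<bar>Im s\<bar> < T" by blast
  qed
qed

text \<open>The zeros in question lie in a bounded box, and a nonconstant entire function has
  finitely many zeros in a compact set. If the function is constant, its nonvanishing for real parts
  at least 1 excludes zeros altogether.\<close>

theorem finitely_many_zeros:
  assumes \<epsilon>: "0 < \<epsilon>"
  shows "finite {s. 1 / 2 + \<epsilon> < Re s \<and> dyn_zeta c R s = 0}"
proof -
  obtain T where T: "\<And>s. 1 / 2 + \<epsilon> < Re s \<Longrightarrow> dyn_zeta c R s = 0 \<Longrightarrow> Re s < 1 \<and> \<bar>Im s\<bar> < T"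
    using zeros_bounded[OF \<epsilon>] by blast
  let ?Z = "{s. 1 / 2 + \<epsilon> < Re s \<and> dyn_zeta c R s = 0}"
  show ?thesis
  proof (cases "dyn_zeta c R constant_on UNIV")
    case True
    have "dyn_zeta c R (of_real (2 + \<epsilon>)) \<noteq> 0" using T[of "of_real (2 + \<epsilon>)"] \<epsilon> by auto
    then have eq: "?Z = {}" using True by (auto simp: constant_on_def)
    show ?thesis unfolding eq by simp
  next
    case False
    have "finite {s \<in> cball 0 (1 + T). dyn_zeta c R s = 0}"
      by (rule holomorphic_compact_finite_zeros[OF dyn_zeta_holomorphic open_UNIV connected_UNIV compact_cball _ False]) simp
    moreover have "?Z \<subseteq> {s \<in> cball 0 (1 + T). dyn_zeta c R s = 0}"
    proof
      fix s assume s: "s \<in> ?Z"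
      then have "Re s < 1" "\<bar>Im s\<bar> < T" "0 < Re s" using T[of s] \<epsilon> by auto
      then show "s \<in> {s \<in> cball 0 (1 + T). dyn_zeta c R s = 0}"
        using s cmod_le[of s] by simp
    qed
    ultimately show ?thesis by (rule finite_subset[rotated])
  qed
qed

end

theorem corollary1p2:
  fixes c R \<epsilon> :: real
  assumes "c < - 3.75"
    and "zeta_fix c < R" and "R < - c"
    and "\<epsilon> > 0"
  shows "finite {s :: complex. Re s > 1 / 2 + \<epsilon> \<and> dyn_zeta c R s = 0}"
proof -
  interpret quadratic_family c R
    by unfold_locales (use assms in auto)
  show ?thesis by (rule finitely_many_zeros[OF assms(4)])
qed

end
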